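(* Let $n\ge1$ and let $M(\mathcal{C}_n)$ be the complement of the Weyl type C toric arrangement in $(\mathbb{C}^\times)^n$. Let $\mathsf{E}_n$ be the exterior algebra over $\mathbb{Z}$ generated by the degree one classes $z_i,\rho_i,\eta_i$ ($1\le i\le n$) and $\alpha_{i,j},\beta_{i,j}$ ($1\le i<j\le n$). Then the integral cohomology ring $H^*(M(\mathcal{C}_n);\mathbb{Z})$ is isomorphic to the quotient $\mathsf{E}_n/\mathsf{I}_n$ of $\mathsf{E}_n$ by the ideal $\mathsf{I}_n$ generated by the following elements, for $1\le i,j,k\le n$ with $i<j$, respectively $i<j<k$, where relevant: $$z_i\rho_i,\qquad z_i\eta_i,\qquad\rho_i\eta_i,$$ $$(z_j-z_i)(\alpha_{i,j}-z_i),\quad(\rho_j-\rho_i)(\alpha_{i,j}-\rho_i),\quad(\eta_j-\eta_i)(\alpha_{i,j}-\eta_i),$$ $$(z_j+z_i)\beta_{i,j},\quad(\rho_j+z_i-\rho_i)(\beta_{i,j}-\rho_i),\quad(\eta_j+z_i-\eta_i)(\beta_{i,j}-\eta_i),$$ $$(\alpha_{i,j}+z_i-\rho_i-\eta_i)(\beta_{i,j}-\rho_i-\eta_i),$$ $$(\alpha_{i,k}-\alpha_{i,j})(\alpha_{j,k}-\alpha_{i,j}),\qquad(\alpha_{i,k}+z_j-\beta_{i,j})(\beta_{j,k}-\beta_{i,j}),$$ $$(\beta_{i,k}-\beta_{i,j})(\alpha_{j,k}+z_i-\beta_{i,j}),\qquad(\beta_{i,k}+z_j-\alpha_{i,j}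)(\beta_{j,k}+z_i-\alpha_{i,j}).$$
   Context: $M(\mathcal{C}_n)$ is the set of $(x_1,\dots,x_n)\in(\mathbb{C}^\times)^n$ with $x_i\ne1$, $x_i\ne-1$ for $1\le i\le n$ and $x_j\ne x_i$, $x_ix_j\ne1$ for $1\le i<j\le n$. The generators are the classes in $H^1(M(\mathcal{C}_n);\mathbb{Z})$, which is free abelian with these classes as basis, of the logarithmic forms $z_i=\frac{1}{2\pi\sqrt{-1}}\mathrm{dlog}(x_i)$, $\rho_i=\frac{1}{2\pi\sqrt{-1}}\mathrm{dlog}(x_i-1)$, $\eta_i=\frac{1}{2\pi\sqrt{-1}}\mathrm{dlog}(x_i+1)$, $\alpha_{i,j}=\frac{1}{2\pi\sqrt{-1}}\mathrm{dlog}(x_j-x_i)$, $\beta_{i,j}=\frac{1}{2\pi\sqrt{-1}}\mathrm{dlog}(x_ix_j-1)$; thus $\mathsf{E}_n=\bigwedge H^1(M(\mathcal{C}_n);\mathbb{Z})$. *)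

theory Defs
  imports "HOL-Homology.Homology" "HOL-Complex_Analysis.Complex_Analysis" "HOL-Algebra.QuotRing"
begin

section \<open>Integral singular cohomology ring\<close>

text \<open>
  A total cochain is a family of integral cochains, one in each degree.  A \<open>p\<close>-cochain is given
  by its values on singular \<open>p\<close>-simplices, normalised to be \<open>0\<close> outside them so that equality of
  functions is equality of cochains.
\<close>

type_synonym 'a cochain = "nat \<Rightarrow> ((nat \<Rightarrow> real) \<Rightarrow> 'a) \<Rightarrow> int"

definition total_cochains :: "'a topology \<Rightarrow> 'a cochain set" where
  "total_cochains X =
     {\<phi>. (\<forall>p \<sigma>. \<not> singular_simplex p X \<sigma> \<longrightarrow> \<phi> p \<sigma> = 0) \<and> finite {p. \<phi> p \<noteq> (\<lambda>\<sigma>. 0)}}"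

definition cochain_eval :: "(((nat \<Rightarrow> real) \<Rightarrow> 'a) \<Rightarrow> int) \<Rightarrow> 'a chain \<Rightarrow> int" where
  "cochain_eval \<phi> c = (\<Sum>\<sigma>\<in>Poly_Mapping.keys c. Poly_Mapping.lookup c \<sigma> * \<phi> \<sigma>)"

text \<open>For \<open>p = 0\<close> the value below is \<open>0\<close>, because \<^const>\<open>chain_boundary\<close> vanishes in degree \<open>0\<close>.\<close>

definition coboundary :: "'a topology \<Rightarrow> 'a cochain \<Rightarrow> 'a cochain" where
  "coboundary X \<phi> = (\<lambda>p \<sigma>. if singular_simplex p X \<sigma>
                            then cochain_eval (\<phi> (p - 1)) (chain_boundary p (frag_of \<sigma>)) else 0)"

text \<open>
  The front \<open>p\<close>-face is spanned by the vertices \<open>0, \<dots>, p\<close>; since \<^const>\<open>standard_simplex\<close> lives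
  in sequences with trailing zeros, this is plain restriction.  The back \<open>q\<close>-face of a
  \<open>(p + q)\<close>-simplex is spanned by the vertices \<open>p, \<dots>, p + q\<close>.
\<close>

definition front_face :: "nat \<Rightarrow> ((nat \<Rightarrow> real) \<Rightarrow> 'a) \<Rightarrow> (nat \<Rightarrow> real) \<Rightarrow> 'a" where
  "front_face p \<sigma> = restrict \<sigma> (standard_simplex p)"

definition back_face :: "nat \<Rightarrow> nat \<Rightarrow> ((nat \<Rightarrow> real) \<Rightarrow> 'a) \<Rightarrow> (nat \<Rightarrow> real) \<Rightarrow> 'a" where
  "back_face p q \<sigma> =
     restrict (\<lambda>v. \<sigma> (\<lambda>i. if i < p then 0 else v (i - p))) (standard_simplex q)"

definition cup :: "'a topology \<Rightarrow> 'a cochain \<Rightarrow> 'a cochain \<Rightarrow> 'a cochain" where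
  "cup X \<phi> \<psi> = (\<lambda>m \<sigma>. if singular_simplex m X \<sigma>
                       then \<Sum>p\<le>m. \<phi> p (front_face p \<sigma>) * \<psi> (m - p) (back_face p (m - p) \<sigma>)
                       else 0)"

definition cocycle_ring :: "'a topology \<Rightarrow> 'a cochain ring" where
  "cocycle_ring X =
     \<lparr> carrier = {\<phi> \<in> total_cochains X. coboundary X \<phi> = (\<lambda>p \<sigma>. 0)},
       monoid.mult = cup X,
       one = (\<lambda>p \<sigma>. if p = 0 \<and> singular_simplex 0 X \<sigma> then 1 else 0),
       zero = (\<lambda>p \<sigma>. 0),
       add = (\<lambda>\<phi> \<psi> p \<sigma>. \<phi> p \<sigma> + \<psi> p \<sigma>) \<rparr>"

definition coboundaries :: "'a topology \<Rightarrow> 'a cochain set" where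
  "coboundaries X = coboundary X ` total_cochains X"

definition cohomology_ring :: "'a topology \<Rightarrow> 'a cochain set ring" where
  "cohomology_ring X = cocycle_ring X Quot coboundaries X"


section \<open>Exterior algebra of the free abelian group on a set\<close>

text \<open>
  The tensor algebra of the free abelian group on \<open>S\<close> consists of the integral linear
  combinations of words over \<open>S\<close>, multiplied by concatenation.
\<close>

definition tensor_algebra :: "'g set \<Rightarrow> ('g list \<Rightarrow>\<^sub>0 int) ring" where
  "tensor_algebra S =
     \<lparr> carrier = {a. Poly_Mapping.keys a \<subseteq> lists S},
       monoid.mult = (\<lambda>a b. frag_extend (\<lambda>u. frag_extend (\<lambda>w. frag_of (u @ w)) b) a),
       one = frag_of [],
       zero = 0,
       add = (+) \<rparr>"

definition square_ideal :: "'g set \<Rightarrow> ('g list \<Rightarrow>\<^sub>0 int) set" where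
  "square_ideal S =
     genideal (tensor_algebra S)
       {v \<otimes>\<^bsub>tensor_algebra S\<^esub> v | v. Poly_Mapping.keys v \<subseteq> {[g] | g. g \<in> S}}"

definition exterior_algebra :: "'g set \<Rightarrow> ('g list \<Rightarrow>\<^sub>0 int) set ring" where
  "exterior_algebra S = tensor_algebra S Quot square_ideal S"

definition exterior_gen :: "'g set \<Rightarrow> 'g \<Rightarrow> ('g list \<Rightarrow>\<^sub>0 int) set" where
  "exterior_gen S g = square_ideal S +>\<^bsub>tensor_algebra S\<^esub> frag_of [g]"


section \<open>The complement of the toric arrangement of type C\<close>

definition M_C :: "nat \<Rightarrow> (nat \<Rightarrow> complex) topology" where
  "M_C n = subtopology (product_topology (\<lambda>i. euclidean) {1..n})
     {x. (\<forall>i\<in>{1..n}. x i \<noteq> 0 \<and> x i \<noteq> 1 \<and> x i \<noteq> -1) \<and>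
         (\<forall>i\<in>{1..n}. \<forall>j\<in>{1..n}. i < j \<longrightarrow> x j \<noteq> x i \<and> x i * x j \<noteq> 1)}"

datatype generator = Z nat | Rho nat | Eta nat | Alpha nat nat | Beta nat nat

definition gens :: "nat \<Rightarrow> generator set" where
  "gens n = Z ` {1..n} \<union> Rho ` {1..n} \<union> Eta ` {1..n}
          \<union> {Alpha i j | i j. 1 \<le> i \<and> i < j \<and> j \<le> n}
          \<union> {Beta i j | i j. 1 \<le> i \<and> i < j \<and> j \<le> n}"

text \<open>The function \<open>f\<close> such that the generator stands for the class of \<open>dlog f / (2 \<pi> \<i>)\<close>.\<close>

fun log_arg :: "generator \<Rightarrow> (nat \<Rightarrow> complex) \<Rightarrow> complex" where
  "log_arg (Z i) x = x i"
| "log_arg (Rho i) x = x i - 1"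
| "log_arg (Eta i) x = x i + 1"
| "log_arg (Alpha i j) x = x j - x i"
| "log_arg (Beta i j) x = x i * x j - 1"

text \<open>The singular 1-simplex traversing a path; it runs from vertex \<open>0\<close> to vertex \<open>1\<close>.\<close>

definition path_simplex :: "(real \<Rightarrow> 'a) \<Rightarrow> (nat \<Rightarrow> real) \<Rightarrow> 'a" where
  "path_simplex \<gamma> = restrict (\<lambda>v. \<gamma> (v 1)) (standard_simplex 1)"

text \<open>
  An integral 1-cocycle represents the closed form \<open>dlog f / (2 \<pi> \<i>)\<close> if its value on each
  piecewise smooth loop \<open>\<gamma>\<close> is the integral of the form along \<open>\<gamma>\<close>, which is the integral of
  \<open>dw / (2 \<pi> \<i> w)\<close> along \<open>f \<circ> \<gamma>\<close>.  As the first integral cohomology group is dual to the first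
  homology group and the latter is generated by such loops, this determines the cohomology class.
\<close>

definition represents_dlog ::
  "(nat \<Rightarrow> complex) topology \<Rightarrow> ((nat \<Rightarrow> complex) \<Rightarrow> complex) \<Rightarrow> (nat \<Rightarrow> complex) cochain \<Rightarrow> bool"
where
  "represents_dlog X f c \<longleftrightarrow>
     c \<in> carrier (cocycle_ring X) \<and> (\<forall>p. p \<noteq> 1 \<longrightarrow> c p = (\<lambda>\<sigma>. 0)) \<and>
     (\<forall>\<gamma>. pathin X \<gamma> \<and> \<gamma> 0 = \<gamma> 1 \<and> (\<forall>i. valid_path (\<lambda>t. \<gamma> t i)) \<longrightarrow>
        of_int (c 1 (path_simplex \<gamma>))
          = contour_integral (f \<circ> \<gamma>) (\<lambda>w. 1 / (2 * of_real pi * \<i> * w)))"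

definition is_dlog_class ::
  "(nat \<Rightarrow> complex) topology \<Rightarrow> ((nat \<Rightarrow> complex) \<Rightarrow> complex) \<Rightarrow> (nat \<Rightarrow> complex) cochain set \<Rightarrow> bool"
where
  "is_dlog_class X f h \<longleftrightarrow>
     (\<exists>c. represents_dlog X f c \<and> h = coboundaries X +>\<^bsub>cocycle_ring X\<^esub> c)"

context
  fixes R :: "('r, 'm) ring_scheme" (structure)
    and z \<rho> \<eta> :: "nat \<Rightarrow> 'r"
    and \<alpha> \<beta> :: "nat \<Rightarrow> nat \<Rightarrow> 'r"
    and n :: nat
begin

inductive_set type_C_relations :: "'r set" where
  "\<lbrakk>1 \<le> i; i \<le> n\<rbrakk> \<Longrightarrow> z i \<otimes> \<rho> i \<in> type_C_relations"
| "\<lbrakk>1 \<le> i; i \<le> n\<rbrakk> \<Longrightarrow> z i \<otimes> \<eta> i \<in> type_C_relations"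
| "\<lbrakk>1 \<le> i; i \<le> n\<rbrakk> \<Longrightarrow> \<rho> i \<otimes> \<eta> i \<in> type_C_relations"
| "\<lbrakk>1 \<le> i; i < j; j \<le> n\<rbrakk> \<Longrightarrow> (z j \<ominus> z i) \<otimes> (\<alpha> i j \<ominus> z i) \<in> type_C_relations"
| "\<lbrakk>1 \<le> i; i < j; j \<le> n\<rbrakk> \<Longrightarrow> (\<rho> j \<ominus> \<rho> i) \<otimes> (\<alpha> i j \<ominus> \<rho> i) \<in> type_C_relations"
| "\<lbrakk>1 \<le> i; i < j; j \<le> n\<rbrakk> \<Longrightarrow> (\<eta> j \<ominus> \<eta> i) \<otimes> (\<alpha> i j \<ominus> \<eta> i) \<in> type_C_relations"
| "\<lbrakk>1 \<le> i; i < j; j \<le> n\<rbrakk> \<Longrightarrow> (z j \<oplus> z i) \<otimes> \<beta> i j \<in> type_C_relations"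
| "\<lbrakk>1 \<le> i; i < j; j \<le> n\<rbrakk> \<Longrightarrow> (\<rho> j \<oplus> z i \<ominus> \<rho> i) \<otimes> (\<beta> i j \<ominus> \<rho> i) \<in> type_C_relations"
| "\<lbrakk>1 \<le> i; i < j; j \<le> n\<rbrakk> \<Longrightarrow> (\<eta> j \<oplus> z i \<ominus> \<eta> i) \<otimes> (\<beta> i j \<ominus> \<eta> i) \<in> type_C_relations"
| "\<lbrakk>1 \<le> i; i < j; j \<le> n\<rbrakk> \<Longrightarrow>
     (\<alpha> i j \<oplus> z i \<ominus> \<rho> i \<ominus> \<eta> i) \<otimes> (\<beta> i j \<ominus> \<rho> i \<ominus> \<eta> i) \<in> type_C_relations"
| "\<lbrakk>1 \<le> i; i < j; j < k; k \<le> n\<rbrakk> \<Longrightarrow>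
     (\<alpha> i k \<ominus> \<alpha> i j) \<otimes> (\<alpha> j k \<ominus> \<alpha> i j) \<in> type_C_relations"
| "\<lbrakk>1 \<le> i; i < j; j < k; k \<le> n\<rbrakk> \<Longrightarrow>
     (\<alpha> i k \<oplus> z j \<ominus> \<beta> i j) \<otimes> (\<beta> j k \<ominus> \<beta> i j) \<in> type_C_relations"
| "\<lbrakk>1 \<le> i; i < j; j < k; k \<le> n\<rbrakk> \<Longrightarrow>
     (\<beta> i k \<ominus> \<beta> i j) \<otimes> (\<alpha> j k \<oplus> z i \<ominus> \<beta> i j) \<in> type_C_relations"
| "\<lbrakk>1 \<le> i; i < j; j < k; k \<le> n\<rbrakk> \<Longrightarrow>
     (\<beta> i k \<oplus> z j \<ominus> \<alpha> i j) \<otimes> (\<beta> j k \<oplus> z i \<ominus> \<alpha> i j) \<in> type_C_relations"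

end

definition E_C :: "nat \<Rightarrow> (generator list \<Rightarrow>\<^sub>0 int) set ring" where
  "E_C n = exterior_algebra (gens n)"

definition E_gen :: "nat \<Rightarrow> generator \<Rightarrow> (generator list \<Rightarrow>\<^sub>0 int) set" where
  "E_gen n = exterior_gen (gens n)"

definition I_C :: "nat \<Rightarrow> (generator list \<Rightarrow>\<^sub>0 int) set set" where
  "I_C n = genideal (E_C n)
     (type_C_relations (E_C n)
        (\<lambda>i. E_gen n (Z i)) (\<lambda>i. E_gen n (Rho i)) (\<lambda>i. E_gen n (Eta i))
        (\<lambda>i j. E_gen n (Alpha i j)) (\<lambda>i j. E_gen n (Beta i j)) n)"

end

theory Submission
  imports Defs "HOL-Library.Function_Algebras"
begin

text \<open>
  Everything is done with cochains.  A nowhere vanishing function \<open>f\<close> has an explicit integral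
  1-cocycle representing \<open>dlog f / (2 \<pi> \<i>)\<close>: winding along an edge, corrected by the principal
  branch of the logarithm at its ends.  It is additive in \<open>f\<close> up to coboundaries, and if \<open>f - g\<close> is a
  nonzero constant then the cup product of the cocycles of \<open>f\<close> and \<open>g\<close> vanishes in cohomology,
  being pulled back from a twice punctured plane.  Each defining relation has this form: for
  instance \<open>x\<^sub>j - x\<^sub>i\<close> and \<open>x\<^sub>i\<close> satisfy \<open>x\<^sub>j / x\<^sub>i - (x\<^sub>j - x\<^sub>i) / x\<^sub>i = 1\<close>.  This gives the ring map
  from the quotient of the exterior algebra to cohomology.

  Forgetting the last coordinate makes the arrangement complement in \<open>n + 1\<close> variables the
  complement of finitely many disjoint graphs over the one in \<open>n\<close> variables, with one generator of
  level \<open>n + 1\<close> for each graph.  Removing the graphs one at a time, Mayer--Vietoris shows that the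
  cohomology of the total space is free over that of the base on 1 and these generators.  Hence the
  words with at most one generator per level form an additive basis of the cohomology.  On the
  algebraic side the relations, which rewrite the product of two generators of the same level,
  show that the same words span the quotient, so the map is bijective.
\<close>

section \<open>Singular cochains and the cup product\<close>

text \<open>The cup product is not commutative on cochains, and graded commutativity of cohomology
  is never established. The ideal defining the exterior algebra is generated by squares of linear
  tensors, so it suffices that an integral cocycle of degree one squares to a coboundary;
  anticommutation of generators is then obtained by polarisation on the algebraic side. In the same
  spirit the Leray--Hirsch sums keep the fibre classes to the left of the classes from the base, so
  that nothing has to be moved past anything else. Homotopy and subdivision act on chains, whereas
  the theorem concerns integral cochains. The bridge is a contraction of the free complex of
  relative chains, chosen simplex by simplex; composing a cocycle with it produces a primitive over
  the integers. The additive comparison needs no independence statement on the algebraic side: the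
  same finite set of words spans the quotient and maps to a basis of cohomology, which forces it to
  be a basis of the quotient and the map to be injective.\<close>

lemma cochain_eval_mono:
  assumes "finite S" "Poly_Mapping.keys c \<subseteq> S"
  shows "cochain_eval \<phi> c = (\<Sum>\<sigma>\<in>S. Poly_Mapping.lookup c \<sigma> * \<phi> \<sigma>)"
  unfolding cochain_eval_def
  by (rule sum.mono_neutral_left) (use assms in \<open>auto simp: in_keys_iff\<close>)

lemma cochain_eval_0 [simp]: "cochain_eval \<phi> 0 = 0"
  by (simp add: cochain_eval_def)

lemma cochain_eval_of [simp]: "cochain_eval \<phi> (frag_of \<sigma>) = \<phi> \<sigma>"
  by (simp add: cochain_eval_def)

lemma cochain_eval_add: "cochain_eval \<phi> (a + b) = cochain_eval \<phi> a + cochain_eval \<phi> b"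
proof -
  let ?S = "Poly_Mapping.keys a \<union> Poly_Mapping.keys b"
  have "cochain_eval \<phi> c = (\<Sum>\<sigma>\<in>?S. Poly_Mapping.lookup c \<sigma> * \<phi> \<sigma>)" if "c \<in> {a, b, a + b}" for c
    by (rule cochain_eval_mono) (use that Poly_Mapping.keys_add[of a b] in auto)
  then show ?thesis
    by (simp add: lookup_add distrib_right sum.distrib)
qed

lemma cochain_eval_cmul: "cochain_eval \<phi> (frag_cmul k c) = k * cochain_eval \<phi> c"
proof -
  have "cochain_eval \<phi> (frag_cmul k c) = (\<Sum>\<sigma>\<in>Poly_Mapping.keys c. Poly_Mapping.lookup (frag_cmul k c) \<sigma> * \<phi> \<sigma>)"
    by (rule cochain_eval_mono) (use keys_cmul in auto)
  then show ?thesis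
    by (simp add: cochain_eval_def sum_distrib_left mult.assoc)
qed

lemma cochain_eval_diff: "cochain_eval \<phi> (a - b) = cochain_eval \<phi> a - cochain_eval \<phi> b"
  using cochain_eval_add[of \<phi> "a - b" b] by simp

lemma cochain_eval_sum: "cochain_eval \<phi> (sum c I) = (\<Sum>i\<in>I. cochain_eval \<phi> (c i))"
  by (induction I rule: infinite_finite_induct) (auto simp: cochain_eval_add)

lemma cochain_eval_eq_0:
  "(\<And>\<sigma>. \<sigma> \<in> Poly_Mapping.keys c \<Longrightarrow> \<phi> \<sigma> = 0) \<Longrightarrow> cochain_eval \<phi> c = 0"
  by (simp add: cochain_eval_def)

lemma cochain_eval_frag_extend:
  "cochain_eval \<phi> (frag_extend h c) = cochain_eval (\<lambda>\<sigma>. cochain_eval \<phi> (h \<sigma>)) c"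
  by (simp add: frag_extend_def cochain_eval_sum cochain_eval_cmul) (simp add: cochain_eval_def)

lemma cochain_eval_cong:
  "(\<And>\<sigma>. \<sigma> \<in> Poly_Mapping.keys c \<Longrightarrow> \<phi> \<sigma> = \<psi> \<sigma>) \<Longrightarrow> cochain_eval \<phi> c = cochain_eval \<psi> c"
  by (simp add: cochain_eval_def)

section \<open>The coboundary operator on total cochains\<close>

lemma coboundary_0 [simp]: "coboundary X \<phi> 0 = 0"
  by (auto simp: coboundary_def chain_boundary_def)

text \<open>The working form of the coboundary: writing the degree as a successor avoids the
  truncated \<open>p - 1\<close>, and a case split on \<open>p\<close> with
  \<open>coboundary_0\<close> covers every degree.\<close>

lemma coboundary_Suc:
  "coboundary X \<phi> (Suc p) \<sigma> =
     (if singular_simplex (Suc p) X \<sigma>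
      then \<Sum>k\<le>Suc p. (-1) ^ k * \<phi> p (singular_face (Suc p) k \<sigma>) else 0)"
  by (simp add: coboundary_def chain_boundary_of cochain_eval_sum cochain_eval_cmul del: sum.atMost_Suc)

lemma total_cochains_0 [simp]: "0 \<in> total_cochains X"
  by (simp add: total_cochains_def zero_fun_def)

lemma total_cochains_uminus [simp]: "- \<phi> \<in> total_cochains X \<longleftrightarrow> \<phi> \<in> total_cochains X"
  by (simp add: total_cochains_def fun_eq_iff)

lemma total_cochains_finite_supp:
  assumes "finite S" "\<And>p \<sigma>. \<not> singular_simplex p X \<sigma> \<Longrightarrow> \<phi> p \<sigma> = 0"
    "\<And>p \<sigma>. p \<notin> S \<Longrightarrow> singular_simplex p X \<sigma> \<Longrightarrow> \<phi> p \<sigma> = 0"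
  shows "\<phi> \<in> total_cochains X"
proof -
  have "{p. \<phi> p \<noteq> (\<lambda>\<sigma>. 0)} \<subseteq> S"
    using assms(2,3) by (auto simp: fun_eq_iff)
  then show ?thesis
    using assms(1,2) by (auto simp: total_cochains_def intro: finite_subset)
qed

text \<open>Finiteness of the set of degrees is always used as an upper bound on the degree: bounds
  combine by maximum under sums and by addition under cup products.\<close>

lemma total_cochains_bound:
  assumes "\<phi> \<in> total_cochains X"
  shows "\<exists>N. \<forall>p\<ge>N. \<forall>\<sigma>. \<phi> p \<sigma> = 0"
proof -
  have "finite {p. \<phi> p \<noteq> (\<lambda>\<sigma>. 0)}"
    using assms by (simp add: total_cochains_def)
  then obtain N where N: "{p. \<phi> p \<noteq> (\<lambda>\<sigma>. 0)} \<subseteq> {..<N}"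
    using finite_nat_iff_bounded by blast
  have "\<phi> p \<sigma> = 0" if "p \<ge> N" for p \<sigma>
  proof -
    have "p \<notin> {p. \<phi> p \<noteq> (\<lambda>\<sigma>. 0)}"
      using N that by auto
    then show ?thesis by (simp add: fun_eq_iff)
  qed
  then show ?thesis by blast
qed

lemma total_cochains_bounded:
  assumes "\<And>p \<sigma>. \<not> singular_simplex p X \<sigma> \<Longrightarrow> \<phi> p \<sigma> = 0"
    "\<And>p \<sigma>. p \<ge> N \<Longrightarrow> singular_simplex p X \<sigma> \<Longrightarrow> \<phi> p \<sigma> = 0"
  shows "\<phi> \<in> total_cochains X"
  by (rule total_cochains_finite_supp[of "{..<N}"]) (use assms in auto)

lemma total_cochains_outside:
  "\<phi> \<in> total_cochains X \<Longrightarrow> \<not> singular_simplex p X \<sigma> \<Longrightarrow> \<phi> p \<sigma> = 0"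
  by (simp add: total_cochains_def)

lemma total_cochains_eqI:
  assumes "\<phi> \<in> total_cochains X" "\<psi> \<in> total_cochains X"
    "\<And>p \<sigma>. singular_simplex p X \<sigma> \<Longrightarrow> \<phi> p \<sigma> = \<psi> p \<sigma>"
  shows "\<phi> = \<psi>"
proof (intro ext)
  fix p \<sigma>
  show "\<phi> p \<sigma> = \<psi> p \<sigma>"
    using assms by (cases "singular_simplex p X \<sigma>") (auto simp: total_cochains_outside)
qed

lemma total_cochains_add [simp]:
  assumes "\<phi> \<in> total_cochains X" "\<psi> \<in> total_cochains X"
  shows "\<phi> + \<psi> \<in> total_cochains X"
proof -
  obtain M where M: "\<forall>p\<ge>M. \<forall>\<sigma>. \<phi> p \<sigma> = 0"
    using total_cochains_bound[OF assms(1)] by blast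
  obtain N where N: "\<forall>p\<ge>N. \<forall>\<sigma>. \<psi> p \<sigma> = 0"
    using total_cochains_bound[OF assms(2)] by blast
  show ?thesis
    using assms M N by (intro total_cochains_bounded[of X _ "max M N"]) (auto simp: total_cochains_outside)
qed

lemma total_cochains_diff [simp]:
  "\<phi> \<in> total_cochains X \<Longrightarrow> \<psi> \<in> total_cochains X \<Longrightarrow> \<phi> - \<psi> \<in> total_cochains X"
  using total_cochains_add[of \<phi> X "- \<psi>"] by simp

lemma total_cochains_coboundary [simp]:
  assumes "\<phi> \<in> total_cochains X"
  shows "coboundary X \<phi> \<in> total_cochains X"
proof -
  obtain N where N: "\<forall>p\<ge>N. \<forall>\<sigma>. \<phi> p \<sigma> = 0"
    using total_cochains_bound[OF assms] by blast
  have "coboundary X \<phi> p \<sigma> = 0" if "p \<ge> Suc N" for p \<sigma>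
    using that by (cases p) (auto simp: coboundary_Suc N)
  then show ?thesis
    by (intro total_cochains_bounded[of X _ "Suc N"]) (auto simp: coboundary_def)
qed

lemma coboundary_add: "coboundary X (\<phi> + \<psi>) = coboundary X \<phi> + coboundary X \<psi>"
proof (intro ext)
  show "coboundary X (\<phi> + \<psi>) p \<sigma> = (coboundary X \<phi> + coboundary X \<psi>) p \<sigma>" for p \<sigma>
    by (cases p) (auto simp: coboundary_Suc algebra_simps sum.distrib simp del: sum.atMost_Suc)
qed

lemma coboundary_zero [simp]: "coboundary X 0 = 0"
  using coboundary_add[of X 0 0] by simp

lemma coboundary_uminus: "coboundary X (- \<phi>) = - coboundary X \<phi>"
  using coboundary_add[of X \<phi> "- \<phi>"] by (simp add: eq_neg_iff_add_eq_0 add.commute)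

lemma coboundary_diff: "coboundary X (\<phi> - \<psi>) = coboundary X \<phi> - coboundary X \<psi>"
  using coboundary_add[of X \<phi> "- \<psi>"] by (simp add: coboundary_uminus)

text \<open>Adjointness of boundary and coboundary, extended linearly from simplices to chains. The
  chain has to lie in \<open>X\<close> because \<open>coboundary X\<close> is cut off to 0
  elsewhere.\<close>

lemma cochain_eval_coboundary:
  assumes "singular_chain (Suc p) X c"
  shows "cochain_eval (coboundary X \<phi> (Suc p)) c = cochain_eval (\<phi> p) (chain_boundary (Suc p) c)"
proof -
  have "cochain_eval (\<phi> p) (chain_boundary (Suc p) c)
      = cochain_eval (\<lambda>\<sigma>. cochain_eval (\<phi> p) (chain_boundary (Suc p) (frag_of \<sigma>))) c"
    unfolding chain_boundary_of unfolding chain_boundary_def by (simp add: cochain_eval_frag_extend)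
  also have "\<dots> = cochain_eval (coboundary X \<phi> (Suc p)) c"
    using assms by (intro cochain_eval_cong) (auto simp: coboundary_def singular_chain_def)
  finally show ?thesis ..
qed

lemma coboundary_coboundary [simp]: "coboundary X (coboundary X \<phi>) = 0"
proof (intro ext)
  fix p \<sigma>
  show "coboundary X (coboundary X \<phi>) p \<sigma> = 0 p \<sigma>"
  proof (cases "p < 2 \<or> \<not> singular_simplex p X \<sigma>")
    case True
    then show ?thesis
      by (cases p) (auto simp: coboundary_Suc less_Suc_eq)
  next
    case False
    then obtain q where p: "p = Suc (Suc q)"
      by (metis add_2_eq_Suc less_eqE not_less)
    have c: "singular_chain (Suc (Suc q)) X (frag_of \<sigma>)"
      using False p by (simp add: singular_chain_of)
    then have "coboundary X (coboundary X \<phi>) p \<sigma> = cochain_eval (\<phi> q) (chain_boundary (Suc q) (chain_boundary (Suc (Suc q)) (frag_of \<sigma>)))"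
      using False p by (simp add: coboundary_def[of X "coboundary X \<phi>"] cochain_eval_coboundary singular_chain_boundary_alt)
    then show ?thesis
      using chain_boundary_boundary_alt[OF c] by simp
  qed
qed

section \<open>Cocycles modulo coboundaries\<close>

definition cocycles :: "'a topology \<Rightarrow> 'a cochain set" where
  "cocycles X = {\<phi> \<in> total_cochains X. coboundary X \<phi> = 0}"

text \<open>A relation on arbitrary cochains rather than equality of cosets: primitives, which need
  not be cocycles, are compared with it as well.\<close>

definition cohomologous :: "'a topology \<Rightarrow> 'a cochain \<Rightarrow> 'a cochain \<Rightarrow> bool" where
  "cohomologous X \<phi> \<psi> \<longleftrightarrow> \<phi> - \<psi> \<in> coboundaries X"

lemma cocyclesI: "\<phi> \<in> total_cochains X \<Longrightarrow> coboundary X \<phi> = 0 \<Longrightarrow> \<phi> \<in> cocycles X"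
  by (simp add: cocycles_def)

lemma cocycles_total [simp]: "\<phi> \<in> cocycles X \<Longrightarrow> \<phi> \<in> total_cochains X"
  and cocycles_coboundary [simp]: "\<phi> \<in> cocycles X \<Longrightarrow> coboundary X \<phi> = 0"
  by (auto simp: cocycles_def)

lemma cocycles_0 [simp]: "0 \<in> cocycles X"
  and cocycles_add [simp]: "\<phi> \<in> cocycles X \<Longrightarrow> \<psi> \<in> cocycles X \<Longrightarrow> \<phi> + \<psi> \<in> cocycles X"
  and cocycles_diff [simp]: "\<phi> \<in> cocycles X \<Longrightarrow> \<psi> \<in> cocycles X \<Longrightarrow> \<phi> - \<psi> \<in> cocycles X"
  and cocycles_uminus [simp]: "\<phi> \<in> cocycles X \<Longrightarrow> - \<phi> \<in> cocycles X"
  by (auto intro!: cocyclesI simp: coboundary_add coboundary_diff coboundary_uminus)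

lemma cocycles_sum:
  "(\<And>i. i \<in> I \<Longrightarrow> \<phi> i \<in> cocycles X) \<Longrightarrow> sum \<phi> I \<in> cocycles X"
  by (induction I rule: infinite_finite_induct) auto

lemma coboundary_in_coboundaries [simp]: "\<phi> \<in> total_cochains X \<Longrightarrow> coboundary X \<phi> \<in> coboundaries X"
  by (simp add: coboundaries_def)

lemma coboundaries_cocycles: "\<phi> \<in> coboundaries X \<Longrightarrow> \<phi> \<in> cocycles X"
  by (auto intro!: cocyclesI simp: coboundaries_def)

lemma coboundaries_0 [simp]: "0 \<in> coboundaries X"
  by (metis coboundary_zero coboundary_in_coboundaries total_cochains_0)

lemma coboundaries_add: "\<phi> \<in> coboundaries X \<Longrightarrow> \<psi> \<in> coboundaries X \<Longrightarrow> \<phi> + \<psi> \<in> coboundaries X"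
  unfolding coboundaries_def by (auto simp flip: coboundary_add)

lemma coboundaries_uminus: "\<phi> \<in> coboundaries X \<Longrightarrow> - \<phi> \<in> coboundaries X"
  unfolding coboundaries_def by (auto simp flip: coboundary_uminus)

lemma cohomologousI:
  "w \<in> total_cochains X \<Longrightarrow> \<phi> = \<psi> + coboundary X w \<Longrightarrow> cohomologous X \<phi> \<psi>"
  by (simp add: cohomologous_def)

lemma cohomologousE:
  assumes "cohomologous X \<phi> \<psi>"
  obtains w where "w \<in> total_cochains X" "\<phi> = \<psi> + coboundary X w"
  using assms by (auto simp: cohomologous_def coboundaries_def algebra_simps)

lemma cohomologous_refl [simp]: "cohomologous X \<phi> \<phi>"
  by (simp add: cohomologous_def)

lemma cohomologous_sym: "cohomologous X \<phi> \<psi> \<Longrightarrow> cohomologous X \<psi> \<phi>"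
  unfolding cohomologous_def using coboundaries_uminus[of "\<phi> - \<psi>" X] by simp

lemma cohomologous_trans [trans]:
  "cohomologous X \<phi> \<psi> \<Longrightarrow> cohomologous X \<psi> \<theta> \<Longrightarrow> cohomologous X \<phi> \<theta>"
  unfolding cohomologous_def using coboundaries_add[of "\<phi> - \<psi>" X "\<psi> - \<theta>"] by simp

lemma cohomologous_eq_trans [trans]:
  "cohomologous X \<phi> \<psi> \<Longrightarrow> \<psi> = \<theta> \<Longrightarrow> cohomologous X \<phi> \<theta>"
  "\<phi> = \<psi> \<Longrightarrow> cohomologous X \<psi> \<theta> \<Longrightarrow> cohomologous X \<phi> \<theta>"
  by auto

lemma cohomologous_add:
  "cohomologous X \<phi> \<psi> \<Longrightarrow> cohomologous X \<phi>' \<psi>' \<Longrightarrow> cohomologous X (\<phi> + \<phi>') (\<psi> + \<psi>')"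
  unfolding cohomologous_def using coboundaries_add[of "\<phi> - \<psi>" X "\<phi>' - \<psi>'"] by (simp add: algebra_simps)

lemma cohomologous_uminus:
  "cohomologous X \<phi> \<psi> \<Longrightarrow> cohomologous X (- \<phi>) (- \<psi>)"
  unfolding cohomologous_def using coboundaries_uminus[of "\<phi> - \<psi>" X] by (simp add: algebra_simps)

lemma cohomologous_diff:
  "cohomologous X \<phi> \<psi> \<Longrightarrow> cohomologous X \<phi>' \<psi>' \<Longrightarrow> cohomologous X (\<phi> - \<phi>') (\<psi> - \<psi>')"
  using cohomologous_add[of X \<phi> \<psi> "- \<phi>'" "- \<psi>'"] cohomologous_uminus[of X \<phi>' \<psi>'] by simp

lemma cohomologous_sum:
  "(\<And>i. i \<in> I \<Longrightarrow> cohomologous X (\<phi> i) (\<psi> i)) \<Longrightarrow> cohomologous X (sum \<phi> I) (sum \<psi> I)"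
  by (induction I rule: infinite_finite_induct) (auto intro: cohomologous_add)

lemma cohomologous_diff_0: "cohomologous X \<phi> \<psi> \<longleftrightarrow> cohomologous X (\<phi> - \<psi>) 0"
  by (simp add: cohomologous_def)

section \<open>Pullback along continuous maps\<close>

definition pullback :: "'a topology \<Rightarrow> ('a \<Rightarrow> 'b) \<Rightarrow> 'b cochain \<Rightarrow> 'a cochain" where
  "pullback X f \<phi> = (\<lambda>p \<sigma>. if singular_simplex p X \<sigma> then \<phi> p (simplex_map p f \<sigma>) else 0)"

lemma pullback_apply: "singular_simplex p X \<sigma> \<Longrightarrow> pullback X f \<phi> p \<sigma> = \<phi> p (simplex_map p f \<sigma>)"
  by (simp add: pullback_def)

lemma singular_face_simplex_map':
  assumes "k \<le> Suc p"
  shows "singular_face (Suc p) k (simplex_map (Suc p) f \<sigma>) = simplex_map p f (singular_face (Suc p) k \<sigma>)"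
  using assms by (subst singular_face_simplex_map)
    (auto simp: simplex_map_def singular_face_def fun_eq_iff restrict_def)

lemma pullback_total [simp]:
  assumes "\<phi> \<in> total_cochains Y"
  shows "pullback X f \<phi> \<in> total_cochains X"
proof -
  obtain N where "\<forall>p\<ge>N. \<forall>\<sigma>. \<phi> p \<sigma> = 0"
    using total_cochains_bound[OF assms] by blast
  then show ?thesis
    by (intro total_cochains_bounded[of X _ N]) (auto simp: pullback_def)
qed

lemma pullback_add: "pullback X f (\<phi> + \<psi>) = pullback X f \<phi> + pullback X f \<psi>"
  and pullback_diff: "pullback X f (\<phi> - \<psi>) = pullback X f \<phi> - pullback X f \<psi>"
  and pullback_uminus: "pullback X f (- \<phi>) = - pullback X f \<phi>"
  and pullback_0 [simp]: "pullback X f 0 = 0"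
  by (auto simp: pullback_def fun_eq_iff)

lemma pullback_sum: "pullback X f (sum \<phi> I) = (\<Sum>i\<in>I. pullback X f (\<phi> i))"
  by (induction I rule: infinite_finite_induct) (simp_all only: sum.infinite sum.empty sum.insert pullback_add pullback_0 not_False_eq_True)

lemma coboundary_pullback:
  assumes "continuous_map X Y f"
  shows "coboundary X (pullback X f \<phi>) = pullback X f (coboundary Y \<phi>)"
proof (intro ext)
  fix p \<sigma>
  show "coboundary X (pullback X f \<phi>) p \<sigma> = pullback X f (coboundary Y \<phi>) p \<sigma>"
  proof (cases p)
    case 0
    then show ?thesis by (simp add: pullback_def)
  next
    case (Suc q)
    show ?thesis
    proof (cases "singular_simplex p X \<sigma>")
      case True
      have "singular_simplex q X (singular_face (Suc q) k \<sigma>)" if "k \<le> Suc q" for k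
        using singular_simplex_singular_face[of p X \<sigma> k] True Suc that by auto
      then show ?thesis
        using True Suc singular_simplex_simplex_map[OF True assms]
        by (auto simp: coboundary_Suc pullback_apply singular_face_simplex_map' simp del: sum.atMost_Suc
            intro!: sum.cong)
    qed (auto simp: coboundary_def pullback_def)
  qed
qed

lemma pullback_cocycles [simp]:
  "continuous_map X Y f \<Longrightarrow> \<phi> \<in> cocycles Y \<Longrightarrow> pullback X f \<phi> \<in> cocycles X"
  by (intro cocyclesI pullback_total[of \<phi> Y]) (simp_all add: coboundary_pullback[of X Y])

lemma pullback_cohomologous:
  assumes "continuous_map X Y f" "cohomologous Y \<phi> \<psi>"
  shows "cohomologous X (pullback X f \<phi>) (pullback X f \<psi>)"
proof -
  obtain w where "w \<in> total_cochains Y" "\<phi> = \<psi> + coboundary Y w"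
    using assms(2) by (rule cohomologousE)
  then show ?thesis
    by (intro cohomologousI[of "pullback X f w"]) (auto simp: pullback_add coboundary_pullback[OF assms(1)])
qed

lemma pullback_compose:
  assumes "continuous_map X Y f"
  shows "pullback X f (pullback Y g \<phi>) = pullback X (g \<circ> f) \<phi>"
proof (intro ext)
  fix p \<sigma>
  show "pullback X f (pullback Y g \<phi>) p \<sigma> = pullback X (g \<circ> f) \<phi> p \<sigma>"
    by (cases "singular_simplex p X \<sigma>")
      (simp_all add: pullback_def singular_simplex_simplex_map[OF _ assms] simplex_map_compose)
qed

lemma pullback_ident:
  assumes "\<phi> \<in> total_cochains X" "\<And>x. x \<in> topspace X \<Longrightarrow> f x = x"
  shows "pullback X f \<phi> = \<phi>"
proof (rule total_cochains_eqI[of _ X])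
  show "pullback X f \<phi> p \<sigma> = \<phi> p \<sigma>" if "singular_simplex p X \<sigma>" for p \<sigma>
    using that simplex_map_id_gen[OF that assms(2)] by (simp add: pullback_apply)
qed (use assms in auto)

section \<open>Front and back faces\<close>

definition shift_vertices :: "nat \<Rightarrow> (nat \<Rightarrow> real) \<Rightarrow> nat \<Rightarrow> real" where
  "shift_vertices p v = (\<lambda>i. if i < p then 0 else v (i - p))"

lemma shift_vertices_in_simplex:
  assumes "v \<in> standard_simplex q"
  shows "shift_vertices p v \<in> standard_simplex (p + q)"
proof -
  have "(\<Sum>i\<le>p + q. shift_vertices p v i) = (\<Sum>i\<in>{p..p + q}. v (i - p))"
    by (rule sum.mono_neutral_cong_right) (auto simp: shift_vertices_def)
  also have "\<dots> = (\<Sum>i\<le>q. v i)"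
    by (rule sum.reindex_bij_witness[of _ "\<lambda>i. i + p" "\<lambda>i. i - p"]) auto
  finally show ?thesis
    using assms by (auto simp: standard_simplex_def shift_vertices_def)
qed

text \<open>As a composition with the affine inclusion \<open>shift_vertices\<close>, so that
  identities between faces reduce to identities between maps on vertices.\<close>

lemma back_face_alt: "back_face p q \<sigma> = restrict (\<sigma> \<circ> shift_vertices p) (standard_simplex q)"
  by (simp add: back_face_def shift_vertices_def o_def)

lemma singular_simplex_front_face:
  assumes "singular_simplex m X \<sigma>" "p \<le> m"
  shows "singular_simplex p X (front_face p \<sigma>)"
  using assms standard_simplex_mono[OF assms(2)]
  by (auto simp: singular_simplex_def front_face_def intro: continuous_map_from_subtopology_mono)

lemma singular_simplex_back_face:
  assumes "singular_simplex m X \<sigma>" "p + q = m"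
  shows "singular_simplex q X (back_face p q \<sigma>)"
proof -
  let ?PT = "powertop_real UNIV"
  have "continuous_map (subtopology ?PT (standard_simplex q)) euclideanreal (\<lambda>x. shift_vertices p x i)" for i
    unfolding shift_vertices_def
    by (cases "i < p") (auto intro: continuous_map_from_subtopology continuous_map_product_projection)
  then have "continuous_map (subtopology ?PT (standard_simplex q)) (subtopology ?PT (standard_simplex m)) (shift_vertices p)"
    using assms(2) shift_vertices_in_simplex
    by (auto simp: continuous_map_in_subtopology continuous_map_componentwise_UNIV)
  then show ?thesis
    using assms by (auto simp: singular_simplex_def back_face_alt intro: continuous_map_compose)
qed

lemma front_face_simplex_map:
  assumes "p \<le> m"
  shows "front_face p (simplex_map m f \<sigma>) = simplex_map p f (front_face p \<sigma>)"
  using standard_simplex_mono[OF assms] by (auto simp: front_face_def simplex_map_def fun_eq_iff)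

lemma back_face_simplex_map:
  "back_face p q (simplex_map (p + q) f \<sigma>) = simplex_map q f (back_face p q \<sigma>)"
  by (auto simp: back_face_alt simplex_map_def fun_eq_iff shift_vertices_in_simplex)

text \<open>This and the next five lemmas sort the faces of a simplex according to whether the
  deleted vertex belongs to the front part or to the back part. They carry the combinatorics of the
  Leibniz rule.\<close>

lemma front_face_face_le:
  assumes "k \<le> p" "p \<le> m"
  shows "front_face p (singular_face (Suc m) k \<sigma>) = singular_face (Suc p) k (front_face (Suc p) \<sigma>)"
proof
  fix v
  show "front_face p (singular_face (Suc m) k \<sigma>) v = singular_face (Suc p) k (front_face (Suc p) \<sigma>) v"
    using standard_simplex_mono[OF assms(2)] simplical_face_in_standard_simplex[of "Suc p" k v] assms(1)
    by (auto simp: front_face_def singular_face_def)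
qed

lemma front_face_face_gt:
  assumes "p < k" "p \<le> m"
  shows "front_face p (singular_face (Suc m) k \<sigma>) = front_face p \<sigma>"
proof
  fix v
  have "simplical_face k v = v" if "v \<in> standard_simplex p"
    using assms that by (auto simp: simplical_face_def fun_eq_iff standard_simplex_def)
  then show "front_face p (singular_face (Suc m) k \<sigma>) v = front_face p \<sigma> v"
    using standard_simplex_mono[OF assms(2)] by (auto simp: front_face_def singular_face_def)
qed

lemma front_face_last_face:
  "singular_face (Suc p) (Suc p) (front_face (Suc p) \<sigma>) = front_face p \<sigma>"
proof
  fix v
  have "simplical_face (Suc p) v = v" if "v \<in> standard_simplex p"
    using that by (auto simp: simplical_face_def fun_eq_iff standard_simplex_def)
  then show "singular_face (Suc p) (Suc p) (front_face (Suc p) \<sigma>) v = front_face p \<sigma> v"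
    using standard_simplex_mono[of p "Suc p"] by (auto simp: front_face_def singular_face_def)
qed

lemma back_face_face_le:
  assumes "k \<le> p"
  shows "back_face p q (singular_face (Suc (p + q)) k \<sigma>) = back_face (Suc p) q \<sigma>"
proof
  fix v
  have "simplical_face k (shift_vertices p v) = shift_vertices (Suc p) v"
    using assms by (auto simp: simplical_face_def shift_vertices_def fun_eq_iff)
  then show "back_face p q (singular_face (Suc (p + q)) k \<sigma>) v = back_face (Suc p) q \<sigma> v"
    using shift_vertices_in_simplex[of v q p] by (auto simp: back_face_alt singular_face_def)
qed

lemma back_face_first_face:
  "singular_face (Suc q) 0 (back_face p (Suc q) \<sigma>) = back_face (Suc p) q \<sigma>"
proof
  fix v
  have "shift_vertices p (simplical_face 0 v) = shift_vertices (Suc p) v"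
    by (auto simp: simplical_face_def shift_vertices_def fun_eq_iff)
  then show "singular_face (Suc q) 0 (back_face p (Suc q) \<sigma>) v = back_face (Suc p) q \<sigma> v"
    using simplical_face_in_standard_simplex[of "Suc q" 0 v] by (auto simp: back_face_alt singular_face_def)
qed

lemma back_face_face_gt:
  assumes "0 < j" "j \<le> Suc q"
  shows "back_face p q (singular_face (Suc (p + q)) (p + j) \<sigma>) = singular_face (Suc q) j (back_face p (Suc q) \<sigma>)"
proof
  fix v
  have "shift_vertices p (simplical_face j v) = simplical_face (p + j) (shift_vertices p v)"
    using assms by (auto simp: simplical_face_def shift_vertices_def fun_eq_iff)
  then show "back_face p q (singular_face (Suc (p + q)) (p + j) \<sigma>) v = singular_face (Suc q) j (back_face p (Suc q) \<sigma>) v"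
    using simplical_face_in_standard_simplex[of "Suc q" j v] shift_vertices_in_simplex[of v q p] assms
    by (auto simp: back_face_alt singular_face_def)
qed

lemma front_front_face: "a \<le> p \<Longrightarrow> front_face a (front_face p \<sigma>) = front_face a \<sigma>"
  using standard_simplex_mono[of a p] by (auto simp: front_face_def fun_eq_iff)

text \<open>The middle one of three consecutive pieces of a simplex is the same whichever end is cut
  off first; with the two neighbouring lemmas this is associativity of the cup product.\<close>

lemma back_front_face: "back_face a b (front_face (a + b) \<sigma>) = front_face b (back_face a (b + c) \<sigma>)"
  using standard_simplex_mono[of b "b + c"] shift_vertices_in_simplex[of _ b a]
  by (auto simp: front_face_def back_face_alt fun_eq_iff)

lemma back_back_face: "back_face b c (back_face a (b + c) \<sigma>) = back_face (a + b) c \<sigma>"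
proof
  fix v
  have "shift_vertices a (shift_vertices b v) = shift_vertices (a + b) v"
    by (auto simp: shift_vertices_def fun_eq_iff)
  then show "back_face b c (back_face a (b + c) \<sigma>) v = back_face (a + b) c \<sigma> v"
    using shift_vertices_in_simplex[of v c b] by (auto simp: back_face_alt)
qed

lemma front_face_self: "singular_simplex m X \<sigma> \<Longrightarrow> front_face m \<sigma> = \<sigma>"
  by (simp add: front_face_def singular_simplex_def extensional_restrict)

lemma back_face_0: "singular_simplex m X \<sigma> \<Longrightarrow> back_face 0 m \<sigma> = \<sigma>"
  by (simp add: back_face_def singular_simplex_def extensional_restrict)

section \<open>The cup product\<close>

lemma cup_apply:
  "singular_simplex m X \<sigma> \<Longrightarrow>
    cup X \<phi> \<psi> m \<sigma> = (\<Sum>p\<le>m. \<phi> p (front_face p \<sigma>) * \<psi> (m - p) (back_face p (m - p) \<sigma>))"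
  by (simp add: cup_def)

lemma cup_total [simp]:
  assumes "\<phi> \<in> total_cochains X" "\<psi> \<in> total_cochains X"
  shows "cup X \<phi> \<psi> \<in> total_cochains X"
proof -
  obtain M where M: "\<forall>p\<ge>M. \<forall>\<sigma>. \<phi> p \<sigma> = 0"
    using total_cochains_bound[OF assms(1)] by blast
  obtain N where N: "\<forall>p\<ge>N. \<forall>\<sigma>. \<psi> p \<sigma> = 0"
    using total_cochains_bound[OF assms(2)] by blast
  have "cup X \<phi> \<psi> m \<sigma> = 0" if "m \<ge> M + N" "singular_simplex m X \<sigma>" for m \<sigma>
    unfolding cup_apply[OF that(2)]
  proof (rule sum.neutral, safe)
    \<comment> \<open>For \<open>p < M\<close> the complementary degree \<open>m - p\<close> exceeds
      \<open>N\<close>, so one of the two factors vanishes in either case.\<close>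
    fix p show "\<phi> p (front_face p \<sigma>) * \<psi> (m - p) (back_face p (m - p) \<sigma>) = 0"
      using M N that(1) by (cases "p \<ge> M") auto
  qed
  then show ?thesis
    by (intro total_cochains_bounded[of X _ "M + N"]) (auto simp: cup_def)
qed

lemma cup_add_left: "cup X (\<phi> + \<phi>') \<psi> = cup X \<phi> \<psi> + cup X \<phi>' \<psi>"
  and cup_add_right: "cup X \<phi> (\<psi> + \<psi>') = cup X \<phi> \<psi> + cup X \<phi> \<psi>'"
  and cup_diff_left: "cup X (\<phi> - \<phi>') \<psi> = cup X \<phi> \<psi> - cup X \<phi>' \<psi>"
  and cup_diff_right: "cup X \<phi> (\<psi> - \<psi>') = cup X \<phi> \<psi> - cup X \<phi> \<psi>'"
  and cup_uminus_right: "cup X \<phi> (- \<psi>) = - cup X \<phi> \<psi>"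
  and cup_0_left [simp]: "cup X 0 \<psi> = 0"
  and cup_0_right [simp]: "cup X \<phi> 0 = 0"
  by (simp_all add: cup_def fun_eq_iff algebra_simps sum.distrib sum_subtractf sum_negf)

lemma cup_sum_right: "cup X \<phi> (sum \<psi> I) = (\<Sum>i\<in>I. cup X \<phi> (\<psi> i))"
  by (induction I rule: infinite_finite_induct)
    (simp_all only: sum.infinite sum.empty sum.insert cup_add_right cup_0_right not_False_eq_True)

lemma pullback_cup:
  assumes "continuous_map X Y f"
  shows "pullback X f (cup Y \<phi> \<psi>) = cup X (pullback X f \<phi>) (pullback X f \<psi>)"
proof (intro ext)
  fix m \<sigma>
  show "pullback X f (cup Y \<phi> \<psi>) m \<sigma> = cup X (pullback X f \<phi>) (pullback X f \<psi>) m \<sigma>"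
  proof (cases "singular_simplex m X \<sigma>")
    case True
    have "back_face p (m - p) (simplex_map m f \<sigma>) = simplex_map (m - p) f (back_face p (m - p) \<sigma>)" if "p \<le> m" for p
      using back_face_simplex_map[of p "m - p" f \<sigma>] that by simp
    then show ?thesis
      using True singular_simplex_simplex_map[OF True assms]
      by (auto simp: cup_apply pullback_apply singular_simplex_front_face singular_simplex_back_face
          front_face_simplex_map intro!: sum.cong)
  qed (simp add: cup_def pullback_def)
qed

definition unit_cochain :: "'a topology \<Rightarrow> 'a cochain" where
  "unit_cochain X = (\<lambda>p \<sigma>. if p = 0 \<and> singular_simplex 0 X \<sigma> then 1 else 0)"

lemma unit_cochain_total [simp]: "unit_cochain X \<in> total_cochains X"
  by (rule total_cochains_bounded[of X _ 1]) (auto simp: unit_cochain_def)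

lemma unit_cochain_cocycle [simp]: "unit_cochain X \<in> cocycles X"
proof (rule cocyclesI)
  show "coboundary X (unit_cochain X) = 0"
  proof (intro ext)
    fix p \<sigma>
    show "coboundary X (unit_cochain X) p \<sigma> = 0 p \<sigma>"
    proof (cases p)
      case (Suc q)
      then show ?thesis
        using singular_simplex_singular_face[of 1 X \<sigma>]
        by (cases "q = 0") (auto simp: coboundary_Suc unit_cochain_def)
    qed auto
  qed
qed auto

lemma pullback_unit_cochain:
  "continuous_map X Y f \<Longrightarrow> pullback X f (unit_cochain Y) = unit_cochain X"
  by (auto simp: pullback_def unit_cochain_def fun_eq_iff singular_simplex_simplex_map)

lemma cup_unit_left [simp]:
  assumes "\<phi> \<in> total_cochains X"
  shows "cup X (unit_cochain X) \<phi> = \<phi>"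
proof (rule total_cochains_eqI[of _ X])
  fix m \<sigma> assume \<sigma>: "singular_simplex m X \<sigma>"
  then have "cup X (unit_cochain X) \<phi> m \<sigma> = (\<Sum>p\<le>m. if p = 0 then \<phi> (m - p) (back_face p (m - p) \<sigma>) else 0)"
    unfolding cup_apply[OF \<sigma>] by (intro sum.cong) (auto simp: unit_cochain_def singular_simplex_front_face)
  then show "cup X (unit_cochain X) \<phi> m \<sigma> = \<phi> m \<sigma>"
    by (simp add: back_face_0[OF \<sigma>])
qed (use assms in auto)

lemma cup_unit_right [simp]:
  assumes "\<phi> \<in> total_cochains X"
  shows "cup X \<phi> (unit_cochain X) = \<phi>"
proof (rule total_cochains_eqI[of _ X])
  fix m \<sigma> assume \<sigma>: "singular_simplex m X \<sigma>"
  have "singular_simplex 0 X (back_face m 0 \<sigma>)"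
    by (rule singular_simplex_back_face[OF \<sigma>]) simp
  then have "cup X \<phi> (unit_cochain X) m \<sigma> = (\<Sum>p\<le>m. if p = m then \<phi> p (front_face p \<sigma>) else 0)"
    unfolding cup_apply[OF \<sigma>] by (intro sum.cong) (auto simp: unit_cochain_def)
  then show "cup X \<phi> (unit_cochain X) m \<sigma> = \<phi> m \<sigma>"
    by (simp add: front_face_self[OF \<sigma>])
qed (use assms in auto)

lemma cup_assoc: "cup X (cup X \<phi> \<psi>) \<theta> = cup X \<phi> (cup X \<psi> \<theta>)"
proof (intro ext)
  fix m \<sigma>
  show "cup X (cup X \<phi> \<psi>) \<theta> m \<sigma> = cup X \<phi> (cup X \<psi> \<theta>) m \<sigma>"
  proof (cases "singular_simplex m X \<sigma>")
    case True
    \<comment> \<open>The product of the three cochains on consecutive pieces of lengths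
      \<open>a\<close>, \<open>b\<close> and \<open>m - a - b\<close>. Both bracketings are its sum
      over all \<open>a + b \<le> m\<close>, indexed differently.\<close>
    define F where "F a b = \<phi> a (front_face a \<sigma>) * \<psi> b (front_face b (back_face a (m - a) \<sigma>))
      * \<theta> (m - (a + b)) (back_face (a + b) (m - (a + b)) \<sigma>)" for a b
    have 1: "\<phi> a (front_face a (front_face p \<sigma>)) * \<psi> (p - a) (back_face a (p - a) (front_face p \<sigma>))
        * \<theta> (m - p) (back_face p (m - p) \<sigma>) = F a (p - a)" if "a \<le> p" "p \<le> m" for a p
      using that back_front_face[of a "p - a" \<sigma> "m - p"] by (simp add: F_def front_front_face)
    have 2: "\<phi> a (front_face a \<sigma>) * (\<psi> b (front_face b (back_face a (m - a) \<sigma>)) *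
        \<theta> (m - a - b) (back_face b (m - a - b) (back_face a (m - a) \<sigma>))) = F a b" if "a \<le> m" "b \<le> m - a" for a b
      using that back_back_face[of b "m - a - b" a \<sigma>] by (simp add: F_def)
    have "cup X (cup X \<phi> \<psi>) \<theta> m \<sigma> = (\<Sum>p\<le>m. \<Sum>a\<le>p. F a (p - a))"
      using True 1 by (simp add: cup_apply singular_simplex_front_face sum_distrib_right)
    also have "\<dots> = (\<Sum>(p, a)\<in>(SIGMA p:{..m}. {..p}). F a (p - a))"
      by (simp add: sum.Sigma)
    also have "\<dots> = (\<Sum>(a, b)\<in>(SIGMA a:{..m}. {..m - a}). F a b)"
      by (rule sum.reindex_bij_witness[of _ "\<lambda>(a, b). (a + b, a)" "\<lambda>(p, a). (a, p - a)"]) auto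
    also have "\<dots> = (\<Sum>a\<le>m. \<Sum>b\<le>m - a. F a b)"
      by (simp add: sum.Sigma)
    also have "\<dots> = cup X \<phi> (cup X \<psi> \<theta>) m \<sigma>"
      using True 2 by (simp add: cup_apply singular_simplex_back_face sum_distrib_left)
    finally show ?thesis .
  qed (simp add: cup_def)
qed

text \<open>The sign in the Leibniz rule depends on the degree of the left factor. A total cochain
  mixes degrees, so the sign is an operator on cochains instead of a scalar.\<close>

definition sign_twist :: "'a cochain \<Rightarrow> 'a cochain" where
  "sign_twist \<phi> = (\<lambda>p \<sigma>. (-1) ^ p * \<phi> p \<sigma>)"

lemma sign_twist_total [simp]:
  assumes "\<phi> \<in> total_cochains X"
  shows "sign_twist \<phi> \<in> total_cochains X"
proof -
  obtain N where "\<forall>p\<ge>N. \<forall>\<sigma>. \<phi> p \<sigma> = 0"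
    using total_cochains_bound[OF assms] by blast
  then show ?thesis
    using assms by (intro total_cochains_bounded[of X _ N]) (auto simp: sign_twist_def total_cochains_outside)
qed

lemma sign_twist_twist [simp]: "sign_twist (sign_twist \<phi>) = \<phi>"
  by (simp add: sign_twist_def fun_eq_iff flip: mult.assoc power_mult_distrib)

lemma coboundary_sign_twist: "coboundary X (sign_twist \<phi>) = - sign_twist (coboundary X \<phi>)"
proof (intro ext)
  show "coboundary X (sign_twist \<phi>) p \<sigma> = (- sign_twist (coboundary X \<phi>)) p \<sigma>" for p \<sigma>
    by (cases p) (auto simp: coboundary_Suc sign_twist_def sum_distrib_left algebra_simps sum_negf simp del: sum.atMost_Suc)
qed

lemma sign_twist_cocycle:
  assumes "\<phi> \<in> cocycles X" shows "sign_twist \<phi> \<in> cocycles X"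
proof (rule cocyclesI)
  show "coboundary X (sign_twist \<phi>) = 0"
    using assms by (simp only: coboundary_sign_twist cocycles_coboundary) (simp add: sign_twist_def fun_eq_iff)
qed (use assms in simp)

text \<open>The terms deleting the vertex shared by the front and the back face cancel.\<close>

lemma coboundary_cup:
  "coboundary X (cup X \<phi> \<psi>) = cup X (coboundary X \<phi>) \<psi> + cup X (sign_twist \<phi>) (coboundary X \<psi>)"
proof (intro ext)
  fix m' \<sigma>
  show "coboundary X (cup X \<phi> \<psi>) m' \<sigma>
      = (cup X (coboundary X \<phi>) \<psi> + cup X (sign_twist \<phi>) (coboundary X \<psi>)) m' \<sigma>"
  proof (cases "m' = 0 \<or> \<not> singular_simplex m' X \<sigma>")
    case True
    then show ?thesis
    proof
      assume "m' = 0"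
      then show ?thesis by (cases "singular_simplex 0 X \<sigma>") (auto simp: cup_def)
    qed (simp add: cup_def coboundary_def)
  next
    case False
    then obtain m where m': "m' = Suc m" and \<sigma>: "singular_simplex (Suc m) X \<sigma>"
      by (cases m') auto
    \<comment> \<open>\<open>L p\<close> uses the faces of the front simplex except its last,
      \<open>R p\<close> those of the back simplex except its first. \<open>M p\<close> is the
      remaining term: the last face of the front and the first face of the back give it with
      opposite signs.\<close>
    define L where "L p = (\<Sum>k\<le>p. (-1) ^ k * \<phi> p (singular_face (Suc p) k (front_face (Suc p) \<sigma>)) *
        \<psi> (m - p) (back_face (Suc p) (m - p) \<sigma>))" for p
    define R where "R p = (\<Sum>j\<in>{1..Suc (m - p)}. (-1) ^ (p + j) * \<phi> p (front_face p \<sigma>) *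
        \<psi> (m - p) (singular_face (Suc (m - p)) j (back_face p (Suc (m - p)) \<sigma>)))" for p
    define M where "M p = (-1) ^ p * \<phi> p (front_face p \<sigma>) * \<psi> (m - p) (back_face (Suc p) (m - p) \<sigma>)" for p
    have face: "singular_simplex m X (singular_face (Suc m) k \<sigma>)" if "k \<le> Suc m" for k
      using singular_simplex_singular_face[OF \<sigma>] that by simp
    have key: "(\<Sum>k\<le>Suc m. (-1) ^ k * (\<phi> p (front_face p (singular_face (Suc m) k \<sigma>)) *
        \<psi> (m - p) (back_face p (m - p) (singular_face (Suc m) k \<sigma>)))) = L p + R p" (is "?S = _") if "p \<le> m" for p
    proof -
      let ?t = "\<lambda>k. (-1) ^ k * (\<phi> p (front_face p (singular_face (Suc m) k \<sigma>)) *
        \<psi> (m - p) (back_face p (m - p) (singular_face (Suc m) k \<sigma>)))"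
      have "{..Suc m} = {..p} \<union> {p + 1..Suc m}" using that by auto
      then have "?S = sum ?t {..p} + sum ?t {p + 1..Suc m}"
        by (simp only:) (intro sum.union_disjoint; auto)
      also have "sum ?t {..p} = L p"
        unfolding L_def using that back_face_face_le[of _ p "m - p" \<sigma>]
        by (intro sum.cong) (auto simp: front_face_face_le)
      also have "sum ?t {p + 1..Suc m} = R p"
        unfolding R_def
      proof (rule sum.reindex_bij_witness[of _ "\<lambda>j. p + j" "\<lambda>k. k - p"])
        fix k assume k: "k \<in> {p + 1..Suc m}"
        show "(-1) ^ (p + (k - p)) * \<phi> p (front_face p \<sigma>) * \<psi> (m - p)
            (singular_face (Suc (m - p)) (k - p) (back_face p (Suc (m - p)) \<sigma>)) = ?t k"
          using k that back_face_face_gt[of "k - p" "m - p" p \<sigma>] by (simp add: front_face_face_gt diff_le_mono Suc_diff_le[symmetric])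
      qed (use that in auto)
      finally show ?thesis .
    qed
    have "coboundary X (cup X \<phi> \<psi>) m' \<sigma> = (\<Sum>k\<le>Suc m. \<Sum>p\<le>m. (-1) ^ k * (\<phi> p (front_face p (singular_face (Suc m) k \<sigma>)) *
        \<psi> (m - p) (back_face p (m - p) (singular_face (Suc m) k \<sigma>))))"
      using face \<sigma> by (simp add: m' coboundary_Suc cup_apply sum_distrib_left del: sum.atMost_Suc)
    also have "\<dots> = (\<Sum>p\<le>m. L p + R p)"
      by (subst sum.swap) (simp add: key del: sum.atMost_Suc)
    finally have lhs: "coboundary X (cup X \<phi> \<psi>) m' \<sigma> = (\<Sum>p\<le>m. L p + R p)" .
    have "cup X (coboundary X \<phi>) \<psi> m' \<sigma> = (\<Sum>p\<le>m. coboundary X \<phi> (Suc p) (front_face (Suc p) \<sigma>) *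
        \<psi> (m - p) (back_face (Suc p) (m - p) \<sigma>))"
      using \<sigma> by (simp add: m' cup_apply sum.atMost_Suc_shift del: sum.atMost_Suc)
    also have "\<dots> = (\<Sum>p\<le>m. L p - M p)"
      using \<sigma> by (intro sum.cong)
        (auto simp: L_def M_def coboundary_Suc singular_simplex_front_face front_face_last_face
          sum_distrib_left sum_distrib_right algebra_simps)
    finally have A: "cup X (coboundary X \<phi>) \<psi> m' \<sigma> = (\<Sum>p\<le>m. L p - M p)" .
    have "cup X (sign_twist \<phi>) (coboundary X \<psi>) m' \<sigma> = (\<Sum>p\<le>m. (-1) ^ p * \<phi> p (front_face p \<sigma>) *
        coboundary X \<psi> (Suc (m - p)) (back_face p (Suc (m - p)) \<sigma>))"
      using \<sigma> by (simp add: m' cup_apply sign_twist_def Suc_diff_le)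
    also have "\<dots> = (\<Sum>p\<le>m. M p + R p)"
    proof (intro sum.cong refl)
      fix p assume "p \<in> {..m}"
      then have "singular_simplex (Suc (m - p)) X (back_face p (Suc (m - p)) \<sigma>)"
        by (intro singular_simplex_back_face[OF \<sigma>]) simp
      then have "coboundary X \<psi> (Suc (m - p)) (back_face p (Suc (m - p)) \<sigma>)
        = (\<Sum>k\<in>{0..Suc (m - p)}. (-1) ^ k * \<psi> (m - p) (singular_face (Suc (m - p)) k (back_face p (Suc (m - p)) \<sigma>)))"
        by (simp add: coboundary_Suc atMost_atLeast0 del: sum.atMost_Suc sum.cl_ivl_Suc)
      also have "\<dots> = \<psi> (m - p) (back_face (Suc p) (m - p) \<sigma>) +
          (\<Sum>k\<in>{1..Suc (m - p)}. (-1) ^ k * \<psi> (m - p) (singular_face (Suc (m - p)) k (back_face p (Suc (m - p)) \<sigma>)))"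
        by (subst sum.atLeast_Suc_atMost) (simp_all add: back_face_first_face del: sum.cl_ivl_Suc)
      finally show "(-1) ^ p * \<phi> p (front_face p \<sigma>) * coboundary X \<psi> (Suc (m - p)) (back_face p (Suc (m - p)) \<sigma>) = M p + R p"
        by (simp add: M_def R_def sum_distrib_left algebra_simps power_add
          del: sum.cl_ivl_Suc)
    qed
    finally have B: "cup X (sign_twist \<phi>) (coboundary X \<psi>) m' \<sigma> = (\<Sum>p\<le>m. M p + R p)" .
    show ?thesis
      by (simp add: lhs A B flip: sum.distrib)
  qed
qed

lemma cup_cocycles [simp]:
  "\<phi> \<in> cocycles X \<Longrightarrow> \<psi> \<in> cocycles X \<Longrightarrow> cup X \<phi> \<psi> \<in> cocycles X"
  by (intro cocyclesI) (simp_all add: coboundary_cup)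

lemma cohomologous_cup_left:
  assumes "cohomologous X \<phi> \<phi>'" "\<psi> \<in> cocycles X"
  shows "cohomologous X (cup X \<phi> \<psi>) (cup X \<phi>' \<psi>)"
proof -
  obtain w where "w \<in> total_cochains X" "\<phi> = \<phi>' + coboundary X w"
    using assms(1) by (rule cohomologousE)
  then show ?thesis
    using assms(2) by (intro cohomologousI[of "cup X w \<psi>"]) (simp_all add: cup_add_left coboundary_cup)
qed

lemma cohomologous_cup_right:
  assumes "\<phi> \<in> cocycles X" "cohomologous X \<psi> \<psi>'"
  shows "cohomologous X (cup X \<phi> \<psi>) (cup X \<phi> \<psi>')"
proof -
  obtain w where w: "w \<in> total_cochains X" "\<psi> = \<psi>' + coboundary X w"
    using assms(2) by (rule cohomologousE)
  \<comment> \<open>Twisting the left factor in advance cancels the sign that the Leibniz rule would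
    put on \<open>\<phi>\<close>.\<close>
  have "coboundary X (cup X (sign_twist \<phi>) w) = cup X \<phi> (coboundary X w)"
    using sign_twist_cocycle[OF assms(1)] by (simp add: coboundary_cup)
  then show ?thesis
    using w assms(1) by (intro cohomologousI[of "cup X (sign_twist \<phi>) w"]) (simp_all add: cup_add_right)
qed

lemma cohomologous_cup:
  assumes "cohomologous X \<phi> \<phi>'" "cohomologous X \<psi> \<psi>'" "\<phi>' \<in> cocycles X" "\<psi> \<in> cocycles X"
  shows "cohomologous X (cup X \<phi> \<psi>) (cup X \<phi>' \<psi>')"
  using cohomologous_cup_left[OF assms(1,4)] cohomologous_cup_right[OF assms(3,2)]
  by (rule cohomologous_trans)

section \<open>The cohomology ring\<close>

lemma carrier_cocycle_ring [simp]: "carrier (cocycle_ring X) = cocycles X"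
  and mult_cocycle_ring [simp]: "\<phi> \<otimes>\<^bsub>cocycle_ring X\<^esub> \<psi> = cup X \<phi> \<psi>"
  and one_cocycle_ring [simp]: "\<one>\<^bsub>cocycle_ring X\<^esub> = unit_cochain X"
  and zero_cocycle_ring [simp]: "\<zero>\<^bsub>cocycle_ring X\<^esub> = 0"
  and add_cocycle_ring [simp]: "\<phi> \<oplus>\<^bsub>cocycle_ring X\<^esub> \<psi> = \<phi> + \<psi>"
  by (simp_all add: cocycle_ring_def cocycles_def unit_cochain_def zero_fun_def plus_fun_def
      del: cocycles_coboundary cocycles_total)

lemma ring_cocycle_ring: "ring (cocycle_ring X)"
proof (rule ringI)
  show "abelian_group (cocycle_ring X)"
  proof (rule abelian_groupI)
    show "\<exists>\<psi>\<in>carrier (cocycle_ring X). \<psi> \<oplus>\<^bsub>cocycle_ring X\<^esub> \<phi> = \<zero>\<^bsub>cocycle_ring X\<^esub>"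
      if "\<phi> \<in> carrier (cocycle_ring X)" for \<phi>
      using that by (intro bexI[of _ "- \<phi>"]) simp_all
  qed (simp_all add: add_ac)
  show "Group.monoid (cocycle_ring X)"
    by (rule monoidI) (simp_all add: cup_assoc)
qed (simp_all add: cup_add_left cup_add_right)

lemma a_inv_cocycle_ring [simp]:
  assumes "\<phi> \<in> cocycles X" shows "\<ominus>\<^bsub>cocycle_ring X\<^esub> \<phi> = - \<phi>"
proof -
  interpret ring "cocycle_ring X" by (rule ring_cocycle_ring)
  show ?thesis
    by (rule minus_equality) (use assms in simp_all)
qed

lemma ideal_coboundaries: "ideal (coboundaries X) (cocycle_ring X)"
proof (rule idealI[OF ring_cocycle_ring])
  interpret ring "cocycle_ring X" by (rule ring_cocycle_ring)
  show "subgroup (coboundaries X) (add_monoid (cocycle_ring X))"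
  proof (rule add.subgroupI)
    show "coboundaries X \<subseteq> carrier (cocycle_ring X)"
      using coboundaries_cocycles by auto
    show "coboundaries X \<noteq> {}"
      using coboundaries_0 by blast
  qed (auto simp: coboundaries_uminus coboundaries_add coboundaries_cocycles)
next
  fix \<phi> \<psi> assume *: "\<phi> \<in> coboundaries X" "\<psi> \<in> carrier (cocycle_ring X)"
  then have "cohomologous X \<phi> 0"
    by (simp add: cohomologous_def)
  then have "cohomologous X (cup X \<psi> \<phi>) (cup X \<psi> 0)" "cohomologous X (cup X \<phi> \<psi>) (cup X 0 \<psi>)"
    using * cohomologous_cup_left[of X \<phi> 0 \<psi>] cohomologous_cup_right[of \<psi> X \<phi> 0] by simp_all
  then show "\<psi> \<otimes>\<^bsub>cocycle_ring X\<^esub> \<phi> \<in> coboundaries X" "\<phi> \<otimes>\<^bsub>cocycle_ring X\<^esub> \<psi> \<in> coboundaries X"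
    by (simp_all add: cohomologous_def)
qed

definition cohomology_class :: "'a topology \<Rightarrow> 'a cochain \<Rightarrow> 'a cochain set" where
  "cohomology_class X \<phi> = coboundaries X +>\<^bsub>cocycle_ring X\<^esub> \<phi>"

lemma ring_cohomology_ring: "ring (cohomology_ring X)"
  unfolding cohomology_ring_def by (rule ideal.quotient_is_ring[OF ideal_coboundaries])

lemma cohomology_class_hom: "cohomology_class X \<in> ring_hom (cocycle_ring X) (cohomology_ring X)"
  unfolding cohomology_ring_def cohomology_class_def
  by (rule ideal.rcos_ring_hom[OF ideal_coboundaries])

lemma cohomology_class_eq_iff:
  assumes "\<phi> \<in> cocycles X" "\<psi> \<in> cocycles X"
  shows "cohomology_class X \<phi> = cohomology_class X \<psi> \<longleftrightarrow> cohomologous X \<phi> \<psi>"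
proof -
  interpret ring "cocycle_ring X" by (rule ring_cocycle_ring)
  show ?thesis
    using quotient_eq_iff_same_a_r_cos[OF ideal_coboundaries, of \<phi> \<psi>] assms
    by (simp add: cohomology_class_def cohomologous_def a_minus_def)
qed

lemma carrier_cohomology_ring: "carrier (cohomology_ring X) = cohomology_class X ` cocycles X"
  by (auto simp: cohomology_ring_def cohomology_class_def FactRing_def A_RCOSETS_defs a_r_coset_def)

section \<open>Homotopy invariance and gluing of cochains\<close>

text \<open>An acyclic complex of free abelian groups is contractible, applied to the chains of
  \<open>X\<close> modulo those spanned by \<open>S\<close>. The contraction is chosen on simplices:
  \<open>\<sigma>\<close> minus the contraction of its boundary is a relative cycle, hence bounds
  modulo \<open>S\<close>, and a bounding chain serves as \<open>s p \<sigma>\<close>. On simplices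
  of \<open>S\<close> the choice 0 is admissible.\<close>

lemma relative_contraction:
  fixes S :: "nat \<Rightarrow> ((nat \<Rightarrow> real) \<Rightarrow> 'a) \<Rightarrow> bool"
  defines "small \<equiv> \<lambda>p c. Poly_Mapping.keys c \<subseteq> {\<sigma>. S p \<sigma>}"
  assumes sub: "\<And>p \<sigma>. S p \<sigma> \<Longrightarrow> singular_simplex p X \<sigma>"
    and face: "\<And>p \<sigma> k. S (Suc p) \<sigma> \<Longrightarrow> k \<le> Suc p \<Longrightarrow> S p (singular_face (Suc p) k \<sigma>)"
    and acyc: "\<And>p c. singular_chain p X c \<Longrightarrow> small (p - 1) (chain_boundary p c) \<Longrightarrow>
                 \<exists>d. singular_chain (Suc p) X d \<and> small p (c - chain_boundary (Suc p) d)"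
  shows "\<exists>s. (\<forall>p \<sigma>. singular_simplex p X \<sigma> \<longrightarrow> singular_chain (Suc p) X (s p \<sigma>)) \<and>
    (\<forall>p \<sigma>. S p \<sigma> \<longrightarrow> s p \<sigma> = 0) \<and>
    (\<forall>\<sigma>. singular_simplex 0 X \<sigma> \<longrightarrow> small 0 (frag_of \<sigma> - chain_boundary 1 (s 0 \<sigma>))) \<and>
    (\<forall>p \<sigma>. singular_simplex (Suc p) X \<sigma> \<longrightarrow>
       small (Suc p) (frag_of \<sigma> - frag_extend (s p) (chain_boundary (Suc p) (frag_of \<sigma>)) - chain_boundary (Suc (Suc p)) (s (Suc p) \<sigma>)))"
proof -
  have small_0: "small p 0" for p
    by (simp add: small_def)
  have small_of: "small p (frag_of \<sigma>) \<longleftrightarrow> S p \<sigma>" for p \<sigma>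
    by (simp add: small_def)
  have small_diff: "small p (a - b)" if "small p a" "small p b" for p a b
    using that keys_diff[of a b] by (auto simp: small_def)
  have small_bd: "small p (chain_boundary (Suc p) (frag_of \<sigma>))" if "S (Suc p) \<sigma>" for p \<sigma>
  proof -
    have "Poly_Mapping.keys (\<Sum>k\<le>Suc p. frag_cmul ((-1) ^ k) (frag_of (singular_face (Suc p) k \<sigma>)))
        \<subseteq> (\<Union>k\<in>{..Suc p}. Poly_Mapping.keys (frag_cmul ((-1) ^ k) (frag_of (singular_face (Suc p) k \<sigma>))))"
      by (rule keys_sum)
    also have "\<dots> \<subseteq> {\<sigma>. S p \<sigma>}"
      using face[OF that] by (auto simp: keys_cmul_iff)
    finally show ?thesis
      by (simp add: small_def chain_boundary_of del: sum.atMost_Suc)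
  qed
  \<comment> \<open>The last clause, that a relative cycle is modulo \<open>S\<close> the boundary
    of its own contraction, is what makes the correction term in the next degree a relative cycle.
    \<open>Q\<close> ties consecutive degrees together, so the sequence requires dependent
    choice.\<close>
  define P where "P p s \<longleftrightarrow> (\<forall>\<sigma>. singular_simplex p X \<sigma> \<longrightarrow> singular_chain (Suc p) X (s \<sigma>)) \<and>
      (\<forall>\<sigma>. S p \<sigma> \<longrightarrow> s \<sigma> = 0) \<and>
      (p = 0 \<longrightarrow> (\<forall>\<sigma>. singular_simplex 0 X \<sigma> \<longrightarrow> small 0 (frag_of \<sigma> - chain_boundary 1 (s \<sigma>)))) \<and>
      (\<forall>c. singular_chain p X c \<and> small (p - 1) (chain_boundary p c) \<longrightarrow>
         small p (c - chain_boundary (Suc p) (frag_extend s c)))" for p and s :: "((nat \<Rightarrow> real) \<Rightarrow> 'a) \<Rightarrow> 'a chain"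
  define Q where "Q p s s' \<longleftrightarrow> (\<forall>\<sigma>. singular_simplex (Suc p) X \<sigma> \<longrightarrow>
       small (Suc p) (frag_of \<sigma> - frag_extend s (chain_boundary (Suc p) (frag_of \<sigma>)) - chain_boundary (Suc (Suc p)) (s' \<sigma>)))"
    for p and s s' :: "((nat \<Rightarrow> real) \<Rightarrow> 'a) \<Rightarrow> 'a chain"
  have "\<exists>f. \<forall>n. P n (f n) \<and> Q n (f n) (f (Suc n))"
  proof (rule dependent_nat_choice)
    have "\<exists>d. (S 0 \<sigma> \<longrightarrow> d = 0) \<and> (singular_simplex 0 X \<sigma> \<longrightarrow> singular_chain 1 X d \<and> small 0 (frag_of \<sigma> - chain_boundary 1 d))" for \<sigma>
    proof (cases "S 0 \<sigma>")
      case True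
      then show ?thesis by (intro exI[of _ 0]) (simp add: small_of)
    next
      case False
      then show ?thesis
        using acyc[of 0 "frag_of \<sigma>"] by (auto simp: singular_chain_of chain_boundary_of small_0)
    qed
    then obtain s where s: "\<And>\<sigma>. S 0 \<sigma> \<Longrightarrow> s \<sigma> = 0"
      "\<And>\<sigma>. singular_simplex 0 X \<sigma> \<Longrightarrow> singular_chain 1 X (s \<sigma>) \<and> small 0 (frag_of \<sigma> - chain_boundary 1 (s \<sigma>))"
      by metis
    have "small 0 (c - chain_boundary 1 (frag_extend s c))" if "Poly_Mapping.keys c \<subseteq> singular_simplex_set 0 X" for c
      using that
    proof (induction c rule: frag_induction)
      case (diff a b)
      then show ?case
        using small_diff[OF diff] by (simp add: frag_extend_diff chain_boundary_diff algebra_simps)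
    qed (use s in \<open>simp_all add: small_0\<close>)
    then show "\<exists>s. P 0 s"
      using s unfolding P_def singular_chain_def by (intro exI[of _ s]) auto
  next
    fix s p assume P: "P p s"
    have s_chain: "singular_chain (Suc p) X (frag_extend s c)" if "singular_chain p X c" for c
      by (rule singular_chain_extend) (use that P in \<open>auto simp: P_def singular_chain_def\<close>)
    have s_small: "frag_extend s c = 0" if "small p c" for c
      by (rule frag_extend_eq_0) (use that P in \<open>auto simp: P_def small_def\<close>)
    have "\<exists>d. (S (Suc p) \<sigma> \<longrightarrow> d = 0) \<and> (singular_simplex (Suc p) X \<sigma> \<longrightarrow> singular_chain (Suc (Suc p)) X d \<and>
        small (Suc p) (frag_of \<sigma> - frag_extend s (chain_boundary (Suc p) (frag_of \<sigma>)) - chain_boundary (Suc (Suc p)) d))" for \<sigma>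
    proof (cases "S (Suc p) \<sigma>")
      case True
      then show ?thesis
        by (intro exI[of _ 0]) (simp add: small_of s_small[OF small_bd])
    next
      case False
      show ?thesis
      proof (cases "singular_simplex (Suc p) X \<sigma>")
        case True
        let ?b = "chain_boundary (Suc p) (frag_of \<sigma>)"
        have c: "singular_chain (Suc p) X (frag_of \<sigma>)"
          using True by (simp add: singular_chain_of)
        have b: "singular_chain p X ?b"
          by (rule singular_chain_boundary_alt[OF c])
        have "small p (?b - chain_boundary (Suc p) (frag_extend s ?b))"
          using P b chain_boundary_boundary_alt[OF c] by (simp add: P_def small_0)
        then obtain d where "singular_chain (Suc (Suc p)) X d"
            "small (Suc p) (frag_of \<sigma> - frag_extend s ?b - chain_boundary (Suc (Suc p)) d)"
          using acyc[of "Suc p" "frag_of \<sigma> - frag_extend s ?b"] c s_chain[OF b]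
          by (auto simp: chain_boundary_diff singular_chain_diff)
        then show ?thesis using False by blast
      qed (use False in auto)
    qed
    then obtain s' where s': "\<And>\<sigma>. S (Suc p) \<sigma> \<Longrightarrow> s' \<sigma> = 0"
      "\<And>\<sigma>. singular_simplex (Suc p) X \<sigma> \<Longrightarrow> singular_chain (Suc (Suc p)) X (s' \<sigma>) \<and>
        small (Suc p) (frag_of \<sigma> - frag_extend s (chain_boundary (Suc p) (frag_of \<sigma>)) - chain_boundary (Suc (Suc p)) (s' \<sigma>))"
      by metis
    have *: "small (Suc p) (c - frag_extend s (chain_boundary (Suc p) c) - chain_boundary (Suc (Suc p)) (frag_extend s' c))"
      if "Poly_Mapping.keys c \<subseteq> singular_simplex_set (Suc p) X" for c
      using that
    proof (induction c rule: frag_induction)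
      case (diff a b)
      then show ?case
        using small_diff[OF diff] by (simp add: frag_extend_diff chain_boundary_diff algebra_simps)
    qed (simp_all add: small_0 s')
    have "small (Suc p) (c - chain_boundary (Suc (Suc p)) (frag_extend s' c))"
      if "singular_chain (Suc p) X c" "small p (chain_boundary (Suc p) c)" for c
      using *[of c] that(1) s_small[OF that(2)] by (simp add: singular_chain_def)
    then show "\<exists>s'. P (Suc p) s' \<and> Q p s s'"
      using s' by (intro exI[of _ s']) (auto simp: P_def Q_def)
  qed
  then obtain s where "\<And>n. P n (s n)" "\<And>n. Q n (s n) (s (Suc n))"
    by blast
  then show ?thesis
    by (intro exI[of _ s]) (auto simp: P_def Q_def)
qed

text \<open>Since the relative singular complex is free, relative acyclicity of chains dualises.\<close>

lemma relative_cocycle_coboundary: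
  fixes S :: "nat \<Rightarrow> ((nat \<Rightarrow> real) \<Rightarrow> 'a) \<Rightarrow> bool"
  assumes sub: "\<And>p \<sigma>. S p \<sigma> \<Longrightarrow> singular_simplex p X \<sigma>"
    and face: "\<And>p \<sigma> k. S (Suc p) \<sigma> \<Longrightarrow> k \<le> Suc p \<Longrightarrow> S p (singular_face (Suc p) k \<sigma>)"
    and acyc: "\<And>p c. singular_chain p X c \<Longrightarrow> Poly_Mapping.keys (chain_boundary p c) \<subseteq> {\<sigma>. S (p - 1) \<sigma>} \<Longrightarrow>
                 \<exists>d. singular_chain (Suc p) X d \<and> Poly_Mapping.keys (c - chain_boundary (Suc p) d) \<subseteq> {\<sigma>. S p \<sigma>}"
    and \<phi>: "\<phi> \<in> cocycles X" "\<And>p \<sigma>. S p \<sigma> \<Longrightarrow> \<phi> p \<sigma> = 0"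
  shows "\<exists>\<psi>\<in>total_cochains X. (\<forall>p \<sigma>. S p \<sigma> \<longrightarrow> \<psi> p \<sigma> = 0) \<and> \<phi> = coboundary X \<psi>"
proof -
  have "\<exists>s. (\<forall>p \<sigma>. singular_simplex p X \<sigma> \<longrightarrow> singular_chain (Suc p) X (s p \<sigma>)) \<and>
    (\<forall>p \<sigma>. S p \<sigma> \<longrightarrow> s p \<sigma> = 0) \<and>
    (\<forall>\<sigma>. singular_simplex 0 X \<sigma> \<longrightarrow>
       Poly_Mapping.keys (frag_of \<sigma> - chain_boundary 1 (s 0 \<sigma>)) \<subseteq> {\<sigma>. S 0 \<sigma>}) \<and>
    (\<forall>p \<sigma>. singular_simplex (Suc p) X \<sigma> \<longrightarrow>
       Poly_Mapping.keys (frag_of \<sigma> - frag_extend (s p) (chain_boundary (Suc p) (frag_of \<sigma>))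
         - chain_boundary (Suc (Suc p)) (s (Suc p) \<sigma>)) \<subseteq> {\<sigma>. S (Suc p) \<sigma>})"
    by (rule relative_contraction[of S X]) (fact sub face acyc)+
  then obtain s where
    s: "\<forall>p \<sigma>. singular_simplex p X \<sigma> \<longrightarrow> singular_chain (Suc p) X (s p \<sigma>)"
    "\<forall>p \<sigma>. S p \<sigma> \<longrightarrow> s p \<sigma> = 0"
    "\<forall>\<sigma>. singular_simplex 0 X \<sigma> \<longrightarrow>
       Poly_Mapping.keys (frag_of \<sigma> - chain_boundary 1 (s 0 \<sigma>)) \<subseteq> {\<sigma>. S 0 \<sigma>}"
    "\<forall>p \<sigma>. singular_simplex (Suc p) X \<sigma> \<longrightarrow>
       Poly_Mapping.keys (frag_of \<sigma> - frag_extend (s p) (chain_boundary (Suc p) (frag_of \<sigma>))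
         - chain_boundary (Suc (Suc p)) (s (Suc p) \<sigma>)) \<subseteq> {\<sigma>. S (Suc p) \<sigma>}"
    by (elim exE conjE)
  note s = s[rule_format]
  have eval_small: "cochain_eval (\<phi> p) c = 0" if "Poly_Mapping.keys c \<subseteq> {\<sigma>. S p \<sigma>}" for p c
    using that \<phi>(2) by (intro cochain_eval_eq_0) auto
  have eval_bd: "cochain_eval (\<phi> p) (chain_boundary (Suc p) c) = 0" if "singular_chain (Suc p) X c" for p c
    using cochain_eval_coboundary[OF that, of \<phi>] \<phi>(1) by (simp add: cochain_eval_def)
  \<comment> \<open>Evaluate \<open>\<phi>\<close> on the contraction. Since \<open>\<phi>\<close>
    vanishes on boundaries and on \<open>S\<close>, evaluating it on the homotopy identity leaves
    exactly that its value is the coboundary of \<open>\<psi>\<close>.\<close>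
  define \<psi> where "\<psi> p \<sigma> = (if singular_simplex p X \<sigma> then cochain_eval (\<phi> (Suc p)) (s p \<sigma>) else 0)" for p \<sigma>
  obtain N where N: "\<forall>p\<ge>N. \<forall>\<sigma>. \<phi> p \<sigma> = 0"
    using total_cochains_bound[of \<phi> X] \<phi>(1) by auto
  have \<psi>: "\<psi> \<in> total_cochains X"
    by (rule total_cochains_bounded[of X _ N]) (auto simp: \<psi>_def N cochain_eval_def)
  have "\<phi> = coboundary X \<psi>"
  proof (rule total_cochains_eqI[of _ X])
    fix p \<sigma> assume \<sigma>: "singular_simplex p X \<sigma>"
    show "\<phi> p \<sigma> = coboundary X \<psi> p \<sigma>"
    proof (cases p)
      case 0
      then have "cochain_eval (\<phi> 0) (frag_of \<sigma> - chain_boundary 1 (s 0 \<sigma>)) = 0"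
        using s(3) \<sigma> by (intro eval_small) auto
      then show ?thesis
        using 0 \<sigma> s(1) eval_bd[of 0 "s 0 \<sigma>"] by (simp add: cochain_eval_diff)
    next
      case (Suc q)
      let ?b = "chain_boundary (Suc q) (frag_of \<sigma>)"
      have b: "singular_chain q X ?b"
        using \<sigma> Suc by (intro singular_chain_boundary_alt) (simp add: singular_chain_of)
      have "coboundary X \<psi> p \<sigma> = cochain_eval (\<psi> q) ?b"
        using \<sigma> Suc by (simp add: coboundary_def)
      also have "\<dots> = cochain_eval (\<lambda>\<tau>. cochain_eval (\<phi> p) (s q \<tau>)) ?b"
        using b Suc by (intro cochain_eval_cong) (auto simp: \<psi>_def singular_chain_def)
      also have "\<dots> = cochain_eval (\<phi> p) (frag_extend (s q) ?b)"
        by (simp add: cochain_eval_frag_extend)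
      also have "\<dots> = \<phi> p \<sigma>"
        using eval_small[OF s(4)[of q \<sigma>]] \<sigma> Suc s(1)[of p \<sigma>] eval_bd[of p "s p \<sigma>"] by (simp add: cochain_eval_diff)
      finally show ?thesis ..
    qed
  qed (use \<phi> \<psi> in auto)
  then show ?thesis
    using \<psi> s(2) sub by (intro bexI[of _ \<psi>]) (auto simp: \<psi>_def)
qed

section \<open>Deformations and fibrewise contraction\<close>

lemma singular_simplex_subtopology_face:
  assumes "singular_simplex (Suc p) X \<sigma>" "k \<le> Suc p"
  shows "singular_simplex p X (singular_face (Suc p) k \<sigma>)"
  using singular_simplex_singular_face[OF assms(1), of k] assms(2) by simp

text \<open>The homotopy is one of pairs and ends inside \<open>A\<close>, so every relative cycle
  of the pair is a relative boundary. The difference of two cocycles that agree on \<open>A\<close>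
  is a relative cocycle and therefore bounds. The map \<open>r\<close> is not asked to fix
  \<open>A\<close> pointwise.\<close>

lemma deformation_cohomologous:
  assumes hom: "homotopic_with (\<lambda>h. h \<in> A \<rightarrow> A) X X id r" and r: "r \<in> topspace X \<rightarrow> A"
    and u: "u \<in> cocycles X" and v: "v \<in> cocycles X"
    and eq: "\<And>p \<sigma>. singular_simplex p (subtopology X A) \<sigma> \<Longrightarrow> u p \<sigma> = v p \<sigma>"
  shows "cohomologous X u v"
proof -
  let ?S = "\<lambda>p \<sigma>. singular_simplex p (subtopology X A) \<sigma>"
  have "\<exists>w\<in>total_cochains X. (\<forall>p \<sigma>. ?S p \<sigma> \<longrightarrow> w p \<sigma> = 0) \<and> u - v = coboundary X w"
  proof (rule relative_cocycle_coboundary)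
    show "singular_simplex p X \<sigma>" if "?S p \<sigma>" for p \<sigma>
      using that by (simp add: singular_simplex_subtopology)
    show "?S p (singular_face (Suc p) k \<sigma>)" if "?S (Suc p) \<sigma>" "k \<le> Suc p" for p \<sigma> k
      using that by (rule singular_simplex_subtopology_face)
    show "\<exists>d. singular_chain (Suc p) X d \<and> Poly_Mapping.keys (c - chain_boundary (Suc p) d) \<subseteq> {\<sigma>. ?S p \<sigma>}"
      if c: "singular_chain p X c" and bd: "Poly_Mapping.keys (chain_boundary p c) \<subseteq> {\<sigma>. ?S (p - 1) \<sigma>}" for p c
    proof -
      have "singular_relcycle p X A c"
        using c bd by (simp add: singular_relcycle singular_chain_def)
      then have "homologous_rel p X A (chain_map p id c) (chain_map p r c)"
        by (rule homotopic_imp_homologous_rel_chain_maps[OF hom])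
      then have "homologous_rel p X A c (chain_map p r c)"
        using chain_map_id_gen[OF c, of id] by simp
      then obtain d e where d: "singular_chain (Suc p) X d" "singular_chain p (subtopology X A) e"
          "chain_boundary (Suc p) d + e = c - chain_map p r c"
        unfolding homologous_rel_def singular_relboundary by metis
      have "continuous_map X (subtopology X A) r"
        using homotopic_with_imp_continuous_maps[OF hom] r by (auto simp: continuous_map_in_subtopology)
      then have "singular_chain p (subtopology X A) (chain_map p r c)"
        by (rule singular_chain_chain_map[OF c])
      then have "singular_chain p (subtopology X A) (e + chain_map p r c)"
        by (rule singular_chain_add[OF d(2)])
      moreover have "c - chain_boundary (Suc p) d = e + chain_map p r c"
        using d(3) by (metis add.commute add_diff_cancel_left' add_diff_eq diff_add_cancel)
      ultimately show ?thesis
        using d(1) by (intro exI[of _ d]) (simp add: singular_chain_def)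
    qed
  qed (use u v eq in auto)
  then show ?thesis
    by (auto simp: cohomologous_def)
qed

lemma continuous_map_fst_subtopology [simp]:
  "continuous_map (subtopology (prod_topology B C) W) B fst"
  by (simp add: continuous_map_from_subtopology continuous_map_fst)

lemma continuous_map_scaleR:
  fixes f :: "'a \<Rightarrow> 'b::real_normed_vector"
  shows "continuous_map X euclideanreal c \<Longrightarrow> continuous_map X euclidean f \<Longrightarrow> continuous_map X euclidean (\<lambda>x. c x *\<^sub>R f x)"
  by (simp add: continuous_map_atin tendsto_scaleR)

lemma continuous_map_mult:
  fixes f :: "'a \<Rightarrow> 'b::real_normed_algebra"
  shows "continuous_map X euclidean f \<Longrightarrow> continuous_map X euclidean g \<Longrightarrow> continuous_map X euclidean (\<lambda>x. f x * g x)"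
  by (simp add: continuous_map_atin tendsto_mult)

lemma continuous_map_divide:
  fixes f :: "'a \<Rightarrow> 'b::real_normed_field"
  shows "continuous_map X euclidean f \<Longrightarrow> continuous_map X euclidean g \<Longrightarrow> (\<And>x. x \<in> topspace X \<Longrightarrow> g x \<noteq> 0) \<Longrightarrow>
    continuous_map X euclidean (\<lambda>x. f x / g x)"
  by (simp add: continuous_map_atin tendsto_divide)

text \<open>The straight-line homotopy in each fibre towards the section preserves the image
  \<open>A\<close> of the section, and on \<open>A\<close> the cocycle agrees with its pullback
  through the section.\<close>

lemma fibrewise_star_cohomologous:
  fixes s :: "'b \<Rightarrow> 'c::real_normed_vector" and B :: "'b topology" and W :: "('b \<times> 'c) set"
  defines "E \<equiv> subtopology (prod_topology B euclidean) W"
  assumes s: "continuous_map B euclidean s" "\<And>x. x \<in> topspace B \<Longrightarrow> (x, s x) \<in> W"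
    and star: "\<And>x y t. x \<in> topspace B \<Longrightarrow> (x, y) \<in> W \<Longrightarrow> 0 \<le> t \<Longrightarrow> t \<le> 1 \<Longrightarrow> (x, (1 - t) *\<^sub>R y + t *\<^sub>R s x) \<in> W"
    and u: "u \<in> cocycles E"
  shows "cohomologous E u (pullback E fst (pullback B (\<lambda>x. (x, s x)) u))"
proof -
  have top: "topspace E = (topspace B \<times> UNIV) \<inter> W"
    by (simp add: E_def)
  have sec: "continuous_map B E (\<lambda>x. (x, s x))"
    using s by (auto simp: E_def continuous_map_in_subtopology continuous_map_pairedI)
  have fst: "continuous_map E B fst"
    by (simp add: E_def)
  define A where "A = (\<lambda>x. (x, s x)) ` topspace B"
  define r where "r z = (fst z, s (fst z))" for z :: "'b \<times> 'c"
  have "homotopic_with (\<lambda>h. h \<in> A \<rightarrow> A) E E id r"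
  proof (rule homotopic_with_eq[where f = id and g = r])
    define H where "H = (\<lambda>(t::real, z). (fst z, (1 - t) *\<^sub>R snd z + t *\<^sub>R s (fst z)))"
    have contH: "continuous_map (prod_topology (top_of_set {0..1}) E) E H"
      unfolding E_def continuous_map_in_subtopology
    proof
      let ?P = "prod_topology (top_of_set {0..1::real}) (subtopology (prod_topology B euclidean) W)"
      have 1: "continuous_map ?P euclideanreal fst"
        using continuous_map_fst[of "top_of_set {0..1::real}" "subtopology (prod_topology B (euclidean :: 'c topology)) W"]
        by (simp add: continuous_map_in_subtopology)
      have 2: "continuous_map ?P B (fst \<circ> snd)"
        by (rule continuous_map_compose[OF continuous_map_snd]) simp
      have 3: "continuous_map ?P euclidean (snd \<circ> snd)"
        by (rule continuous_map_compose[OF continuous_map_snd]) (simp add: continuous_map_from_subtopology continuous_map_snd)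
      have 4: "continuous_map ?P euclidean (s \<circ> (fst \<circ> snd))"
        by (rule continuous_map_compose[OF 2 s(1)])
      have "continuous_map ?P euclidean (\<lambda>z. (1 - fst z) *\<^sub>R snd (snd z) + fst z *\<^sub>R s (fst (snd z)))"
        using 1 3 4 by (intro continuous_map_add continuous_map_scaleR continuous_map_diff) (auto simp: o_def)
      then show "continuous_map ?P (prod_topology B euclidean) H"
        using 2 by (simp add: H_def case_prod_unfold continuous_map_pairedI o_def)
      show "H \<in> topspace ?P \<rightarrow> W"
        using star by (auto simp: H_def)
    qed
    have "H (t, z) \<in> A" if "z \<in> A" for t z
      using that by (auto simp: A_def H_def algebra_simps simp flip: scaleR_add_left)
    moreover have "\<forall>x. H (0, x) = id x" "\<forall>x. H (1, x) = r x"
      by (auto simp: H_def r_def)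
    ultimately show "homotopic_with (\<lambda>h. h \<in> A \<rightarrow> A) E E id r"
      unfolding homotopic_with_def using contH by (intro exI[of _ H]) auto
  next
    fix h k :: "'b \<times> 'c \<Rightarrow> 'b \<times> 'c"
    assume "\<And>x. x \<in> topspace E \<Longrightarrow> h x = k x"
    moreover have "A \<subseteq> topspace E"
      using s by (auto simp: A_def top)
    ultimately have "\<And>x. x \<in> A \<Longrightarrow> h x = k x" by auto
    then show "(h \<in> A \<rightarrow> A) = (k \<in> A \<rightarrow> A)"
      by (auto simp: Pi_iff)
  qed auto
  then show ?thesis
  proof (rule deformation_cohomologous)
    show "r \<in> topspace E \<rightarrow> A"
      by (auto simp: r_def A_def top)
    show "pullback E fst (pullback B (\<lambda>x. (x, s x)) u) \<in> cocycles E"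
      by (intro pullback_cocycles[OF fst] pullback_cocycles[OF sec] u)
    fix p \<sigma> assume \<sigma>: "singular_simplex p (subtopology E A) \<sigma>"
    then have "singular_simplex p E \<sigma>" "simplex_map p ((\<lambda>x. (x, s x)) \<circ> fst) \<sigma> = \<sigma>"
      by (auto simp: singular_simplex_subtopology intro!: simplex_map_id_gen[OF \<sigma>]) (auto simp: A_def)
    then show "u p \<sigma> = pullback E fst (pullback B (\<lambda>x. (x, s x)) u) p \<sigma>"
      by (simp add: pullback_compose[OF fst] pullback_apply)
  qed (rule u)
qed

section \<open>Mayer--Vietoris arguments for cochains\<close>

lemma pullback_id_apply:
  "singular_simplex p X \<sigma> \<Longrightarrow> pullback X id \<phi> p \<sigma> = \<phi> p \<sigma>"
  by (simp add: pullback_apply singular_simplex_def extensional_restrict)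

text \<open>A coboundary depends only on the faces of the simplex, hence may be computed in any
  space containing it. Restriction of cochains to a subspace is written \<open>pullback Y id\<close>
  from here on.\<close>

lemma coboundary_local:
  assumes "\<And>p \<sigma>. singular_simplex p Y \<sigma> \<Longrightarrow> \<phi> p \<sigma> = \<psi> p \<sigma>"
    and "singular_simplex p Y \<sigma>" "singular_simplex p X \<sigma>"
  shows "coboundary X \<phi> p \<sigma> = coboundary Y \<psi> p \<sigma>"
proof (cases p)
  case (Suc q)
  then show ?thesis
    using assms singular_simplex_subtopology_face[of q Y \<sigma>] by (simp add: coboundary_Suc del: sum.atMost_Suc)
qed simp

text \<open>The theorem of small simplices: an iterated subdivision makes a given chain small for
  the cover, and the homotopy joining it to the identity does not leave the small chains. Hence
  chains modulo small chains are acyclic.\<close>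

lemma small_cocycle_coboundary:
  assumes U: "openin X U" and V: "openin X V" and cover: "topspace X \<subseteq> U \<union> V"
    and \<phi>: "\<phi> \<in> cocycles X" "\<And>p \<sigma>. singular_simplex p (subtopology X U) \<sigma> \<Longrightarrow> \<phi> p \<sigma> = 0"
      "\<And>p \<sigma>. singular_simplex p (subtopology X V) \<sigma> \<Longrightarrow> \<phi> p \<sigma> = 0"
  shows "\<exists>\<psi>\<in>total_cochains X. (\<forall>p \<sigma>. singular_simplex p (subtopology X U) \<sigma> \<longrightarrow> \<psi> p \<sigma> = 0) \<and>
    (\<forall>p \<sigma>. singular_simplex p (subtopology X V) \<sigma> \<longrightarrow> \<psi> p \<sigma> = 0) \<and> \<phi> = coboundary X \<psi>"
proof -
  let ?S = "\<lambda>p \<sigma>. singular_simplex p (subtopology X U) \<sigma> \<or> singular_simplex p (subtopology X V) \<sigma>"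
  have "\<exists>w\<in>total_cochains X. (\<forall>p \<sigma>. ?S p \<sigma> \<longrightarrow> w p \<sigma> = 0) \<and> \<phi> = coboundary X w"
  proof (rule relative_cocycle_coboundary)
    show "singular_simplex p X \<sigma>" if "?S p \<sigma>" for p \<sigma>
      using that by (auto simp: singular_simplex_subtopology)
    show "?S p (singular_face (Suc p) k \<sigma>)" if "?S (Suc p) \<sigma>" "k \<le> Suc p" for p \<sigma> k
      using that singular_simplex_subtopology_face by blast
    show "\<exists>d. singular_chain (Suc p) X d \<and> Poly_Mapping.keys (c - chain_boundary (Suc p) d) \<subseteq> {\<sigma>. ?S p \<sigma>}"
      if c: "singular_chain p X c" and bd: "Poly_Mapping.keys (chain_boundary p c) \<subseteq> {\<sigma>. ?S (p - 1) \<sigma>}" for p c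
    proof -
      obtain n where n: "\<And>m f. n \<le> m \<Longrightarrow> f \<in> Poly_Mapping.keys ((singular_subdivision p ^^ m) c) \<Longrightarrow>
          \<exists>W\<in>{U, V}. f \<in> standard_simplex p \<rightarrow> W"
        using sufficient_iterated_singular_subdivision_exists[of "{U, V}" X p c] U V cover c by auto
      obtain h where h: "\<And>p. h p 0 = (0 :: 'a chain)" "\<And>p c1 c2. h p (c1-c2) = h p c1 - h p c2"
        "\<And>p X c. singular_chain p X c \<Longrightarrow> singular_chain (Suc p) X (h p c)"
        "\<And>p X c. singular_chain p X c \<Longrightarrow> chain_boundary (Suc p) (h p c) + h (p - Suc 0) (chain_boundary p c)
                   = (singular_subdivision p ^^ n) c - c"
        using chain_homotopic_iterated_singular_subdivision[of n] by blast
      have sd: "singular_chain p X ((singular_subdivision p ^^ m) c)" for m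
        by (induction m) (use c in \<open>auto intro: singular_chain_singular_subdivision\<close>)
      have 1: "Poly_Mapping.keys ((singular_subdivision p ^^ n) c) \<subseteq> {\<sigma>. ?S p \<sigma>}"
        using n[of n] sd[of n] by (fastforce simp: singular_chain_def singular_simplex_subtopology)
      \<comment> \<open>The homotopy \<open>h\<close> is one operator for all spaces, so on a
        simplex lying in \<open>U\<close> or in \<open>V\<close> its value is a chain of that same
        subspace.\<close>
      have small_h: "Poly_Mapping.keys (h q b) \<subseteq> {\<sigma>. ?S (Suc q) \<sigma>}" if "Poly_Mapping.keys b \<subseteq> {\<sigma>. ?S q \<sigma>}" for q b
        using that
      proof (induction b rule: frag_induction)
        case (one \<sigma>)
        then have "singular_chain q (subtopology X U) (frag_of \<sigma>) \<or> singular_chain q (subtopology X V) (frag_of \<sigma>)"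
          by (simp add: singular_chain_of)
        then show ?case
          using h(3) unfolding singular_chain_def by blast
      next
        case (diff a b)
        then show ?case
          using keys_diff[of "h q a" "h q b"] by (auto simp: h(2))
      qed (simp add: h(1))
      have 2: "Poly_Mapping.keys (h (p - 1) (chain_boundary p c)) \<subseteq> {\<sigma>. ?S p \<sigma>}"
      proof (cases p)
        case 0
        then show ?thesis by (simp add: h(1) chain_boundary_def)
      next
        case (Suc q)
        then show ?thesis using small_h[of "chain_boundary p c" q] bd by simp
      qed
      have "c - chain_boundary (Suc p) (- h p c) = (singular_subdivision p ^^ n) c - h (p - 1) (chain_boundary p c)"
        using h(4)[OF c] by (simp add: chain_boundary_minus algebra_simps)
      then have "Poly_Mapping.keys (c - chain_boundary (Suc p) (- h p c)) \<subseteq> {\<sigma>. ?S p \<sigma>}"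
        using 1 2 keys_diff[of "(singular_subdivision p ^^ n) c" "h (p - 1) (chain_boundary p c)"] by auto
      then show ?thesis
        using h(3)[OF c] by (intro exI[of _ "- h p c"]) (simp add: singular_chain_minus)
    qed
  qed (use \<phi> in auto)
  then show ?thesis by blast
qed

lemma total_cochains_glue:
  assumes f: "f \<in> total_cochains (subtopology X U)" and g: "g \<in> total_cochains (subtopology X V)"
    and eq: "\<And>p \<sigma>. singular_simplex p (subtopology X (U \<inter> V)) \<sigma> \<Longrightarrow> f p \<sigma> = g p \<sigma>"
  shows "\<exists>h\<in>total_cochains X. (\<forall>p \<sigma>. singular_simplex p (subtopology X U) \<sigma> \<longrightarrow> h p \<sigma> = f p \<sigma>) \<and>
    (\<forall>p \<sigma>. singular_simplex p (subtopology X V) \<sigma> \<longrightarrow> h p \<sigma> = g p \<sigma>)"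
proof -
  \<comment> \<open>On simplices contained in neither subspace this is the value of
    \<open>g\<close>, which is 0 there by normalisation.\<close>
  define h where "h p \<sigma> = (if singular_simplex p (subtopology X U) \<sigma> then f p \<sigma> else g p \<sigma>)" for p \<sigma>
  obtain M where M: "\<forall>p\<ge>M. \<forall>\<sigma>. f p \<sigma> = 0"
    using total_cochains_bound[OF f] by blast
  obtain N where N: "\<forall>p\<ge>N. \<forall>\<sigma>. g p \<sigma> = 0"
    using total_cochains_bound[OF g] by blast
  have "h \<in> total_cochains X"
    using f g M N by (intro total_cochains_bounded[of X _ "max M N"])
      (auto simp: h_def singular_simplex_subtopology total_cochains_def)
  moreover have "h p \<sigma> = g p \<sigma>" if "singular_simplex p (subtopology X V) \<sigma>" for p \<sigma>
    using that eq[of p \<sigma>] by (auto simp: h_def singular_simplex_subtopology)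
  ultimately show ?thesis
    by (intro bexI[of _ h]) (auto simp: h_def)
qed

text \<open>Since cochains are normalised to vanish off their space, extension by zero to a larger
  subspace leaves the function unchanged. This is surjectivity of restriction on cochains.\<close>

lemma total_cochains_subtopology_mono:
  assumes "w \<in> total_cochains (subtopology X A)" "A \<subseteq> A'"
  shows "w \<in> total_cochains (subtopology X A')"
  using assms singular_simplex_mono[of _ X A _ A'] unfolding total_cochains_def by blast

text \<open>Exactness at the direct sum. The discrepancy \<open>w\<close> on the overlap is extended
  by zero to \<open>U\<close> and removed there, after which the two functions glue. The result need
  not be a cocycle on simplices that are not small; its coboundary vanishes on small ones, and
  subtracting the primitive from \<open>small_cocycle_coboundary\<close> repairs it.\<close>

lemma Mayer_Vietoris_glue:
  assumes U: "openin X U" and V: "openin X V" and cover: "topspace X \<subseteq> U \<union> V"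
    and u: "u \<in> cocycles (subtopology X U)" and v: "v \<in> cocycles (subtopology X V)"
    and uv: "cohomologous (subtopology X (U \<inter> V)) (pullback (subtopology X (U \<inter> V)) id u) (pullback (subtopology X (U \<inter> V)) id v)"
  shows "\<exists>x\<in>cocycles X. cohomologous (subtopology X U) (pullback (subtopology X U) id x) u \<and>
                        cohomologous (subtopology X V) (pullback (subtopology X V) id x) v"
proof -
  let ?U = "subtopology X U" and ?V = "subtopology X V" and ?I = "subtopology X (U \<inter> V)"
  have I: "singular_simplex p ?U \<sigma>" "singular_simplex p ?V \<sigma>" if "singular_simplex p ?I \<sigma>" for p \<sigma>
    using that by (auto simp: singular_simplex_subtopology)
  have X: "singular_simplex p X \<sigma>" if "singular_simplex p ?U \<sigma> \<or> singular_simplex p ?V \<sigma>" for p \<sigma>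
    using that by (auto simp: singular_simplex_subtopology)
  obtain w where w: "w \<in> total_cochains ?I" "pullback ?I id u = pullback ?I id v + coboundary ?I w"
    using uv by (rule cohomologousE)
  have wU: "w \<in> total_cochains ?U"
    using w(1) by (rule total_cochains_subtopology_mono) auto
  have "\<exists>h\<in>total_cochains X. (\<forall>p \<sigma>. singular_simplex p ?U \<sigma> \<longrightarrow> h p \<sigma> = (u - coboundary ?U w) p \<sigma>) \<and>
    (\<forall>p \<sigma>. singular_simplex p ?V \<sigma> \<longrightarrow> h p \<sigma> = v p \<sigma>)"
  proof (rule total_cochains_glue)
    show "u - coboundary ?U w \<in> total_cochains ?U" "v \<in> total_cochains ?V"
      using u v wU by simp_all
    fix p \<sigma> assume \<sigma>: "singular_simplex p ?I \<sigma>"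
    have "coboundary ?U w p \<sigma> = coboundary ?I w p \<sigma>"
      using \<sigma> I by (intro coboundary_local) auto
    moreover have "u p \<sigma> = v p \<sigma> + coboundary ?I w p \<sigma>"
      using fun_cong[OF fun_cong[OF w(2)], of p \<sigma>] \<sigma> by (simp add: pullback_id_apply)
    ultimately show "(u - coboundary ?U w) p \<sigma> = v p \<sigma>"
      by simp
  qed
  then obtain h where h: "h \<in> total_cochains X" "\<And>p \<sigma>. singular_simplex p ?U \<sigma> \<Longrightarrow> h p \<sigma> = (u - coboundary ?U w) p \<sigma>"
      "\<And>p \<sigma>. singular_simplex p ?V \<sigma> \<Longrightarrow> h p \<sigma> = v p \<sigma>"
    by blast
  have "\<exists>\<psi>\<in>total_cochains X. (\<forall>p \<sigma>. singular_simplex p ?U \<sigma> \<longrightarrow> \<psi> p \<sigma> = 0) \<and>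
    (\<forall>p \<sigma>. singular_simplex p ?V \<sigma> \<longrightarrow> \<psi> p \<sigma> = 0) \<and> coboundary X h = coboundary X \<psi>"
  proof (rule small_cocycle_coboundary[OF U V cover])
    show "coboundary X h \<in> cocycles X"
      using h(1) by (intro cocyclesI) auto
    show "coboundary X h p \<sigma> = 0" if "singular_simplex p ?U \<sigma>" for p \<sigma>
    proof -
      have "coboundary X h p \<sigma> = coboundary ?U (u - coboundary ?U w) p \<sigma>"
        using that X h(2) by (intro coboundary_local) auto
      then show ?thesis using u by (simp add: coboundary_diff)
    qed
    show "coboundary X h p \<sigma> = 0" if "singular_simplex p ?V \<sigma>" for p \<sigma>
    proof -
      have "coboundary X h p \<sigma> = coboundary ?V v p \<sigma>"
        using that X h(3) by (intro coboundary_local) auto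
      then show ?thesis using v by simp
    qed
  qed
  then obtain \<psi> where \<psi>: "\<psi> \<in> total_cochains X" "\<And>p \<sigma>. singular_simplex p ?U \<sigma> \<Longrightarrow> \<psi> p \<sigma> = 0"
      "\<And>p \<sigma>. singular_simplex p ?V \<sigma> \<Longrightarrow> \<psi> p \<sigma> = 0" "coboundary X h = coboundary X \<psi>"
    by blast
  have "h - \<psi> \<in> cocycles X"
    using h(1) \<psi> by (intro cocyclesI) (auto simp: coboundary_diff)
  moreover have "pullback ?U id (h - \<psi>) = u - coboundary ?U w"
    by (rule total_cochains_eqI[of _ ?U])
      (use h \<psi> u wU in \<open>auto simp: pullback_id_apply intro: pullback_total[of _ X]\<close>)
  moreover have "pullback ?V id (h - \<psi>) = v"
    by (rule total_cochains_eqI[of _ ?V])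
      (use h \<psi> v in \<open>auto simp: pullback_id_apply intro: pullback_total[of _ X]\<close>)
  ultimately show ?thesis
    using wU by (intro bexI[of _ "h - \<psi>"]) (auto intro!: cohomologousI[of "- w"] simp: coboundary_uminus)
qed

text \<open>Exactness at the total space: a class trivial on both pieces is the connecting image of
  the difference \<open>s - t\<close> of its primitives, and it dies if that difference comes from
  cocycles \<open>a\<close> and \<open>b\<close> on the pieces.\<close>

lemma Mayer_Vietoris_trivial:
  assumes U: "openin X U" and V: "openin X V" and cover: "topspace X \<subseteq> U \<union> V"
    and x: "x \<in> cocycles X"
    and s: "s \<in> total_cochains (subtopology X U)" "pullback (subtopology X U) id x = coboundary (subtopology X U) s"
    and t: "t \<in> total_cochains (subtopology X V)" "pullback (subtopology X V) id x = coboundary (subtopology X V) t"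
    and a: "a \<in> cocycles (subtopology X U)" and b: "b \<in> cocycles (subtopology X V)"
    and st: "cohomologous (subtopology X (U \<inter> V))
       (pullback (subtopology X (U \<inter> V)) id s - pullback (subtopology X (U \<inter> V)) id t)
       (pullback (subtopology X (U \<inter> V)) id a - pullback (subtopology X (U \<inter> V)) id b)"
  shows "cohomologous X x 0"
proof -
  let ?U = "subtopology X U" and ?V = "subtopology X V" and ?I = "subtopology X (U \<inter> V)"
  have I: "singular_simplex p ?U \<sigma>" "singular_simplex p ?V \<sigma>" if "singular_simplex p ?I \<sigma>" for p \<sigma>
    using that by (auto simp: singular_simplex_subtopology)
  have X: "singular_simplex p X \<sigma>" if "singular_simplex p ?U \<sigma> \<or> singular_simplex p ?V \<sigma>" for p \<sigma>
    using that by (auto simp: singular_simplex_subtopology)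
  obtain w where w: "w \<in> total_cochains ?I"
      "pullback ?I id s - pullback ?I id t = pullback ?I id a - pullback ?I id b + coboundary ?I w"
    using st by (rule cohomologousE)
  have wU: "w \<in> total_cochains ?U"
    using w(1) by (rule total_cochains_subtopology_mono) auto
  have "\<exists>h\<in>total_cochains X. (\<forall>p \<sigma>. singular_simplex p ?U \<sigma> \<longrightarrow> h p \<sigma> = (s - a - coboundary ?U w) p \<sigma>) \<and>
    (\<forall>p \<sigma>. singular_simplex p ?V \<sigma> \<longrightarrow> h p \<sigma> = (t - b) p \<sigma>)"
  proof (rule total_cochains_glue)
    show "s - a - coboundary ?U w \<in> total_cochains ?U" "t - b \<in> total_cochains ?V"
      using s t a b wU by simp_all
    fix p \<sigma> assume \<sigma>: "singular_simplex p ?I \<sigma>"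
    have "coboundary ?U w p \<sigma> = coboundary ?I w p \<sigma>"
      using \<sigma> I by (intro coboundary_local) auto
    moreover have "s p \<sigma> - t p \<sigma> = a p \<sigma> - b p \<sigma> + coboundary ?I w p \<sigma>"
      using fun_cong[OF fun_cong[OF w(2)], of p \<sigma>] \<sigma> by (simp add: pullback_id_apply)
    ultimately show "(s - a - coboundary ?U w) p \<sigma> = (t - b) p \<sigma>"
      by simp
  qed
  then obtain h where h: "h \<in> total_cochains X" "\<And>p \<sigma>. singular_simplex p ?U \<sigma> \<Longrightarrow> h p \<sigma> = (s - a - coboundary ?U w) p \<sigma>"
      "\<And>p \<sigma>. singular_simplex p ?V \<sigma> \<Longrightarrow> h p \<sigma> = (t - b) p \<sigma>"
    by blast
  have "\<exists>\<psi>\<in>total_cochains X. (\<forall>p \<sigma>. singular_simplex p ?U \<sigma> \<longrightarrow> \<psi> p \<sigma> = 0) \<and>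
    (\<forall>p \<sigma>. singular_simplex p ?V \<sigma> \<longrightarrow> \<psi> p \<sigma> = 0) \<and> x - coboundary X h = coboundary X \<psi>"
  proof (rule small_cocycle_coboundary[OF U V cover])
    show "x - coboundary X h \<in> cocycles X"
      using h(1) x by (intro cocyclesI) (auto simp: coboundary_diff)
    show "(x - coboundary X h) p \<sigma> = 0" if "singular_simplex p ?U \<sigma>" for p \<sigma>
    proof -
      have "coboundary X h p \<sigma> = coboundary ?U (s - a - coboundary ?U w) p \<sigma>"
        using that X h(2) by (intro coboundary_local) auto
      moreover have "x p \<sigma> = coboundary ?U s p \<sigma>"
        using s(2) pullback_id_apply[OF that, of x] by simp
      ultimately show ?thesis using a by (simp add: coboundary_diff)
    qed
    show "(x - coboundary X h) p \<sigma> = 0" if "singular_simplex p ?V \<sigma>" for p \<sigma>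
    proof -
      have "coboundary X h p \<sigma> = coboundary ?V (t - b) p \<sigma>"
        using that X h(3) by (intro coboundary_local) auto
      moreover have "x p \<sigma> = coboundary ?V t p \<sigma>"
        using t(2) pullback_id_apply[OF that, of x] by simp
      ultimately show ?thesis using b by (simp add: coboundary_diff)
    qed
  qed
  then obtain \<psi> where "\<psi> \<in> total_cochains X" "x - coboundary X h = coboundary X \<psi>"
    by blast
  then show ?thesis
    using h(1) by (intro cohomologousI[of "h + \<psi>"]) (auto simp: coboundary_add algebra_simps)
qed

section \<open>Winding cochains\<close>

definition edge_point :: "real \<Rightarrow> nat \<Rightarrow> real" where
  "edge_point t = (\<lambda>i. if i = 0 then 1 - t else if i = 1 then t else 0)"

definition edge_path :: "('a \<Rightarrow> complex) \<Rightarrow> ((nat \<Rightarrow> real) \<Rightarrow> 'a) \<Rightarrow> real \<Rightarrow> complex" where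
  "edge_path f \<sigma> t = f (\<sigma> (edge_point t))"

text \<open>With the normalisation by \<open>2 * pi * \<i>\<close> two logarithms of the same number
  differ by an integer.\<close>

definition unit_log :: "complex \<Rightarrow> complex" where
  "unit_log z = Ln z / (2 * of_real pi * \<i>)"

text \<open>
  The change of the logarithm of \<open>f\<close> along an edge, minus the change of its principal branch,
  divided by \<open>2 \<pi> \<i>\<close>.  This is an integer, whence the floor is only a conversion.
\<close>

definition winding_cochain :: "'a topology \<Rightarrow> ('a \<Rightarrow> complex) \<Rightarrow> 'a cochain" where
  "winding_cochain X f = (\<lambda>p \<sigma>. if p = 1 \<and> singular_simplex 1 X \<sigma>
     then \<lfloor>Re (winding_number (edge_path f \<sigma>) 0
                 - (unit_log (edge_path f \<sigma> 1) - unit_log (edge_path f \<sigma> 0)))\<rfloor> else 0)"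

definition point_cochain :: "'a topology \<Rightarrow> ('a \<Rightarrow> int) \<Rightarrow> 'a cochain" where
  "point_cochain X n = (\<lambda>p \<sigma>. if p = 0 \<and> singular_simplex 0 X \<sigma> then n (\<sigma> (edge_point 0)) else 0)"

definition nonvanishing :: "'a topology \<Rightarrow> ('a \<Rightarrow> complex) \<Rightarrow> bool" where
  "nonvanishing X f \<longleftrightarrow> continuous_map X euclidean f \<and> (\<forall>x\<in>topspace X. f x \<noteq> 0)"

lemma nonvanishing_mult: "nonvanishing X f \<Longrightarrow> nonvanishing X g \<Longrightarrow> nonvanishing X (\<lambda>x. f x * g x)"
  by (simp add: nonvanishing_def continuous_map_mult)

lemma nonvanishing_divide: "nonvanishing X f \<Longrightarrow> nonvanishing X g \<Longrightarrow> nonvanishing X (\<lambda>x. f x / g x)"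
  by (simp add: nonvanishing_def continuous_map_divide)

lemma edge_point_in_simplex: "t \<in> {0..1} \<Longrightarrow> edge_point t \<in> standard_simplex 1"
  by (auto simp: edge_point_def standard_simplex_def)

lemma edge_point_0_in_simplex: "edge_point 0 \<in> standard_simplex p"
  using basis_in_standard_simplex[of 0 p] by (simp add: edge_point_def cong: if_cong)

lemma singular_simplex_topspace:
  "singular_simplex p X \<sigma> \<Longrightarrow> v \<in> standard_simplex p \<Longrightarrow> \<sigma> v \<in> topspace X"
  by (auto simp: singular_simplex_def continuous_map_def)

lemma continuous_on_simplex_param:
  fixes m :: "'c::topological_space \<Rightarrow> nat \<Rightarrow> real"
  assumes \<sigma>: "singular_simplex p X \<sigma>" and f: "continuous_map X euclidean f"
    and m: "\<And>i. continuous_on S (\<lambda>s. m s i)" "\<And>s. s \<in> S \<Longrightarrow> m s \<in> standard_simplex p"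
  shows "continuous_on S (\<lambda>s. f (\<sigma> (m s)))"
proof -
  have "continuous_map (top_of_set S) (subtopology (powertop_real UNIV) (standard_simplex p)) m"
    using m by (auto simp: continuous_map_in_subtopology continuous_map_componentwise_UNIV)
  then have "continuous_map (top_of_set S) euclidean (f \<circ> (\<sigma> \<circ> m))"
    using \<sigma> f by (intro continuous_map_compose) (auto simp: singular_simplex_def)
  then show ?thesis by (simp add: o_def)
qed

lemma continuous_on_edge_point: "continuous_on S (\<lambda>t. edge_point t i)"
  by (cases "i = 0"; cases "i = 1"; simp add: edge_point_def; intro continuous_intros)

lemma exp_unit_log: "z \<noteq> 0 \<Longrightarrow> exp (2 * of_real pi * \<i> * unit_log z) = z"
  by (simp add: unit_log_def)

lemma exp_2pi_eq_imp_int: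
  assumes "exp (2 * of_real pi * \<i> * a) = exp (2 * of_real pi * \<i> * b)"
  shows "a - b \<in> \<int>"
proof -
  obtain n :: int where "2 * of_real pi * \<i> * a = 2 * of_real pi * \<i> * b + (of_int (2 * n) * pi) * \<i>"
    using assms unfolding exp_eq by auto
  then have "2 * of_real pi * \<i> * (a - b) = 2 * of_real pi * \<i> * of_int n"
    by (simp add: algebra_simps)
  then have "a - b = of_int n"
    by simp
  then show ?thesis by simp
qed

lemma unit_log_diff_int:
  assumes "z = exp (2 * of_real pi * \<i> * a)"
  shows "a - unit_log z \<in> \<int>"
  by (rule exp_2pi_eq_imp_int) (use assms in \<open>simp add: exp_unit_log\<close>)

lemma floor_Re_Ints: "(z::complex) \<in> \<int> \<Longrightarrow> of_int \<lfloor>Re z\<rfloor> = z"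
  by (auto elim!: Ints_cases)

text \<open>The rule for computing values: any continuous logarithm \<open>q\<close> along the edge
  may be used. At both ends \<open>q\<close> differs from the principal branch by an integer, so the
  floor in the definition loses nothing.\<close>

lemma winding_cochain_eq:
  assumes \<sigma>: "singular_simplex 1 X \<sigma>" and q: "continuous_on {0..1} q"
    and exp: "\<And>t. t \<in> {0..1} \<Longrightarrow> f (\<sigma> (edge_point t)) = exp (2 * of_real pi * \<i> * q t)"
  shows "of_int (winding_cochain X f 1 \<sigma>)
    = (q 1 - unit_log (f (\<sigma> (edge_point 1)))) - (q 0 - unit_log (f (\<sigma> (edge_point 0))))"
proof -
  let ?q = "\<lambda>t. 2 * of_real pi * \<i> * q t"
  have "path ?q"
    using q by (auto simp: path_def intro!: continuous_intros)
  then have "winding_number (exp \<circ> ?q) 0 = q 1 - q 0"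
    by (subst winding_number_compose_exp) (auto simp: pathfinish_def pathstart_def field_simps)
  moreover have "winding_number (edge_path f \<sigma>) 0 = winding_number (exp \<circ> ?q) 0"
    by (rule winding_number_cong) (simp add: edge_path_def exp)
  ultimately have "winding_number (edge_path f \<sigma>) 0 - (unit_log (edge_path f \<sigma> 1) - unit_log (edge_path f \<sigma> 0))
     = (q 1 - unit_log (f (\<sigma> (edge_point 1)))) - (q 0 - unit_log (f (\<sigma> (edge_point 0))))"
    by (simp add: edge_path_def algebra_simps)
  moreover have "(q 1 - unit_log (f (\<sigma> (edge_point 1)))) - (q 0 - unit_log (f (\<sigma> (edge_point 0)))) \<in> \<int>"
    using exp by (intro Ints_diff unit_log_diff_int) auto
  ultimately show ?thesis
    using \<sigma> by (simp add: winding_cochain_def floor_Re_Ints del: minus_complex.simps)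
qed

lemma nonvanishing_edge_log:
  assumes \<sigma>: "singular_simplex 1 X \<sigma>" and f: "nonvanishing X f"
  obtains q where "continuous_on {0..1} q"
    "\<And>t. t \<in> {0..1} \<Longrightarrow> f (\<sigma> (edge_point t)) = exp (2 * of_real pi * \<i> * q t)"
proof -
  have "continuous_on {0..1} (\<lambda>t. f (\<sigma> (edge_point t)))"
  proof (rule continuous_on_simplex_param[OF \<sigma>])
    show "continuous_on {0..1} (\<lambda>t. edge_point t i)" for i
      by (rule continuous_on_edge_point)
  qed (use f edge_point_in_simplex in \<open>auto simp: nonvanishing_def\<close>)
  moreover have "contractible {0..1::real}"
    by (simp add: convex_imp_contractible)
  moreover have "f (\<sigma> (edge_point t)) \<noteq> 0" if "t \<in> {0..1}" for t
    using singular_simplex_topspace[OF \<sigma> edge_point_in_simplex[OF that]] f by (auto simp: nonvanishing_def)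
  ultimately obtain g where g: "continuous_on {0..1} g" "\<And>t. t \<in> {0..1} \<Longrightarrow> f (\<sigma> (edge_point t)) = exp (g t)"
    using continuous_logarithm_on_contractible by blast
  show ?thesis
    by (rule that[of "\<lambda>t. g t / (2 * of_real pi * \<i>)"]) (use g in \<open>auto intro!: continuous_intros\<close>)
qed

lemma winding_cochain_total [simp]: "winding_cochain X f \<in> total_cochains X"
  by (rule total_cochains_bounded[of X _ 2]) (auto simp: winding_cochain_def)

lemma winding_cochain_degree: "p \<noteq> 1 \<Longrightarrow> winding_cochain X f p = (\<lambda>\<sigma>. 0)"
  by (simp add: winding_cochain_def fun_eq_iff)

lemma singular_face_edge:
  assumes "k \<le> 2" "t \<in> {0..1}"
  shows "singular_face 2 k \<sigma> (edge_point t) = \<sigma> (simplical_face k (edge_point t))"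
  using edge_point_in_simplex[OF assms(2)] by (simp add: singular_face_def)

text \<open>Along a 2-simplex \<open>f\<close> has a single continuous logarithm, because the
  parameter triangle is contractible. With \<open>n\<close> its integral deviation from the
  principal branch at a point, the value on an edge is a difference of \<open>n\<close> at the two
  ends, and these differences cancel around the triangle.\<close>

lemma winding_cochain_cocycle [simp]:
  assumes f: "nonvanishing X f"
  shows "winding_cochain X f \<in> cocycles X"
proof (rule cocyclesI)
  show "coboundary X (winding_cochain X f) = 0"
  proof (intro ext)
    fix p \<sigma>
    show "coboundary X (winding_cochain X f) p \<sigma> = 0 p \<sigma>"
    proof (cases "p = 2 \<and> singular_simplex p X \<sigma>")
      case False
      then show ?thesis
        by (cases p; cases "p = 2") (auto simp: coboundary_Suc winding_cochain_degree numeral_2_eq_2 simp del: sum.atMost_Suc)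
    next
      case True
      then have \<sigma>: "singular_simplex 2 X \<sigma>" and p: "p = Suc 1" by auto
      define T where "T = {(s::real, t::real). 0 \<le> s \<and> 0 \<le> t \<and> s + t \<le> 1}"
      define tri where "tri = (\<lambda>(s::real, t::real) i::nat. if i = 0 then 1 - s - t else if i = 1 then s else if i = 2 then t else 0)"
      have tri_in: "tri z \<in> standard_simplex 2" if "z \<in> T" for z
        using that by (auto simp: T_def tri_def standard_simplex_def numeral_2_eq_2)
      have "continuous_on T (\<lambda>z. f (\<sigma> (tri z)))"
      proof (rule continuous_on_simplex_param[OF \<sigma>])
        show "continuous_on T (\<lambda>z. tri z i)" for i
          by (cases "i = 0"; cases "i = 1"; cases "i = 2"; simp add: tri_def case_prod_unfold; intro continuous_intros)
      qed (use f tri_in in \<open>auto simp: nonvanishing_def\<close>)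
      moreover have "contractible T"
      proof (rule convex_imp_contractible)
        have "T = {z. (-1, 0) \<bullet> z \<le> 0} \<inter> {z. (0, -1) \<bullet> z \<le> 0} \<inter> {z. (1, 1) \<bullet> z \<le> 1}"
          by (auto simp: T_def)
        then show "convex T"
          by (simp add: convex_Int convex_halfspace_le)
      qed
      moreover have "f (\<sigma> (tri z)) \<noteq> 0" if "z \<in> T" for z
        using singular_simplex_topspace[OF \<sigma> tri_in[OF that]] f by (auto simp: nonvanishing_def)
      ultimately obtain g where g: "continuous_on T g" "\<And>z. z \<in> T \<Longrightarrow> f (\<sigma> (tri z)) = exp (g z)"
        using continuous_logarithm_on_contractible by blast
      define Q where "Q z = g z / (2 * of_real pi * \<i>)" for z
      have Q: "continuous_on T Q" "\<And>z. z \<in> T \<Longrightarrow> f (\<sigma> (tri z)) = exp (2 * of_real pi * \<i> * Q z)"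
        using g by (auto simp: Q_def intro!: continuous_intros)
      define n where "n z = Q z - unit_log (f (\<sigma> (tri z)))" for z
      have edge: "of_int (winding_cochain X f 1 (singular_face 2 k \<sigma>)) = n (e 1) - n (e 0)"
        if k: "k \<le> 2" and e: "continuous_on {0..1} e" "e \<in> {0..1} \<rightarrow> T"
          and face: "\<And>t. t \<in> {0..1} \<Longrightarrow> simplical_face k (edge_point t) = tri (e t)" for k e
      proof -
        have "singular_simplex 1 X (singular_face 2 k \<sigma>)"
          using singular_simplex_singular_face[OF \<sigma>, of k] k by simp
        then have "of_int (winding_cochain X f 1 (singular_face 2 k \<sigma>)) =
            (Q (e 1) - unit_log (f (singular_face 2 k \<sigma> (edge_point 1)))) -
            (Q (e 0) - unit_log (f (singular_face 2 k \<sigma> (edge_point 0))))"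
        proof (rule winding_cochain_eq)
          show "continuous_on {0..1} (\<lambda>t. Q (e t))"
            by (rule continuous_on_compose2[OF Q(1) e(1)]) (use e(2) in auto)
          show "f (singular_face 2 k \<sigma> (edge_point t)) = exp (2 * of_real pi * \<i> * Q (e t))" if "t \<in> {0..1}" for t
            using Q(2)[OF funcset_mem[OF e(2) that]] that k by (auto simp: singular_face_edge face)
        qed
        then show ?thesis
          using k by (simp add: n_def singular_face_edge face)
      qed
      \<comment> \<open>The faces opposite the vertices 0, 1, 2, each traversed from its smaller to
        its larger vertex; this accounts for the signs in the final sum.\<close>
      have tri_eq: "simplical_face k (edge_point t) = tri z"
        if "k = 0 \<and> z = (1 - t, t) \<or> k = 1 \<and> z = (0, t) \<or> k = 2 \<and> z = (t, 0)" for k t z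
      proof
        fix i :: nat
        consider "i = 0" | "i = 1" | "i = 2" | "i > 2" by linarith
        then show "simplical_face k (edge_point t) i = tri z i"
          using that by cases (auto simp: tri_def simplical_face_def edge_point_def)
      qed
      have "of_int (winding_cochain X f 1 (singular_face 2 0 \<sigma>)) = n ((\<lambda>t. (1 - t, t)) 1) - n ((\<lambda>t. (1 - t, t)) 0)"
        by (rule edge) (auto intro!: continuous_intros tri_eq simp: T_def)
      then have 0: "of_int (winding_cochain X f 1 (singular_face 2 0 \<sigma>)) = n (0, 1) - n (1, 0)"
        by simp
      have "of_int (winding_cochain X f 1 (singular_face 2 1 \<sigma>)) = n ((\<lambda>t. (0, t)) 1) - n ((\<lambda>t. (0, t)) 0)"
        by (rule edge) (auto intro!: continuous_intros tri_eq simp: T_def)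
      then have 1: "of_int (winding_cochain X f 1 (singular_face 2 1 \<sigma>)) = n (0, 1) - n (0, 0)"
        by simp
      have "of_int (winding_cochain X f 1 (singular_face 2 2 \<sigma>)) = n ((\<lambda>t. (t, 0)) 1) - n ((\<lambda>t. (t, 0)) 0)"
        by (rule edge) (auto intro!: continuous_intros tri_eq simp: T_def)
      then have 2: "of_int (winding_cochain X f 1 (singular_face 2 2 \<sigma>)) = n (1, 0) - n (0, 0)"
        by simp
      have "of_int (winding_cochain X f 1 (singular_face 2 0 \<sigma>) - winding_cochain X f 1 (singular_face 2 1 \<sigma>)
          + winding_cochain X f 1 (singular_face 2 2 \<sigma>)) = (0 :: complex)"
        unfolding of_int_add of_int_diff 0 1 2 by simp
      then show ?thesis
        using \<sigma> unfolding p of_int_eq_0_iff by (simp add: coboundary_Suc numeral_2_eq_2)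
    qed
  qed
qed simp

lemma pullback_winding_cochain:
  assumes h: "continuous_map X Y h"
  shows "pullback X h (winding_cochain Y f) = winding_cochain X (f \<circ> h)"
proof (intro ext)
  fix p \<sigma>
  show "pullback X h (winding_cochain Y f) p \<sigma> = winding_cochain X (f \<circ> h) p \<sigma>"
  proof (cases "p = 1 \<and> singular_simplex p X \<sigma>")
    case True
    have eq: "edge_path f (simplex_map 1 h \<sigma>) t = edge_path (f \<circ> h) \<sigma> t" if "0 \<le> t" "t \<le> 1" for t
      using that edge_point_in_simplex[of t] by (simp add: edge_path_def simplex_map_def)
    have "winding_number (edge_path f (simplex_map 1 h \<sigma>)) 0 = winding_number (edge_path (f \<circ> h) \<sigma>) 0"
      by (rule winding_number_cong) (rule eq)
    then show ?thesis
      using True singular_simplex_simplex_map[OF _ h] eq[of 0] eq[of 1] by (simp add: pullback_def winding_cochain_def)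
  qed (auto simp: pullback_def winding_cochain_def)
qed

lemma winding_cochain_cong:
  assumes "\<And>x. x \<in> topspace X \<Longrightarrow> f x = g x"
  shows "winding_cochain X f = winding_cochain X g"
proof (intro ext)
  fix p \<sigma>
  show "winding_cochain X f p \<sigma> = winding_cochain X g p \<sigma>"
  proof (cases "p = 1 \<and> singular_simplex p X \<sigma>")
    case True
    have eq: "edge_path f \<sigma> t = edge_path g \<sigma> t" if "0 \<le> t" "t \<le> 1" for t
      using that edge_point_in_simplex[of t] True singular_simplex_topspace by (auto simp: edge_path_def intro!: assms)
    have "winding_number (edge_path f \<sigma>) 0 = winding_number (edge_path g \<sigma>) 0"
      by (rule winding_number_cong) (rule eq)
    then show ?thesis
      by (simp add: winding_cochain_def eq)
  qed (auto simp: winding_cochain_def)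
qed

section \<open>Products, quotients and logarithms on slit planes\<close>

lemma point_cochain_total [simp]: "point_cochain X n \<in> total_cochains X"
  by (rule total_cochains_bounded[of X _ 1]) (auto simp: point_cochain_def)

lemma point_cochain_cong:
  assumes "\<And>x. x \<in> topspace X \<Longrightarrow> n x = m x"
  shows "point_cochain X n = point_cochain X m"
  using assms singular_simplex_topspace[OF _ edge_point_0_in_simplex]
  by (auto simp: point_cochain_def fun_eq_iff)

lemma coboundary_point_cochain:
  "coboundary X (point_cochain X n) p \<sigma> =
    (if p = 1 \<and> singular_simplex 1 X \<sigma> then n (\<sigma> (edge_point 1)) - n (\<sigma> (edge_point 0)) else 0)"
proof (cases "p = 1 \<and> singular_simplex 1 X \<sigma>")
  case True
  have "singular_simplex 0 X (singular_face 1 k \<sigma>)" if "k \<le> 1" for k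
    using True singular_simplex_singular_face[of 1 X \<sigma> k] that by simp
  moreover have "singular_face 1 0 \<sigma> (edge_point 0) = \<sigma> (edge_point 1)"
    using edge_point_0_in_simplex[of 0] by (auto simp: singular_face_def simplical_face_def edge_point_def intro!: arg_cong[of _ _ \<sigma>])
  moreover have "singular_face 1 1 \<sigma> (edge_point 0) = \<sigma> (edge_point 0)"
    using edge_point_0_in_simplex[of 0] by (auto simp: singular_face_def simplical_face_def edge_point_def intro!: arg_cong[of _ _ \<sigma>])
  ultimately show ?thesis
    using True by (simp add: coboundary_Suc point_cochain_def)
next
  case False
  then show ?thesis
    by (cases p; cases "p = 1") (auto simp: coboundary_Suc point_cochain_def simp del: sum.atMost_Suc)
qed

text \<open>Continuous logarithms along an edge add exactly, while principal branches add up to an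
  integer \<open>d\<close> depending only on the point. This function is discontinuous, which is
  harmless for a 0-cochain, and it bounds the defect.\<close>

lemma winding_cochain_mult:
  assumes f: "nonvanishing X f" and g: "nonvanishing X g"
  shows "cohomologous X (winding_cochain X (\<lambda>x. f x * g x)) (winding_cochain X f + winding_cochain X g)"
proof (rule cohomologousI)
  define d where "d x = unit_log (f x) + unit_log (g x) - unit_log (f x * g x)" for x
  have d: "of_int \<lfloor>Re (d x)\<rfloor> = d x" if "x \<in> topspace X" for x
    using f g that unfolding d_def
    by (intro floor_Re_Ints unit_log_diff_int) (simp add: nonvanishing_def distrib_left exp_add exp_unit_log)
  show "winding_cochain X (\<lambda>x. f x * g x) = winding_cochain X f + winding_cochain X g
      + coboundary X (point_cochain X (\<lambda>x. \<lfloor>Re (d x)\<rfloor>))"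
  proof (intro ext)
    fix p \<sigma>
    show "winding_cochain X (\<lambda>x. f x * g x) p \<sigma> = (winding_cochain X f + winding_cochain X g
      + coboundary X (point_cochain X (\<lambda>x. \<lfloor>Re (d x)\<rfloor>))) p \<sigma>"
    proof (cases "p = 1 \<and> singular_simplex 1 X \<sigma>")
      case True
      then have \<sigma>: "singular_simplex 1 X \<sigma>" and p: "p = 1" by auto
      obtain q where q: "continuous_on {0..1} q"
        "\<And>t. t \<in> {0..1} \<Longrightarrow> f (\<sigma> (edge_point t)) = exp (2 * of_real pi * \<i> * q t)"
        using nonvanishing_edge_log[OF \<sigma> f] by blast
      obtain r where r: "continuous_on {0..1} r"
        "\<And>t. t \<in> {0..1} \<Longrightarrow> g (\<sigma> (edge_point t)) = exp (2 * of_real pi * \<i> * r t)"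
        using nonvanishing_edge_log[OF \<sigma> g] by blast
      have 1: "of_int (winding_cochain X f 1 \<sigma>) = (q 1 - unit_log (f (\<sigma> (edge_point 1)))) - (q 0 - unit_log (f (\<sigma> (edge_point 0))))"
        by (rule winding_cochain_eq[OF \<sigma>]) (use q in auto)
      have 2: "of_int (winding_cochain X g 1 \<sigma>) = (r 1 - unit_log (g (\<sigma> (edge_point 1)))) - (r 0 - unit_log (g (\<sigma> (edge_point 0))))"
        by (rule winding_cochain_eq[OF \<sigma>]) (use r in auto)
      have 3: "of_int (winding_cochain X (\<lambda>x. f x * g x) 1 \<sigma>)
        = ((q 1 + r 1) - unit_log (f (\<sigma> (edge_point 1)) * g (\<sigma> (edge_point 1))))
          - ((q 0 + r 0) - unit_log (f (\<sigma> (edge_point 0)) * g (\<sigma> (edge_point 0))))"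
        by (rule winding_cochain_eq[OF \<sigma>, where q = "\<lambda>t. q t + r t"])
          (use q r in \<open>auto simp: distrib_left exp_add intro!: continuous_intros\<close>)
      have 4: "\<sigma> (edge_point 0) \<in> topspace X" "\<sigma> (edge_point 1) \<in> topspace X"
        using singular_simplex_topspace[OF \<sigma> edge_point_in_simplex] by auto
      have "of_int (winding_cochain X (\<lambda>x. f x * g x) 1 \<sigma>) = (of_int (winding_cochain X f 1 \<sigma> + winding_cochain X g 1 \<sigma>
          + (\<lfloor>Re (d (\<sigma> (edge_point 1)))\<rfloor> - \<lfloor>Re (d (\<sigma> (edge_point 0)))\<rfloor>)) :: complex)"
        unfolding of_int_add of_int_diff d[OF 4(1)] d[OF 4(2)] 1 2 3 by (simp add: d_def)
      then show ?thesis
        using \<sigma> unfolding p of_int_eq_iff by (simp add: coboundary_point_cochain)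
    qed (auto simp: winding_cochain_def coboundary_point_cochain)
  qed
qed simp

text \<open>A global logarithm \<open>l\<close> serves on all edges at once, so the cocycle bounds
  the integer function by which \<open>l\<close> exceeds the principal branch.\<close>

lemma winding_cochain_log:
  assumes l: "continuous_map X euclidean l" and exp: "\<And>x. x \<in> topspace X \<Longrightarrow> f x = exp (2 * of_real pi * \<i> * l x)"
    and n: "\<And>x. x \<in> topspace X \<Longrightarrow> l x = unit_log (f x) + of_int (n x)"
  shows "winding_cochain X f = coboundary X (point_cochain X n)"
proof (intro ext)
  fix p \<sigma>
  show "winding_cochain X f p \<sigma> = coboundary X (point_cochain X n) p \<sigma>"
  proof (cases "p = 1 \<and> singular_simplex 1 X \<sigma>")
    case True
    then have \<sigma>: "singular_simplex 1 X \<sigma>" and p: "p = 1" by auto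
    have "of_int (winding_cochain X f 1 \<sigma>) = (l (\<sigma> (edge_point 1)) - unit_log (f (\<sigma> (edge_point 1))))
        - (l (\<sigma> (edge_point 0)) - unit_log (f (\<sigma> (edge_point 0))))"
    proof (rule winding_cochain_eq[OF \<sigma>])
      show "continuous_on {0..1} (\<lambda>t. l (\<sigma> (edge_point t)))"
      proof (rule continuous_on_simplex_param[OF \<sigma> l])
        show "continuous_on {0..1} (\<lambda>t. edge_point t i)" for i
          by (rule continuous_on_edge_point)
      qed (use edge_point_in_simplex in auto)
      show "f (\<sigma> (edge_point t)) = exp (2 * of_real pi * \<i> * l (\<sigma> (edge_point t)))" if "t \<in> {0..1}" for t
        using exp singular_simplex_topspace[OF \<sigma> edge_point_in_simplex[OF that]] by auto
    qed
    also have "\<dots> = of_int (n (\<sigma> (edge_point 1)) - n (\<sigma> (edge_point 0)))"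
      using n singular_simplex_topspace[OF \<sigma> edge_point_in_simplex] by simp
    finally show ?thesis
      using \<sigma> unfolding p of_int_eq_iff by (simp add: coboundary_point_cochain)
  qed (auto simp: winding_cochain_def coboundary_point_cochain)
qed

lemma continuous_map_Ln_compose:
  assumes f: "continuous_map X euclidean f" and slit: "\<And>x. x \<in> topspace X \<Longrightarrow> f x \<notin> \<real>\<^sub>\<le>\<^sub>0"
  shows "continuous_map X euclidean (\<lambda>x. Ln (f x))"
proof -
  have "continuous_map (top_of_set (- \<real>\<^sub>\<le>\<^sub>0)) euclidean Ln"
    by (auto intro!: continuous_intros)
  then have "continuous_map X euclidean (Ln \<circ> f)"
    using f slit by (intro continuous_map_compose[of _ "top_of_set (- \<real>\<^sub>\<le>\<^sub>0)"]) (auto simp: continuous_map_in_subtopology)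
  then show ?thesis by (simp add: o_def)
qed

lemma winding_cochain_slit_negative:
  assumes f: "continuous_map X euclidean f" and slit: "\<And>x. x \<in> topspace X \<Longrightarrow> f x \<notin> \<real>\<^sub>\<le>\<^sub>0"
  shows "winding_cochain X f = 0"
proof -
  have "winding_cochain X f = coboundary X (point_cochain X (\<lambda>x. 0))"
  proof (rule winding_cochain_log[where l = "\<lambda>x. unit_log (f x)"])
    show "continuous_map X euclidean (\<lambda>x. unit_log (f x))"
      unfolding unit_log_def
      by (intro continuous_map_divide continuous_map_Ln_compose[OF f slit]) auto
    show "f x = exp (2 * of_real pi * \<i> * unit_log (f x))" if "x \<in> topspace X" for x
      using slit[OF that] by (subst exp_unit_log) auto
  qed simp
  also have "\<dots> = 0"
    by (auto simp: coboundary_point_cochain fun_eq_iff)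
  finally show ?thesis .
qed

text \<open>Off the nonnegative real axis \<open>Ln (- f x) + of_real pi * \<i>\<close> is a
  continuous logarithm. It agrees with the principal branch in the closed upper half plane and
  exceeds it by one full turn below the axis.\<close>

lemma winding_cochain_slit_positive:
  assumes f: "continuous_map X euclidean f" and slit: "\<And>x. x \<in> topspace X \<Longrightarrow> - f x \<notin> \<real>\<^sub>\<le>\<^sub>0"
  shows "winding_cochain X f = coboundary X (point_cochain X (\<lambda>x. if Im (f x) < 0 then 1 else 0))"
proof (rule winding_cochain_log[where l = "\<lambda>x. (Ln (- f x) + of_real pi * \<i>) / (2 * of_real pi * \<i>)"])
  show "continuous_map X euclidean (\<lambda>x. (Ln (- f x) + of_real pi * \<i>) / (2 * of_real pi * \<i>))"
    by (intro continuous_map_divide continuous_map_add continuous_map_Ln_compose slit) (use f in auto)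
  fix x assume x: "x \<in> topspace X"
  then have nz: "f x \<noteq> 0"
    using slit by force
  have Ln: "Ln (f x) = (if Im (f x) < 0 then Ln (- f x) - \<i> * pi else Ln (- f x) + \<i> * pi)"
    using Ln_minus[of "- f x"] nz slit[OF x] by (auto simp: complex_nonpos_Reals_iff)
  show "f x = exp (2 * of_real pi * \<i> * ((Ln (- f x) + of_real pi * \<i>) / (2 * of_real pi * \<i>)))"
    using nz by (simp add: exp_add)
  show "(Ln (- f x) + of_real pi * \<i>) / (2 * of_real pi * \<i>) = unit_log (f x) + of_int (if Im (f x) < 0 then 1 else 0)"
    unfolding unit_log_def Ln by (simp add: field_simps)
qed

lemma winding_cochain_divide:
  assumes f: "nonvanishing X f" and g: "nonvanishing X g"
  shows "cohomologous X (winding_cochain X (\<lambda>x. f x / g x)) (winding_cochain X f - winding_cochain X g)"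
proof -
  have "cohomologous X (winding_cochain X (\<lambda>x. f x / g x * g x)) (winding_cochain X (\<lambda>x. f x / g x) + winding_cochain X g)"
    by (rule winding_cochain_mult[OF nonvanishing_divide[OF f g] g])
  moreover have "winding_cochain X (\<lambda>x. f x / g x * g x) = winding_cochain X f"
    by (rule winding_cochain_cong) (use g in \<open>auto simp: nonvanishing_def\<close>)
  ultimately have "cohomologous X (winding_cochain X (\<lambda>x. f x / g x) + winding_cochain X g - winding_cochain X g)
     (winding_cochain X f - winding_cochain X g)"
    by (intro cohomologous_diff cohomologous_refl) (simp add: cohomologous_sym)
  then show ?thesis by simp
qed

text \<open>On a loop the corrections by the principal branch at the two ends cancel, leaving the
  winding number, which for a valid path is the contour integral.\<close>

lemma winding_cochain_path_simplex:
  assumes \<gamma>: "pathin X \<gamma>" "\<gamma> 0 = \<gamma> 1" and f: "nonvanishing X f" and valid: "valid_path (f \<circ> \<gamma>)"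
  shows "of_int (winding_cochain X f 1 (path_simplex \<gamma>))
    = contour_integral (f \<circ> \<gamma>) (\<lambda>w. 1 / (2 * of_real pi * \<i> * w))"
proof -
  have cont: "continuous_map (subtopology euclideanreal {0..1}) X \<gamma>"
    using \<gamma>(1) by (simp add: pathin_def)
  have "continuous_map (subtopology (powertop_real UNIV) (standard_simplex 1)) (subtopology euclideanreal {0..1}) (\<lambda>v. v 1)"
    by (auto simp: continuous_map_in_subtopology standard_simplex_def
        intro!: continuous_map_from_subtopology continuous_map_product_projection)
  from continuous_map_compose[OF this cont] have \<sigma>: "singular_simplex 1 X (path_simplex \<gamma>)"
    by (simp add: singular_simplex_def path_simplex_def o_def)
  have eq: "edge_path f (path_simplex \<gamma>) t = (f \<circ> \<gamma>) t" if "0 \<le> t" "t \<le> 1" for t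
    using that edge_point_in_simplex[of t] by (simp add: edge_path_def path_simplex_def) (simp add: edge_point_def)
  have nz: "0 \<notin> path_image (f \<circ> \<gamma>)"
    using continuous_map_image_subset_topspace[OF cont] f by (auto simp: path_image_def nonvanishing_def)
  obtain q where q: "path q" "pathfinish q - pathstart q = 2 * of_real pi * \<i> * winding_number (f \<circ> \<gamma>) 0"
      "\<And>t. t \<in> {0..1} \<Longrightarrow> (f \<circ> \<gamma>) t = 0 + exp (q t)"
    using winding_number_as_continuous_log[OF valid_path_imp_path[OF valid] nz] by blast
  have "of_int (winding_cochain X f 1 (path_simplex \<gamma>)) =
      (q 1 / (2 * of_real pi * \<i>) - unit_log (f (path_simplex \<gamma> (edge_point 1))))
      - (q 0 / (2 * of_real pi * \<i>) - unit_log (f (path_simplex \<gamma> (edge_point 0))))"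
    by (rule winding_cochain_eq[OF \<sigma>])
      (use q eq in \<open>auto simp: path_def edge_path_def intro!: continuous_intros\<close>)
  also have "\<dots> = winding_number (f \<circ> \<gamma>) 0"
    using q(2) eq[of 0] eq[of 1] \<gamma>(2) by (simp add: edge_path_def pathstart_def pathfinish_def flip: diff_divide_distrib)
  also have "\<dots> = 1 / (2 * of_real pi * \<i>) * contour_integral (f \<circ> \<gamma>) (\<lambda>w. 1 / w)"
    using winding_number_valid_path[OF valid nz] by simp
  also have "\<dots> = contour_integral (f \<circ> \<gamma>) (\<lambda>w. 1 / (2 * of_real pi * \<i>) * (1 / w))"
    using contour_integrable_inversediff[OF valid nz] by (subst contour_integral_lmul) auto
  finally show ?thesis by simp
qed

text \<open>Steenrod's relation: the square of an integral 1-cocycle \<open>a\<close> is the coboundary of \<open>- a (a - 1) / 2\<close>.\<close>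

lemma cup_square_degree_1:
  assumes a: "a \<in> cocycles X" and deg: "\<And>p. p \<noteq> 1 \<Longrightarrow> a p = (\<lambda>\<sigma>. 0)"
  shows "cohomologous X (cup X a a) 0"
proof (rule cohomologousI)
  define w where "w p \<sigma> = - (a p \<sigma> * (a p \<sigma> - 1) div 2)" for p \<sigma>
  have wdeg: "w p \<sigma> = 0" if "p \<noteq> 1" for p \<sigma>
    using deg[OF that] by (simp add: w_def)
  show "w \<in> total_cochains X"
  proof (rule total_cochains_bounded[of X _ 2])
    show "w p \<sigma> = 0" if "\<not> singular_simplex p X \<sigma>" for p \<sigma>
      using a that by (simp add: w_def total_cochains_outside[of a X])
  qed (simp add: wdeg)
  show "cup X a a = 0 + coboundary X w"
  proof (intro ext)
    fix p \<sigma>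
    show "cup X a a p \<sigma> = (0 + coboundary X w) p \<sigma>"
    proof (cases "p = 2 \<and> singular_simplex p X \<sigma>")
      case True
      then have \<sigma>: "singular_simplex 2 X \<sigma>" and p: "p = Suc (Suc 0)" by auto
      define x where "x k = a 1 (singular_face 2 k \<sigma>)" for k
      \<comment> \<open>The front edge omits vertex 2 and the back edge omits vertex 0; the
        remaining edge is their sum by the cocycle condition. The rest is the polarisation of
        \<open>y * (y - 1) / 2\<close>.\<close>
      have f: "front_face 1 \<sigma> = singular_face 2 2 \<sigma>"
        using front_face_last_face[of 1 \<sigma>] front_face_self[OF \<sigma>] by (simp add: numeral_2_eq_2)
      have b: "back_face 1 1 \<sigma> = singular_face 2 0 \<sigma>"
        using back_face_first_face[of 1 0 \<sigma>] back_face_0[OF \<sigma>] by (simp add: numeral_2_eq_2)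
      have cup: "cup X a a p \<sigma> = x 2 * x 0"
        using \<sigma> f b deg by (simp add: p cup_def numeral_2_eq_2 x_def)
      have "coboundary X a (Suc (Suc 0)) \<sigma> = 0"
        using a by simp
      then have x: "x 1 = x 0 + x 2"
        using \<sigma> by (simp add: coboundary_Suc numeral_2_eq_2 x_def)
      have "coboundary X w p \<sigma> = x 1 * (x 1 - 1) div 2 - x 0 * (x 0 - 1) div 2 - x 2 * (x 2 - 1) div 2"
        using \<sigma> by (simp add: p coboundary_Suc numeral_2_eq_2 x_def w_def)
      also have "\<dots> = x 2 * x 0"
      proof -
        define h where "h y = y * (y - 1) div 2" for y :: int
        have ev: "2 * h y = y * (y - 1)" for y
          by (simp add: h_def even_two_times_div_two)
        have "2 * (h (x 1) - h (x 0) - h (x 2)) = 2 * (x 2 * x 0)"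
          unfolding right_diff_distrib ev x by (simp add: algebra_simps)
        then have "h (x 1) - h (x 0) - h (x 2) = x 2 * x 0" by (metis mult_left_cancel zero_neq_numeral)
        then show ?thesis by (simp add: h_def)
      qed
      finally show ?thesis by (simp add: cup)
    next
      case False
      have "cup X a a p \<sigma> = 0"
      proof (cases "singular_simplex p X \<sigma>")
        case True
        with False have p: "p \<noteq> 2" by simp
        then have "a i (front_face i \<sigma>) * a (p - i) (back_face i (p - i) \<sigma>) = 0" for i
          using deg[of i] deg[of "p - i"] by (cases "i = 1") auto
        then show ?thesis by (auto simp: cup_def intro!: sum.neutral)
      qed (simp add: cup_def)
      moreover have "coboundary X w p \<sigma> = 0"
        using False by (cases p; cases "p = 2") (auto simp: coboundary_Suc wdeg numeral_2_eq_2 simp del: sum.atMost_Suc)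
      ultimately show ?thesis by simp
    qed
  qed
qed

section \<open>Complements of graphs\<close>

definition fibre_space :: "'b topology \<Rightarrow> ('b \<times> complex) set \<Rightarrow> ('b \<times> complex) topology" where
  "fibre_space B W = subtopology (prod_topology B euclidean) W"

lemma topspace_fibre_space: "topspace (fibre_space B W) = {z \<in> W. fst z \<in> topspace B}"
  by (auto simp: fibre_space_def)

lemma subtopology_fibre_space: "subtopology (fibre_space B W) W' = fibre_space B (W \<inter> W')"
  by (simp add: fibre_space_def subtopology_subtopology)

lemma continuous_map_fst_fibre_space [simp]: "continuous_map (fibre_space B W) B fst"
  by (simp add: fibre_space_def)

lemma continuous_map_snd_fibre_space [simp]: "continuous_map (fibre_space B W) euclidean snd"
  by (simp add: fibre_space_def continuous_map_from_subtopology continuous_map_snd)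

lemma continuous_map_fibre_spaceI:
  assumes "continuous_map X B g" "continuous_map X euclidean h" "\<And>x. x \<in> topspace X \<Longrightarrow> (g x, h x) \<in> W"
  shows "continuous_map X (fibre_space B W) (\<lambda>x. (g x, h x))"
  using assms by (auto simp: fibre_space_def continuous_map_in_subtopology continuous_map_pairedI)

lemma continuous_map_fibre_space_id:
  "W \<subseteq> W' \<Longrightarrow> continuous_map (fibre_space B W) (fibre_space B W') id"
  by (auto simp: fibre_space_def continuous_map_in_subtopology continuous_map_from_subtopology)

lemma pullback_id_left:
  "continuous_map X Y f \<Longrightarrow> pullback X f (pullback Y id \<phi>) = pullback X f \<phi>"
  by (simp add: pullback_compose)

lemma pullback_id_right:
  "continuous_map X Y id \<Longrightarrow> pullback X id (pullback Y f \<phi>) = pullback X f \<phi>"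
  by (simp add: pullback_compose)

lemma pullback_section:
  assumes "continuous_map B E s" "continuous_map E B g" "\<And>x. x \<in> topspace B \<Longrightarrow> g (s x) = x"
    and "b \<in> total_cochains B"
  shows "pullback B s (pullback E g b) = b"
  using assms by (simp add: pullback_compose pullback_ident)

text \<open>If a class on the total space comes from the base, every section recovers the base
  class; in particular any two sections give the same restriction.\<close>

lemma sections_cohomologous:
  assumes E: "continuous_map E B g" and s: "continuous_map B E s" "\<And>x. x \<in> topspace B \<Longrightarrow> g (s x) = x"
    and u: "u \<in> cocycles E" "cohomologous E u (pullback E g b)" and b: "b \<in> total_cochains B"
  shows "cohomologous B (pullback B s u) b"
  using pullback_cohomologous[OF s(1) u(2)] pullback_section[OF s(1) E s(2) b] by simp

lemma cohomologous_empty_space: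
  assumes "topspace X = {}" "u \<in> total_cochains X" "v \<in> total_cochains X"
  shows "cohomologous X u v"
proof -
  have "u = v"
    by (rule total_cochains_eqI[of _ X]) (use assms singular_simplex_empty in auto)
  then show ?thesis by simp
qed

lemma cohomologous_disjoint_union:
  assumes U: "openin X U" and V: "openin X V" and cover: "topspace X \<subseteq> U \<union> V" and disj: "U \<inter> V = {}"
    and u: "u \<in> cocycles X" and v: "v \<in> cocycles X"
    and eqU: "cohomologous (subtopology X U) (pullback (subtopology X U) id u) (pullback (subtopology X U) id v)"
    and eqV: "cohomologous (subtopology X V) (pullback (subtopology X V) id u) (pullback (subtopology X V) id v)"
  shows "cohomologous X u v"
proof -
  let ?U = "subtopology X U" and ?V = "subtopology X V" and ?I = "subtopology X (U \<inter> V)"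
  obtain s where s: "s \<in> total_cochains ?U" "pullback ?U id u = pullback ?U id v + coboundary ?U s"
    using eqU by (rule cohomologousE)
  obtain t where t: "t \<in> total_cochains ?V" "pullback ?V id u = pullback ?V id v + coboundary ?V t"
    using eqV by (rule cohomologousE)
  have "cohomologous X (u - v) 0"
  proof (rule Mayer_Vietoris_trivial[OF U V cover])
    show "cohomologous ?I (pullback ?I id s - pullback ?I id t) (pullback ?I id 0 - pullback ?I id 0)"
      using disj pullback_total[OF s(1), of ?I id] pullback_total[OF t(1), of ?I id]
      by (intro cohomologous_empty_space) auto
  qed (use u v s t in \<open>auto simp: pullback_diff\<close>)
  then show ?thesis
    using cohomologous_diff_0 by blast
qed

section \<open>Tubes around a graph and classes on the punctured tube\<close>

locale disc_bundle =
  fixes B :: "'b topology" and p :: "'b \<Rightarrow> complex" and r :: "'b \<Rightarrow> real"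
  assumes cont_p: "continuous_map B euclidean p" and cont_r: "continuous_map B euclideanreal r"
    and r_pos: "\<And>x. x \<in> topspace B \<Longrightarrow> r x > 0"
begin

definition offset :: "'b \<times> complex \<Rightarrow> complex" where
  "offset z = snd z - p (fst z)"

text \<open>Only the displacement from the centre is constrained, so a subset of the plane describes
  a subspace of the disc bundle over all of \<open>B\<close>, however centre and radius
  vary.\<close>

definition tube :: "complex set \<Rightarrow> ('b \<times> complex) set" where
  "tube S = {z. fst z \<in> topspace B \<and> offset z \<in> S \<and> cmod (offset z) < r (fst z)}"

definition sec :: "complex \<Rightarrow> 'b \<Rightarrow> 'b \<times> complex" where
  "sec k x = (x, p x + r x *\<^sub>R k)"

abbreviation "T S \<equiv> fibre_space B (tube S)"

lemma offset_sec [simp]: "offset (sec k x) = r x *\<^sub>R k"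
  by (simp add: offset_def sec_def)

lemma fst_sec [simp]: "fst (sec k x) = x"
  by (simp add: sec_def)

lemma tube_Int: "tube S \<inter> tube S' = tube (S \<inter> S')"
  by (auto simp: tube_def)

lemma tube_mono: "S \<subseteq> S' \<Longrightarrow> tube S \<subseteq> tube S'"
  by (auto simp: tube_def)

lemma topspace_T [simp]: "topspace (T S) = tube S"
  by (auto simp: topspace_fibre_space tube_def)

lemma subtopology_T: "S' \<subseteq> S \<Longrightarrow> subtopology (T S) (tube S') = T S'"
  by (simp add: subtopology_fibre_space tube_Int Int_absorb1)

lemma continuous_map_offset: "continuous_map (T S) euclidean offset"
proof -
  have "continuous_map (T S) euclidean (p \<circ> fst)"
    by (rule continuous_map_compose[OF _ cont_p]) simp
  then show ?thesis
    unfolding offset_def by (intro continuous_map_diff) (auto simp: o_def)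
qed

lemma offset_in: "z \<in> topspace (T S) \<Longrightarrow> offset z \<in> S"
  unfolding topspace_T by (simp add: tube_def)

lemma openin_tube:
  assumes "open S'" "S' \<subseteq> S"
  shows "openin (T S) (tube S')"
proof -
  have "openin (T S) {z \<in> topspace (T S). offset z \<in> S'}"
    using continuous_map_offset by (rule openin_continuous_map_preimage) (use assms in simp)
  moreover have "{z \<in> topspace (T S). offset z \<in> S'} = tube S'"
    unfolding topspace_T using assms(2) by (auto simp: tube_def)
  ultimately show ?thesis by simp
qed

lemma sec_in_tube: "x \<in> topspace B \<Longrightarrow> cmod k < 1 \<Longrightarrow> r x *\<^sub>R k \<in> S \<Longrightarrow> sec k x \<in> tube S"
  using r_pos[of x] by (simp add: tube_def)

lemma continuous_map_sec:
  assumes "cmod k < 1" "\<And>\<rho>. \<rho> > 0 \<Longrightarrow> \<rho> *\<^sub>R k \<in> S"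
  shows "continuous_map B (T S) (sec k)"
  unfolding sec_def
proof (rule continuous_map_fibre_spaceI)
  show "continuous_map B euclidean (\<lambda>x. p x + r x *\<^sub>R k)"
    by (intro continuous_map_add continuous_map_scaleR cont_p cont_r) auto
  show "(x, p x + r x *\<^sub>R k) \<in> tube S" if "x \<in> topspace B" for x
    using sec_in_tube[of x k S] that assms r_pos by (simp add: sec_def)
qed (simp_all flip: id_def)

text \<open>The target point of the contraction is \<open>k\<close> in units of the varying radius,
  so \<open>S\<close> must be star-shaped about every positive multiple of \<open>k\<close>. The
  bound on the displacement survives because balls are convex.\<close>

lemma tube_cohomologous:
  assumes k: "cmod k < 1"
    and star: "\<And>\<rho>. \<rho> > 0 \<Longrightarrow> \<rho> *\<^sub>R k \<in> S"
      "\<And>w \<rho> t. w \<in> S \<Longrightarrow> \<rho> > 0 \<Longrightarrow> 0 \<le> t \<Longrightarrow> t < 1 \<Longrightarrow> (1 - t) *\<^sub>R w + t *\<^sub>R (\<rho> *\<^sub>R k) \<in> S"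
    and u: "u \<in> cocycles (T S)"
  shows "cohomologous (T S) u (pullback (T S) fst (pullback B (sec k) u))"
  unfolding fibre_space_def sec_def
proof (rule fibrewise_star_cohomologous)
  show "continuous_map B euclidean (\<lambda>x. p x + r x *\<^sub>R k)"
    by (intro continuous_map_add continuous_map_scaleR cont_p cont_r) auto
  show "(x, p x + r x *\<^sub>R k) \<in> tube S" if "x \<in> topspace B" for x
    using sec_in_tube[of x k S] that k star r_pos by (simp add: sec_def)
  show "u \<in> cocycles (subtopology (prod_topology B euclidean) (tube S))"
    using u by (simp add: fibre_space_def)
  fix x y and t :: real
  assume x: "x \<in> topspace B" and y: "(x, y) \<in> tube S" and t: "0 \<le> t" "t \<le> 1"
  have eq: "offset (x, (1 - t) *\<^sub>R y + t *\<^sub>R (p x + r x *\<^sub>R k)) = (1 - t) *\<^sub>R offset (x, y) + t *\<^sub>R (r x *\<^sub>R k)"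
    by (simp add: offset_def algebra_simps)
  have "(1 - t) *\<^sub>R offset (x, y) + t *\<^sub>R (r x *\<^sub>R k) \<in> S"
    using star(2)[of "offset (x, y)" "r x" t] star(1)[of "r x"] y t r_pos[OF x] by (cases "t = 1") (auto simp: tube_def)
  moreover have "(1 - t) *\<^sub>R offset (x, y) + t *\<^sub>R (r x *\<^sub>R k) \<in> ball 0 (r x)"
    using y t k r_pos[OF x] by (intro convexD[OF convex_ball]) (auto simp: tube_def)
  ultimately show "(x, (1 - t) *\<^sub>R y + t *\<^sub>R (p x + r x *\<^sub>R k)) \<in> tube S"
    using x by (simp add: tube_def eq)
qed

lemma tube_UNIV_cohomologous:
  assumes "u \<in> cocycles (T UNIV)"
  shows "cohomologous (T UNIV) u (pullback (T UNIV) fst (pullback B (sec 0) u))"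
  by (rule tube_cohomologous) (use assms in auto)

text \<open>The two slit planes cover the punctured plane and meet in two half planes. Each of the
  four is star-shaped about the points of a half axis, so the punctured tube is computed like a
  circle covered by two arcs; the sections \<open>1/2\<close>, \<open>-1/2\<close>,
  \<open>\<i>/2\<close>, \<open>-\<i>/2\<close> are the base points.\<close>

definition right_slit :: "complex set" where "right_slit = {w. w \<notin> \<real>\<^sub>\<le>\<^sub>0}"
definition left_slit :: "complex set" where "left_slit = {w. - w \<notin> \<real>\<^sub>\<le>\<^sub>0}"
definition upper :: "complex set" where "upper = {w. Im w > 0}"
definition lower :: "complex set" where "lower = {w. Im w < 0}"

lemmas half_planes = right_slit_def left_slit_def upper_def lower_def complex_nonpos_Reals_iff

lemma open_half_planes: "open right_slit" "open left_slit" "open upper" "open lower"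
proof -
  have "right_slit = - \<real>\<^sub>\<le>\<^sub>0"
    by (auto simp: right_slit_def)
  then show "open right_slit"
    by (metis open_Compl closed_nonpos_Reals_complex)
  have "left_slit = uminus -` (- \<real>\<^sub>\<le>\<^sub>0)"
    by (auto simp: left_slit_def)
  moreover have "open (uminus -` (- \<real>\<^sub>\<le>\<^sub>0) :: complex set)"
    by (intro open_vimage open_Compl closed_nonpos_Reals_complex continuous_on_minus continuous_on_id)
  ultimately show "open left_slit"
    by (simp only:)
  show "open upper" "open lower"
    by (auto simp: upper_def lower_def open_halfspace_Im_gt open_halfspace_Im_lt)
qed

lemma upper_subset: "upper \<subseteq> right_slit" "upper \<subseteq> left_slit" "upper \<subseteq> - {0}" "upper \<subseteq> right_slit \<inter> left_slit"
  and lower_subset: "lower \<subseteq> right_slit" "lower \<subseteq> left_slit" "lower \<subseteq> - {0}" "lower \<subseteq> right_slit \<inter> left_slit"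
  and slit_subset: "right_slit \<subseteq> - {0}" "left_slit \<subseteq> - {0}" "right_slit \<inter> left_slit \<subseteq> - {0}"
  by (auto simp: half_planes)

lemma slit_cover: "- {0} = right_slit \<union> left_slit"
  by (auto simp: half_planes complex_eq_iff)

lemma slit_Int: "right_slit \<inter> left_slit = upper \<union> lower"
  by (auto simp: half_planes)

lemma right_slit_cohomologous:
  assumes "u \<in> cocycles (T right_slit)"
  shows "cohomologous (T right_slit) u (pullback (T right_slit) fst (pullback B (sec (1/2)) u))"
proof (rule tube_cohomologous)
  show "(1 - t) *\<^sub>R w + t *\<^sub>R (\<rho> *\<^sub>R (1/2)) \<in> right_slit" if "w \<in> right_slit" "\<rho> > 0" "0 \<le> t" "t < 1" for w t and \<rho> :: real
  proof -
    have "0 < (1 - t) * Re w + t * \<rho> / 2" if "Re w > 0"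
      using that \<open>\<rho> > 0\<close> \<open>0 \<le> t\<close> \<open>t < 1\<close> by (intro add_pos_nonneg) auto
    then show ?thesis
      using that by (auto simp: half_planes)
  qed
qed (use assms in \<open>auto simp: half_planes\<close>)

lemma left_slit_cohomologous:
  assumes "u \<in> cocycles (T left_slit)"
  shows "cohomologous (T left_slit) u (pullback (T left_slit) fst (pullback B (sec (- (1/2))) u))"
proof (rule tube_cohomologous)
  show "(1 - t) *\<^sub>R w + t *\<^sub>R (\<rho> *\<^sub>R (- (1/2))) \<in> left_slit" if "w \<in> left_slit" "\<rho> > 0" "0 \<le> t" "t < 1" for w t and \<rho> :: real
  proof -
    have "(1 - t) * Re w < t * \<rho> / 2" if "Re w < 0"
      using mult_pos_neg[of "1 - t" "Re w"] mult_nonneg_nonneg[of t \<rho>] that \<open>\<rho> > 0\<close> \<open>0 \<le> t\<close> \<open>t < 1\<close> by linarith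
    then show ?thesis
      using that by (auto simp: half_planes)
  qed
qed (use assms in \<open>auto simp: half_planes\<close>)

lemma upper_cohomologous:
  assumes "u \<in> cocycles (T upper)"
  shows "cohomologous (T upper) u (pullback (T upper) fst (pullback B (sec (\<i>/2)) u))"
  by (rule tube_cohomologous)
    (use assms in \<open>auto simp: half_planes norm_divide intro!: add_pos_nonneg mult_pos_pos\<close>)

lemma lower_cohomologous:
  assumes "u \<in> cocycles (T lower)"
  shows "cohomologous (T lower) u (pullback (T lower) fst (pullback B (sec (- (\<i>/2))) u))"
proof (rule tube_cohomologous)
  show "(1 - t) *\<^sub>R w + t *\<^sub>R (\<rho> *\<^sub>R (- (\<i>/2))) \<in> lower" if "w \<in> lower" "\<rho> > 0" "0 \<le> t" "t < 1" for w t and \<rho> :: real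
  proof -
    have "(1 - t) * Im w < t * \<rho> / 2"
      using mult_pos_neg[of "1 - t" "Im w"] mult_nonneg_nonneg[of t \<rho>] that unfolding lower_def mem_Collect_eq by linarith
    then show ?thesis
      by (simp add: lower_def)
  qed
qed (use assms in \<open>auto simp: half_planes norm_divide\<close>)

lemma cont_sec:
  "continuous_map B (T right_slit) (sec (1/2))" "continuous_map B (T left_slit) (sec (- (1/2)))"
  "continuous_map B (T upper) (sec (\<i>/2))" "continuous_map B (T lower) (sec (- (\<i>/2)))"
  by (rule continuous_map_sec; auto simp: half_planes norm_divide)+

lemma cont_T_id: "S \<subseteq> S' \<Longrightarrow> continuous_map (T S) (T S') id"
  by (rule continuous_map_fibre_space_id) (rule tube_mono)

lemma cont_sec_mono: "S \<subseteq> S' \<Longrightarrow> continuous_map B (T S) (sec k) \<Longrightarrow> continuous_map B (T S') (sec k)"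
  using continuous_map_compose[OF _ cont_T_id[of S S']] by fastforce

abbreviation wind :: "complex set \<Rightarrow> ('b \<times> complex) cochain" where
  "wind S \<equiv> winding_cochain (T S) offset"

lemma nonvanishing_offset: "S \<subseteq> - {0} \<Longrightarrow> nonvanishing (T S) offset"
  using continuous_map_offset[of S] offset_in[of _ S] unfolding nonvanishing_def by blast

lemma pullback_wind: "S \<subseteq> S' \<Longrightarrow> pullback (T S) id (wind S') = wind S"
  by (simp add: pullback_winding_cochain[OF cont_T_id])

text \<open>The primitive of the winding cocycle on the left slit. On the right slit that cocycle is
  literally 0, so \<open>jump\<close>, being 0 above and 1 below the axis, represents the residue on
  the overlap.\<close>

definition jump :: "('b \<times> complex) cochain" where
  "jump = point_cochain (T left_slit) (\<lambda>z. if Im (offset z) < 0 then 1 else 0)"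

lemma wind_right_slit: "wind right_slit = 0"
  by (rule winding_cochain_slit_negative[OF continuous_map_offset])
    (use offset_in[of _ right_slit] in \<open>simp add: right_slit_def\<close>)

lemma wind_left_slit: "wind left_slit = coboundary (T left_slit) jump"
  unfolding jump_def
  by (rule winding_cochain_slit_positive[OF continuous_map_offset])
    (use offset_in[of _ left_slit] in \<open>simp add: left_slit_def\<close>)

lemma pullback_point_cochain:
  assumes "continuous_map X Y h"
  shows "pullback X h (point_cochain Y n) = point_cochain X (n \<circ> h)"
  using singular_simplex_simplex_map[OF _ assms] edge_point_0_in_simplex[of 0]
  by (auto simp: pullback_def point_cochain_def simplex_map_def fun_eq_iff)

lemma jump_upper: "pullback (T upper) id jump = 0"
proof -
  have "pullback (T upper) id jump = point_cochain (T upper) (\<lambda>z. 0)"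
    unfolding jump_def pullback_point_cochain[OF cont_T_id[OF upper_subset(2)]]
    by (rule point_cochain_cong) (use offset_in[of _ upper] in \<open>force simp: upper_def\<close>)
  then show ?thesis by (simp add: point_cochain_def fun_eq_iff)
qed

lemma jump_lower: "pullback (T lower) id jump = unit_cochain (T lower)"
proof -
  have "pullback (T lower) id jump = point_cochain (T lower) (\<lambda>z. 1)"
    unfolding jump_def pullback_point_cochain[OF cont_T_id[OF lower_subset(2)]]
    by (rule point_cochain_cong) (use offset_in[of _ lower] in \<open>force simp: lower_def\<close>)
  then show ?thesis by (simp add: point_cochain_def unit_cochain_def fun_eq_iff)
qed

lemma wind_cup_left_slit:
  assumes "b \<in> cocycles B"
  shows "cup (T left_slit) (wind left_slit) (pullback (T left_slit) fst b)
    = coboundary (T left_slit) (cup (T left_slit) jump (pullback (T left_slit) fst b))"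
  using assms pullback_cocycles[OF continuous_map_fst_fibre_space assms] 
  by (simp add: wind_left_slit coboundary_cup)

lemma jump_total [simp]: "jump \<in> total_cochains (T left_slit)"
  by (simp add: jump_def)

lemma T_slit_Int:
  "subtopology (T (- {0})) (tube right_slit \<inter> tube left_slit) = T (right_slit \<inter> left_slit)"
  by (simp only: tube_Int subtopology_T[OF slit_subset(3)])

lemma slit_Int_cohomologous:
  assumes "u \<in> cocycles (T (right_slit \<inter> left_slit))" "v \<in> cocycles (T (right_slit \<inter> left_slit))"
    and "cohomologous (T upper) (pullback (T upper) id u) (pullback (T upper) id v)"
    and "cohomologous (T lower) (pullback (T lower) id u) (pullback (T lower) id v)"
  shows "cohomologous (T (right_slit \<inter> left_slit)) u v"
proof (rule cohomologous_disjoint_union)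
  show "openin (T (right_slit \<inter> left_slit)) (tube upper)" "openin (T (right_slit \<inter> left_slit)) (tube lower)"
    by (rule openin_tube; use open_half_planes upper_subset lower_subset in auto)+
  show "topspace (T (right_slit \<inter> left_slit)) \<subseteq> tube upper \<union> tube lower"
    unfolding topspace_T slit_Int by (auto simp: tube_def)
  show "tube upper \<inter> tube lower = {}"
    by (auto simp: tube_def half_planes)
qed (use assms in \<open>simp_all add: subtopology_T upper_subset lower_subset\<close>)

text \<open>Mayer--Vietoris for the two slits with zero correcting cocycles: whatever freedom there
  is in the primitives has to be absorbed into \<open>s\<close> and \<open>t\<close> beforehand, and
  then agreement can be tested on each half plane separately.\<close>

lemma punctured_tube_trivial:
  assumes x: "x \<in> cocycles (T (- {0}))"
    and s: "s \<in> total_cochains (T right_slit)" "pullback (T right_slit) id x = coboundary (T right_slit) s"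
    and t: "t \<in> total_cochains (T left_slit)" "pullback (T left_slit) id x = coboundary (T left_slit) t"
    and up: "cohomologous (T upper) (pullback (T upper) id s) (pullback (T upper) id t)"
    and low: "cohomologous (T lower) (pullback (T lower) id s) (pullback (T lower) id t)"
  shows "cohomologous (T (- {0})) x 0"
proof (rule Mayer_Vietoris_trivial[where U = "tube right_slit" and V = "tube left_slit" and s = s and t = t and a = 0 and b = 0])
  let ?I = "right_slit \<inter> left_slit"
  have I: "continuous_map (T ?I) (T right_slit) id" "continuous_map (T ?I) (T left_slit) id"
    by (auto intro!: cont_T_id)
  have "cohomologous (T ?I) (pullback (T ?I) id s - pullback (T ?I) id t) 0"
  proof (rule slit_Int_cohomologous)
    have "coboundary (T ?I) (pullback (T ?I) id s) = pullback (T ?I) id x"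
      using coboundary_pullback[OF I(1), of s] s(2) pullback_id_left[OF I(1), of x] by simp
    moreover have "coboundary (T ?I) (pullback (T ?I) id t) = pullback (T ?I) id x"
      using coboundary_pullback[OF I(2), of t] t(2) pullback_id_left[OF I(2), of x] by simp
    ultimately show "pullback (T ?I) id s - pullback (T ?I) id t \<in> cocycles (T ?I)"
      using pullback_total[OF s(1), of "T ?I" id] pullback_total[OF t(1), of "T ?I" id]
      by (intro cocyclesI) (auto simp: coboundary_diff)
    show "cohomologous (T upper) (pullback (T upper) id (pullback (T ?I) id s - pullback (T ?I) id t)) (pullback (T upper) id 0)"
      using up pullback_id_left[OF cont_T_id[OF upper_subset(4)]] cohomologous_diff_0
      by (simp add: pullback_diff) blast
    show "cohomologous (T lower) (pullback (T lower) id (pullback (T ?I) id s - pullback (T ?I) id t)) (pullback (T lower) id 0)"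
      using low pullback_id_left[OF cont_T_id[OF lower_subset(4)]] cohomologous_diff_0
      by (simp add: pullback_diff) blast
  qed simp
  then show "cohomologous (subtopology (T (- {0})) (tube right_slit \<inter> tube left_slit))
     (pullback (subtopology (T (- {0})) (tube right_slit \<inter> tube left_slit)) id s -
      pullback (subtopology (T (- {0})) (tube right_slit \<inter> tube left_slit)) id t)
     (pullback (subtopology (T (- {0})) (tube right_slit \<inter> tube left_slit)) id 0 -
      pullback (subtopology (T (- {0})) (tube right_slit \<inter> tube left_slit)) id 0)"
    by (simp add: T_slit_Int)
  show "openin (T (- {0})) (tube right_slit)" "openin (T (- {0})) (tube left_slit)"
    by (intro openin_tube open_half_planes slit_subset)+
  show "topspace (T (- {0})) \<subseteq> tube right_slit \<union> tube left_slit"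
    unfolding topspace_T slit_cover by (auto simp: tube_def)
qed (use x s t in \<open>simp_all only: subtopology_T[OF slit_subset(1)] subtopology_T[OF slit_subset(2)] cocycles_0\<close>)

lemma fst_cocycles: "b \<in> cocycles B \<Longrightarrow> pullback (T S) fst b \<in> cocycles (T S)"
  by (rule pullback_cocycles) simp_all

lemma cup_jump_upper:
  "pullback (T upper) id (cup (T left_slit) jump (pullback (T left_slit) fst b)) = 0"
  by (simp add: pullback_cup[OF cont_T_id[OF upper_subset(2)]] jump_upper)

lemma cup_jump_lower:
  assumes "b \<in> cocycles B"
  shows "pullback (T lower) id (cup (T left_slit) jump (pullback (T left_slit) fst b)) = pullback (T lower) fst b"
  using fst_cocycles[OF assms, of lower]
  by (simp add: pullback_cup[OF cont_T_id[OF lower_subset(2)]] jump_lower pullback_id_right[OF cont_T_id[OF lower_subset(2)]])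

text \<open>The existence half of Leray--Hirsch for a circle bundle: \<open>b0\<close> is the
  restriction to a section, and the other base class is the residue, measured by how differently the
  primitives on the two slits disagree above and below the axis.\<close>

theorem punctured_tube_decomposition:
  assumes u: "u \<in> cocycles (T (- {0}))"
  shows "\<exists>b0\<in>cocycles B. \<exists>b1\<in>cocycles B. cohomologous (T (- {0})) u
           (pullback (T (- {0})) fst b0 + cup (T (- {0})) (wind (- {0})) (pullback (T (- {0})) fst b1))"
proof -
  let ?N = "T (- {0})" and ?U = "T right_slit" and ?V = "T left_slit" and ?A = "T upper" and ?L = "T lower"
  have U: "continuous_map ?U ?N id" and V: "continuous_map ?V ?N id"
    by (auto intro!: cont_T_id slit_subset)
  have AU: "continuous_map ?A ?U id" and AV: "continuous_map ?A ?V id" and LU: "continuous_map ?L ?U id" and LV: "continuous_map ?L ?V id"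
    by (auto intro!: cont_T_id upper_subset lower_subset)
  have secU: "continuous_map B ?N (sec (1/2))" and secV: "continuous_map B ?N (sec (- (1/2)))"
    using cont_sec_mono[OF slit_subset(1) cont_sec(1)] cont_sec_mono[OF slit_subset(2) cont_sec(2)] .
  define b0 where "b0 = pullback B (sec (1/2)) u"
  have b0: "b0 \<in> cocycles B"
    unfolding b0_def by (rule pullback_cocycles[OF secU u])
  define u1 where "u1 = u - pullback ?N fst b0"
  have u1: "u1 \<in> cocycles ?N"
    using u fst_cocycles[OF b0] by (simp add: u1_def)
  have "cohomologous ?U (pullback ?U id u) (pullback ?U fst (pullback B (sec (1/2)) (pullback ?U id u)))"
    by (rule right_slit_cohomologous[OF pullback_cocycles[OF U u]])
  then have "cohomologous ?U (pullback ?U id u) (pullback ?U fst b0)"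
    by (simp add: pullback_id_left[OF cont_sec(1)] b0_def)
  then have "cohomologous ?U (pullback ?U id u - pullback ?U fst b0) 0"
    using cohomologous_diff_0 by blast
  then have u1U: "cohomologous ?U (pullback ?U id u1) 0"
    by (simp add: u1_def pullback_diff pullback_id_right[OF U])
  then obtain s where s: "s \<in> total_cochains ?U" "pullback ?U id u1 = coboundary ?U s"
    by (rule cohomologousE) simp
  define b' where "b' = pullback B (sec (- (1/2))) u1"
  have b': "b' \<in> cocycles B"
    unfolding b'_def by (rule pullback_cocycles[OF secV u1])
  have "cohomologous ?V (pullback ?V id u1) (pullback ?V fst (pullback B (sec (- (1/2))) (pullback ?V id u1)))"
    by (rule left_slit_cohomologous[OF pullback_cocycles[OF V u1]])
  then have u1V: "cohomologous ?V (pullback ?V id u1) (pullback ?V fst b')"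
    by (simp add: pullback_id_left[OF cont_sec(2)] b'_def)
  \<comment> \<open>The section \<open>\<i>/2\<close> lies in both slits. Through the left one it
    sees \<open>b'\<close>, through the right one it sees 0, so \<open>b'\<close> is trivial and
    \<open>u1\<close> bounds on the left slit too.\<close>
  have "cohomologous B (pullback B (sec (\<i>/2)) (pullback ?V id u1)) b'"
    by (rule sections_cohomologous[OF _ cont_sec_mono[OF upper_subset(2) cont_sec(3)] _ pullback_cocycles[OF V u1] u1V]) (use b' in auto)
  moreover have "cohomologous B (pullback B (sec (\<i>/2)) (pullback ?U id u1)) (pullback B (sec (\<i>/2)) 0)"
    by (rule pullback_cohomologous[OF cont_sec_mono[OF upper_subset(1) cont_sec(3)] u1U])
  ultimately have "cohomologous B b' 0"
    by (simp add: pullback_id_left[OF cont_sec_mono[OF upper_subset(1) cont_sec(3)]]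
        pullback_id_left[OF cont_sec_mono[OF upper_subset(2) cont_sec(3)]])
      (use cohomologous_sym cohomologous_trans in blast)
  then have "cohomologous ?V (pullback ?V fst b') (pullback ?V fst 0)"
    by (intro pullback_cohomologous) auto
  with u1V have "cohomologous ?V (pullback ?V id u1) 0"
    by (simp add: cohomologous_trans)
  then obtain t where t: "t \<in> total_cochains ?V" "pullback ?V id u1 = coboundary ?V t"
    by (rule cohomologousE) simp
  have cocycle: "pullback (T S) id s - pullback (T S) id t \<in> cocycles (T S)" if "S \<subseteq> right_slit" "S \<subseteq> left_slit" for S
  proof -
    have S: "continuous_map (T S) ?U id" "continuous_map (T S) ?V id"
      using that by (auto intro!: cont_T_id)
    have "coboundary (T S) (pullback (T S) id s) = coboundary (T S) (pullback (T S) id t)"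
      using coboundary_pullback[OF S(1), of s] coboundary_pullback[OF S(2), of t] s(2) t(2)
        pullback_id_left[OF S(1), of u1] pullback_id_left[OF S(2), of u1] by simp
    then show ?thesis
      using pullback_total[OF s(1), of "T S" id] pullback_total[OF t(1), of "T S" id]
      by (intro cocyclesI) (auto simp: coboundary_diff)
  qed
  define c where "c = pullback B (sec (\<i>/2)) (pullback ?A id s - pullback ?A id t)"
  define c' where "c' = pullback B (sec (- (\<i>/2))) (pullback ?L id s - pullback ?L id t)"
  have c: "c \<in> cocycles B" and c': "c' \<in> cocycles B"
    unfolding c_def c'_def by (intro pullback_cocycles[OF cont_sec(3)] pullback_cocycles[OF cont_sec(4)] cocycle upper_subset lower_subset)+
  have A: "cohomologous ?A (pullback ?A id s - pullback ?A id t) (pullback ?A fst c)"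
    unfolding c_def by (rule upper_cohomologous) (intro cocycle upper_subset)
  have L: "cohomologous ?L (pullback ?L id s - pullback ?L id t) (pullback ?L fst c')"
    unfolding c'_def by (rule lower_cohomologous) (intro cocycle lower_subset)
  \<comment> \<open>Adding \<open>c\<close> to \<open>t\<close> changes the primitive by a cocycle
    and settles the upper half plane. The lower one then lacks \<open>d\<close>; \<open>jump\<close>
    supplies it there without touching the upper one, at the price of adding \<open>wind\<close>
    times \<open>d\<close> to the cocycle itself.\<close>
  define d where "d = c' - c"
  have d: "d \<in> cocycles B"
    using c c' by (simp add: d_def)
  define t' where "t' = t + pullback ?V fst c + cup ?V jump (pullback ?V fst d)"
  have "cohomologous ?N (u1 + cup ?N (wind (- {0})) (pullback ?N fst d)) 0"
  proof (rule punctured_tube_trivial)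
    show "u1 + cup ?N (wind (- {0})) (pullback ?N fst d) \<in> cocycles ?N"
      using u1 fst_cocycles[OF d] nonvanishing_offset[of "- {0}"] by simp
    show "pullback ?U id (u1 + cup ?N (wind (- {0})) (pullback ?N fst d)) = coboundary ?U s"
      by (simp add: pullback_add pullback_cup[OF U] pullback_wind[OF slit_subset(1)] wind_right_slit s)
    show "pullback ?V id (u1 + cup ?N (wind (- {0})) (pullback ?N fst d)) = coboundary ?V t'"
      using fst_cocycles[OF c, of left_slit]
      by (simp add: pullback_add pullback_cup[OF V] pullback_wind[OF slit_subset(2)] t pullback_id_right[OF V]
          wind_cup_left_slit[OF d] t'_def coboundary_add)
    show "t' \<in> total_cochains ?V"
      using t fst_cocycles[OF c, of left_slit] fst_cocycles[OF d, of left_slit] by (simp add: t'_def)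
    have "pullback ?A id t' = pullback ?A id t + pullback ?A fst c"
      by (simp add: t'_def pullback_add cup_jump_upper pullback_id_right[OF AV])
    then show "cohomologous ?A (pullback ?A id s) (pullback ?A id t')"
      using cohomologous_add[OF A cohomologous_refl[of ?A "pullback ?A id t"]] by (simp add: add.commute)
    have "pullback ?L id t' = pullback ?L id t + pullback ?L fst c + pullback ?L fst d"
      by (simp add: t'_def pullback_add cup_jump_lower[OF d] pullback_id_right[OF LV])
    also have "\<dots> = pullback ?L id t + pullback ?L fst c'"
      by (simp add: d_def pullback_diff)
    finally show "cohomologous ?L (pullback ?L id s) (pullback ?L id t')"
      using cohomologous_add[OF L cohomologous_refl[of ?L "pullback ?L id t"]] by (simp add: add.commute)
  qed (use s in simp)
  moreover have "u1 + cup ?N (wind (- {0})) (pullback ?N fst d)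
      = u - (pullback ?N fst b0 + cup ?N (wind (- {0})) (pullback ?N fst (- d)))"
    by (simp add: u1_def pullback_uminus cup_uminus_right)
  ultimately have "cohomologous ?N u (pullback ?N fst b0 + cup ?N (wind (- {0})) (pullback ?N fst (- d)))"
    using cohomologous_diff_0 by metis
  then show ?thesis
    using b0 d by (intro bexI[of _ b0] bexI[of _ "- d"]) simp_all
qed

text \<open>On the right slit the winding cocycle is 0, which isolates \<open>b0\<close>. For
  \<open>b1\<close>, take a primitive \<open>w\<close> of the remaining product: it is a cocycle on
  the right slit, while on the left slit it is one only after subtracting \<open>jump\<close> times
  \<open>b1\<close>. Comparing two sections through either slit detects this difference.\<close>

theorem punctured_tube_independence:
  assumes b0: "b0 \<in> cocycles B" and b1: "b1 \<in> cocycles B"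
    and zero: "cohomologous (T (- {0})) (pullback (T (- {0})) fst b0 + cup (T (- {0})) (wind (- {0})) (pullback (T (- {0})) fst b1)) 0"
  shows "cohomologous B b0 0" "cohomologous B b1 0"
proof -
  let ?N = "T (- {0})" and ?U = "T right_slit" and ?V = "T left_slit" and ?A = "T upper" and ?L = "T lower"
  have U: "continuous_map ?U ?N id" and V: "continuous_map ?V ?N id"
    by (auto intro!: cont_T_id slit_subset)
  have AV: "continuous_map ?A ?V id" and LV: "continuous_map ?L ?V id"
    by (auto intro!: cont_T_id upper_subset lower_subset)
  have b0U: "pullback B (sec (1/2)) (pullback ?U fst b0) = b0"
    by (rule pullback_section[OF cont_sec(1)]) (use b0 in auto)
  have "cohomologous ?U (pullback ?U id (pullback ?N fst b0 + cup ?N (wind (- {0})) (pullback ?N fst b1))) (pullback ?U id 0)"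
    by (rule pullback_cohomologous[OF U zero])
  then have "cohomologous ?U (pullback ?U fst b0) 0"
    by (simp add: pullback_add pullback_cup[OF U] pullback_wind[OF slit_subset(1)] wind_right_slit pullback_id_right[OF U])
  from pullback_cohomologous[OF cont_sec(1) this] show "cohomologous B b0 0"
    by (simp add: b0U)
  then have "cohomologous ?N (pullback ?N fst b0) (pullback ?N fst 0)"
    by (intro pullback_cohomologous) auto
  from cohomologous_diff[OF zero this] have "cohomologous ?N (cup ?N (wind (- {0})) (pullback ?N fst b1)) 0"
    by simp
  then obtain w where w: "w \<in> total_cochains ?N" "cup ?N (wind (- {0})) (pullback ?N fst b1) = coboundary ?N w"
    by (rule cohomologousE) simp
  have wU: "pullback ?U id w \<in> cocycles ?U"
  proof (rule cocyclesI)
    have "coboundary ?U (pullback ?U id w) = pullback ?U id (cup ?N (wind (- {0})) (pullback ?N fst b1))"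
      using w(2) by (simp add: coboundary_pullback[OF U])
    then show "coboundary ?U (pullback ?U id w) = 0"
      by (simp add: pullback_cup[OF U] pullback_wind[OF slit_subset(1)] wind_right_slit)
  qed (rule pullback_total[OF w(1)])
  define j where "j = cup ?V jump (pullback ?V fst b1)"
  have wV: "pullback ?V id w - j \<in> cocycles ?V"
  proof (rule cocyclesI)
    have "coboundary ?V (pullback ?V id w) = pullback ?V id (cup ?N (wind (- {0})) (pullback ?N fst b1))"
      using w(2) by (simp add: coboundary_pullback[OF V])
    also have "\<dots> = coboundary ?V j"
      by (simp add: pullback_cup[OF V] pullback_wind[OF slit_subset(2)] pullback_id_right[OF V] wind_cup_left_slit[OF b1] j_def)
    finally show "coboundary ?V (pullback ?V id w - j) = 0"
      by (simp add: coboundary_diff)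
    show "pullback ?V id w - j \<in> total_cochains ?V"
      using pullback_total[OF w(1), of ?V id] fst_cocycles[OF b1, of left_slit] by (simp add: j_def)
  qed
  have secA: "continuous_map B ?U (sec (\<i>/2))" "continuous_map B ?V (sec (\<i>/2))"
    and secL: "continuous_map B ?U (sec (- (\<i>/2)))" "continuous_map B ?V (sec (- (\<i>/2)))"
    using cont_sec_mono[OF _ cont_sec(3)] cont_sec_mono[OF _ cont_sec(4)] upper_subset lower_subset by auto
  have U2: "cohomologous B (pullback B (sec (\<i>/2)) (pullback ?U id w)) (pullback B (sec (1/2)) (pullback ?U id w))"
           "cohomologous B (pullback B (sec (- (\<i>/2))) (pullback ?U id w)) (pullback B (sec (1/2)) (pullback ?U id w))"
    by (rule sections_cohomologous[OF _ _ _ wU right_slit_cohomologous[OF wU]];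
        use secA secL wU pullback_cocycles[OF cont_sec(1) wU] in auto)+
  have V2: "cohomologous B (pullback B (sec (\<i>/2)) (pullback ?V id w - j)) (pullback B (sec (- (1/2))) (pullback ?V id w - j))"
           "cohomologous B (pullback B (sec (- (\<i>/2))) (pullback ?V id w - j)) (pullback B (sec (- (1/2))) (pullback ?V id w - j))"
    by (rule sections_cohomologous[OF _ _ _ wV left_slit_cohomologous[OF wV]];
        use secA secL wV pullback_cocycles[OF cont_sec(2) wV] in auto)+
  have "pullback B (sec (\<i>/2)) j = pullback B (sec (\<i>/2)) (pullback ?A id j)"
    by (simp add: pullback_id_left[OF cont_sec(3)])
  then have jA: "pullback B (sec (\<i>/2)) j = 0"
    by (simp add: j_def cup_jump_upper)
  have "pullback B (sec (- (\<i>/2))) j = pullback B (sec (- (\<i>/2))) (pullback ?L id j)"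
    by (simp add: pullback_id_left[OF cont_sec(4)])
  also have "\<dots> = b1"
    unfolding j_def cup_jump_lower[OF b1] by (rule pullback_section[OF cont_sec(4)]) (use b1 in auto)
  finally have jL: "pullback B (sec (- (\<i>/2))) j = b1" .
  let ?wA = "pullback B (sec (\<i>/2)) w" and ?wL = "pullback B (sec (- (\<i>/2))) w"
  \<comment> \<open>Passing from the upper to the lower section through the right slit changes
    nothing; through the left slit, in the next fact, \<open>jump\<close> contributes
    \<open>b1\<close>.\<close>
  have 1: "cohomologous B ?wA ?wL"
    using cohomologous_trans[OF U2(1) cohomologous_sym[OF U2(2)]]
    by (simp add: pullback_id_left[OF secA(1)] pullback_id_left[OF secL(1)])
  have 2: "cohomologous B ?wA (?wL - b1)"
    using cohomologous_trans[OF V2(1) cohomologous_sym[OF V2(2)]]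
    by (simp add: pullback_diff pullback_id_left[OF secA(2)] pullback_id_left[OF secL(2)] jA jL)
  from cohomologous_diff[OF 1 2] have "cohomologous B 0 b1"
    by simp
  then show "cohomologous B b1 0"
    by (rule cohomologous_sym)
qed

end

section \<open>Complements of several disjoint graphs\<close>

definition graph_complement :: "'b topology \<Rightarrow> ('i \<Rightarrow> 'b \<Rightarrow> complex) \<Rightarrow> 'i set \<Rightarrow> ('b \<times> complex) set" where
  "graph_complement B q I = {z. fst z \<in> topspace B \<and> (\<forall>i\<in>I. snd z \<noteq> q i (fst z))}"

abbreviation punctured_bundle :: "'b topology \<Rightarrow> ('i \<Rightarrow> 'b \<Rightarrow> complex) \<Rightarrow> 'i set \<Rightarrow> ('b \<times> complex) topology" where
  "punctured_bundle B q I \<equiv> fibre_space B (graph_complement B q I)"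

text \<open>The logarithmic class of the distance to one graph, with residue 1 along that graph and
  0 along the others.\<close>

definition graph_class :: "'b topology \<Rightarrow> ('i \<Rightarrow> 'b \<Rightarrow> complex) \<Rightarrow> 'i set \<Rightarrow> 'i \<Rightarrow> ('b \<times> complex) cochain" where
  "graph_class B q I i = winding_cochain (punctured_bundle B q I) (\<lambda>z. snd z - q i (fst z))"

lemma topspace_punctured_bundle: "topspace (punctured_bundle B q I) = graph_complement B q I"
  by (auto simp: topspace_fibre_space graph_complement_def)

lemma continuous_map_punctured_id:
  "I \<subseteq> J \<Longrightarrow> continuous_map (punctured_bundle B q J) (punctured_bundle B q I) id"
  by (rule continuous_map_fibre_space_id) (auto simp: graph_complement_def)

lemma pullback_graph_class:
  "I \<subseteq> J \<Longrightarrow> pullback (punctured_bundle B q J) id (graph_class B q I i) = graph_class B q J i"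
  unfolding graph_class_def by (simp add: pullback_winding_cochain[OF continuous_map_punctured_id])

lemma continuous_map_graph_diff:
  assumes "continuous_map B euclidean p"
  shows "continuous_map (fibre_space B W) euclidean (\<lambda>z. snd z - p (fst z))"
proof -
  have "continuous_map (fibre_space B W) euclidean (p \<circ> fst)"
    by (rule continuous_map_compose[OF _ assms]) simp
  then show ?thesis
    by (intro continuous_map_diff) (auto simp: o_def)
qed

lemma graph_class_cocycle:
  assumes "continuous_map B euclidean (q i)" "i \<in> I"
  shows "graph_class B q I i \<in> cocycles (punctured_bundle B q I)"
proof -
  have "nonvanishing (punctured_bundle B q I) (\<lambda>z. snd z - q i (fst z))"
    unfolding nonvanishing_def topspace_punctured_bundle
    by (intro conjI ballI continuous_map_graph_diff assms(1)) (use assms(2) in \<open>auto simp: graph_complement_def\<close>)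
  then show ?thesis
    unfolding graph_class_def by (rule winding_cochain_cocycle)
qed

text \<open>Starting from the constant 1, take the minimum with the distance to each other graph;
  finitely many minima stay continuous and positive.\<close>

lemma separating_radius:
  assumes "finite I" "continuous_map B euclidean p" "\<And>i. i \<in> I \<Longrightarrow> continuous_map B euclidean (q i)"
    "\<And>i x. i \<in> I \<Longrightarrow> x \<in> topspace B \<Longrightarrow> q i x \<noteq> p x"
  shows "\<exists>r. continuous_map B euclideanreal r \<and> (\<forall>x\<in>topspace B. r x > 0 \<and> (\<forall>i\<in>I. r x \<le> cmod (q i x - p x)))"
  using assms(1,3,4)
proof (induction I)
  case empty
  then show ?case by (intro exI[of _ "\<lambda>x. 1"]) auto
next
  case (insert i I)
  then obtain r where r: "continuous_map B euclideanreal r" "\<forall>x\<in>topspace B. r x > 0 \<and> (\<forall>i\<in>I. r x \<le> cmod (q i x - p x))"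
    by auto
  have "continuous_map B euclideanreal (\<lambda>x. min (r x) (cmod (q i x - p x)))"
    using insert.prems assms(2) by (intro continuous_map_real_min continuous_map_norm continuous_map_diff r) auto
  then show ?case
    using r(2) insert.prems(2) by (intro exI[of _ "\<lambda>x. min (r x) (cmod (q i x - p x))"]) (auto simp: min.coboundedI1)
qed

lemma pullback_fst_cocycles: "b \<in> cocycles B \<Longrightarrow> pullback (fibre_space B W) fst b \<in> cocycles (fibre_space B W)"
  by (rule pullback_cocycles) simp_all

lemma pullback_combination:
  assumes "I \<subseteq> J"
  shows "pullback (punctured_bundle B q J) id (pullback (punctured_bundle B q I) fst b0 +
      (\<Sum>i\<in>I. cup (punctured_bundle B q I) (graph_class B q I i) (pullback (punctured_bundle B q I) fst (b i))))
    = pullback (punctured_bundle B q J) fst b0 +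
      (\<Sum>i\<in>I. cup (punctured_bundle B q J) (graph_class B q J i) (pullback (punctured_bundle B q J) fst (b i)))"
  using continuous_map_punctured_id[OF assms, of B q]
  by (simp only: pullback_add pullback_sum pullback_cup pullback_graph_class[OF assms] pullback_id_right)

text \<open>
  Removing one more graph: the complement of all graphs and a tube around the new one cover the
  complement of the old graphs, and intersect in a punctured tube.
\<close>

locale graph_removal =
  fixes B :: "'b topology" and q :: "'i \<Rightarrow> 'b \<Rightarrow> complex" and I :: "'i set" and j :: 'i
  assumes fin: "finite I" and j: "j \<notin> I"
    and cont: "\<And>i. i \<in> insert j I \<Longrightarrow> continuous_map B euclidean (q i)"
    and distinct: "\<And>i x. i \<in> I \<Longrightarrow> x \<in> topspace B \<Longrightarrow> q i x \<noteq> q j x"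
begin

definition r :: "'b \<Rightarrow> real" where
  "r = (SOME r. continuous_map B euclideanreal r \<and> (\<forall>x\<in>topspace B. r x > 0 \<and> (\<forall>i\<in>I. r x \<le> cmod (q i x - q j x))))"

lemma r: "continuous_map B euclideanreal r" "x \<in> topspace B \<Longrightarrow> r x > 0"
    "x \<in> topspace B \<Longrightarrow> i \<in> I \<Longrightarrow> r x \<le> cmod (q i x - q j x)"
proof -
  have "\<exists>r. continuous_map B euclideanreal r \<and> (\<forall>x\<in>topspace B. r x > 0 \<and> (\<forall>i\<in>I. r x \<le> cmod (q i x - q j x)))"
    by (rule separating_radius) (use fin cont distinct in auto)
  from someI_ex[OF this, folded r_def] show "continuous_map B euclideanreal r" "x \<in> topspace B \<Longrightarrow> r x > 0"
    "x \<in> topspace B \<Longrightarrow> i \<in> I \<Longrightarrow> r x \<le> cmod (q i x - q j x)"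
    by auto
qed

sublocale disc_bundle B "q j" r
  using cont r by unfold_locales auto

abbreviation "X \<equiv> punctured_bundle B q I"
abbreviation "Y \<equiv> punctured_bundle B q (insert j I)"

lemma tube_subset: "tube S \<subseteq> graph_complement B q I"
proof
  fix z assume z: "z \<in> tube S"
  have "snd z \<noteq> q i (fst z)" if "i \<in> I" for i
    using z r(3)[of "fst z" i] that by (auto simp: tube_def offset_def)
  then show "z \<in> graph_complement B q I"
    using z by (auto simp: graph_complement_def tube_def)
qed

lemma punctured_tube_subset: "tube (- {0}) \<subseteq> graph_complement B q (insert j I)"
  using tube_subset[of "- {0}"] by (auto simp: graph_complement_def tube_def offset_def)

lemma openin_cover: "openin X (graph_complement B q (insert j I))" "openin X (tube UNIV)"
proof -
  have 1: "continuous_map X euclidean (\<lambda>z. snd z - q j (fst z))"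
    by (rule continuous_map_graph_diff) (use cont in auto)
  then have "openin X {z \<in> topspace X. snd z - q j (fst z) \<in> - {0}}"
    by (rule openin_continuous_map_preimage) auto
  moreover have "{z \<in> topspace X. snd z - q j (fst z) \<in> - {0}} = graph_complement B q (insert j I)"
    unfolding topspace_punctured_bundle by (auto simp: graph_complement_def)
  ultimately show "openin X (graph_complement B q (insert j I))" by simp
  have "continuous_map X euclideanreal (r \<circ> fst)"
    by (rule continuous_map_compose[OF _ r(1)]) simp
  then have "continuous_map X euclideanreal (\<lambda>z. r (fst z) - cmod (snd z - q j (fst z)))"
    by (intro continuous_map_diff continuous_map_norm 1) (auto simp: o_def)
  then have "openin X {z \<in> topspace X. r (fst z) - cmod (snd z - q j (fst z)) \<in> {0<..}}"
    by (rule openin_continuous_map_preimage) auto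
  moreover have "{z \<in> topspace X. r (fst z) - cmod (snd z - q j (fst z)) \<in> {0<..}} = tube UNIV"
    unfolding topspace_punctured_bundle using tube_subset[of UNIV]
    by (auto simp: graph_complement_def tube_def offset_def)
  ultimately show "openin X (tube UNIV)" by simp
qed

lemma cover: "topspace X \<subseteq> graph_complement B q (insert j I) \<union> tube UNIV"
  unfolding topspace_punctured_bundle using r(2)
  by (auto simp: graph_complement_def tube_def offset_def)

lemma subspaces:
  "subtopology X (graph_complement B q (insert j I)) = Y"
  "subtopology X (tube UNIV) = T UNIV"
  "subtopology X (graph_complement B q (insert j I) \<inter> tube UNIV) = T (- {0})"
proof -
  have "graph_complement B q I \<inter> graph_complement B q (insert j I) = graph_complement B q (insert j I)"
    by (auto simp: graph_complement_def)
  then show "subtopology X (graph_complement B q (insert j I)) = Y"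
    by (simp add: subtopology_fibre_space)
  show "subtopology X (tube UNIV) = T UNIV"
    using tube_subset[of UNIV] by (simp add: subtopology_fibre_space Int_absorb1)
  have "graph_complement B q I \<inter> (graph_complement B q (insert j I) \<inter> tube UNIV) = tube (- {0})"
    using punctured_tube_subset tube_subset[of UNIV] by (auto simp: graph_complement_def tube_def offset_def)
  then show "subtopology X (graph_complement B q (insert j I) \<inter> tube UNIV) = T (- {0})"
    by (simp add: subtopology_fibre_space)
qed

lemma maps: "continuous_map Y X id" "continuous_map (T UNIV) X id"
  "continuous_map (T (- {0})) Y id" "continuous_map (T (- {0})) (T UNIV) id" "continuous_map (T (- {0})) X id"
proof -
  show "continuous_map Y X id"
    by (rule continuous_map_punctured_id) auto
  show "continuous_map (T UNIV) X id" "continuous_map (T (- {0})) X id"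
    by (rule continuous_map_fibre_space_id[OF tube_subset])+
  show "continuous_map (T (- {0})) Y id"
    by (rule continuous_map_fibre_space_id[OF punctured_tube_subset])
  show "continuous_map (T (- {0})) (T UNIV) id"
    by (rule cont_T_id) auto
qed

lemma pullback_new_class: "pullback (T (- {0})) id (graph_class B q (insert j I) j) = wind (- {0})"
  unfolding graph_class_def pullback_winding_cochain[OF maps(3)]
  by (rule winding_cochain_cong) (simp add: offset_def)

abbreviation "a \<equiv> graph_class B q (insert j I)"

lemma a_cocycle: "i \<in> insert j I \<Longrightarrow> a i \<in> cocycles Y"
  by (rule graph_class_cocycle) (use cont in auto)

text \<open>The residue \<open>b1\<close> along the new graph is read off on the punctured tube.
  Once \<open>a j\<close> times \<open>b1\<close> is subtracted, what remains near the new graph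
  comes from the base, so it extends across the tube and glues to a class on \<open>X\<close>, where
  the induction hypothesis applies.\<close>

lemma removal_decomposition:
  assumes IH: "\<And>x. x \<in> cocycles X \<Longrightarrow> \<exists>b0\<in>cocycles B. \<exists>b. (\<forall>i\<in>I. b i \<in> cocycles B) \<and>
      cohomologous X x (pullback X fst b0 + (\<Sum>i\<in>I. cup X (graph_class B q I i) (pullback X fst (b i))))"
    and u: "u \<in> cocycles Y"
  shows "\<exists>b0\<in>cocycles B. \<exists>b. (\<forall>i\<in>insert j I. b i \<in> cocycles B) \<and>
      cohomologous Y u (pullback Y fst b0 + (\<Sum>i\<in>insert j I. cup Y (a i) (pullback Y fst (b i))))"
proof -
  have "pullback (T (- {0})) id u \<in> cocycles (T (- {0}))"
    by (rule pullback_cocycles[OF maps(3) u])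
  then obtain b0 b1 where b0: "b0 \<in> cocycles B" and b1: "b1 \<in> cocycles B" and
    dec: "cohomologous (T (- {0})) (pullback (T (- {0})) id u)
      (pullback (T (- {0})) fst b0 + cup (T (- {0})) (wind (- {0})) (pullback (T (- {0})) fst b1))"
    using punctured_tube_decomposition by meson
  define u1 where "u1 = u - cup Y (a j) (pullback Y fst b1)"
  have aj: "cup Y (a j) (pullback Y fst b1) \<in> cocycles Y"
    using a_cocycle[of j] pullback_fst_cocycles[OF b1] by auto
  have u1: "u1 \<in> cocycles Y"
    using u aj by (simp add: u1_def)
  define v where "v = pullback (T UNIV) fst b0"
  have v: "v \<in> cocycles (T UNIV)"
    unfolding v_def by (rule pullback_fst_cocycles[OF b0])
  have "cohomologous (T (- {0})) (pullback (T (- {0})) id u1) (pullback (T (- {0})) id v)"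
  proof -
    have "pullback (T (- {0})) id u1 = pullback (T (- {0})) id u - cup (T (- {0})) (wind (- {0})) (pullback (T (- {0})) fst b1)"
      by (simp add: u1_def pullback_diff pullback_cup[OF maps(3)] pullback_new_class pullback_id_right[OF maps(3)])
    moreover have "pullback (T (- {0})) id v = (pullback (T (- {0})) fst b0 + cup (T (- {0})) (wind (- {0})) (pullback (T (- {0})) fst b1))
        - cup (T (- {0})) (wind (- {0})) (pullback (T (- {0})) fst b1)"
      by (simp add: v_def pullback_id_right[OF maps(4)])
    ultimately show ?thesis
      using cohomologous_diff[OF dec cohomologous_refl[of _ "cup (T (- {0})) (wind (- {0})) (pullback (T (- {0})) fst b1)"]] by simp
  qed
  then obtain x where x: "x \<in> cocycles X" "cohomologous Y (pullback Y id x) u1"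
    using Mayer_Vietoris_glue[OF openin_cover cover, unfolded subspaces, OF u1 v] by meson
  obtain c0 c where c0: "c0 \<in> cocycles B" and c: "\<forall>i\<in>I. c i \<in> cocycles B"
    and xc: "cohomologous X x (pullback X fst c0 + (\<Sum>i\<in>I. cup X (graph_class B q I i) (pullback X fst (c i))))"
    using IH[OF x(1)] by meson
  define b where "b = c(j := b1)"
  have bI: "b i = c i" if "i \<in> I" for i
    using that j by (auto simp: b_def)
  have "cohomologous Y u1 (pullback Y fst c0 + (\<Sum>i\<in>I. cup Y (a i) (pullback Y fst (b i))))"
    using cohomologous_trans[OF cohomologous_sym[OF x(2)] pullback_cohomologous[OF maps(1) xc]]
    by (simp add: pullback_combination[OF subset_insertI] bI)
  from cohomologous_add[OF this cohomologous_refl[of Y "cup Y (a j) (pullback Y fst b1)"]]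
  have "cohomologous Y u (pullback Y fst c0 + (\<Sum>i\<in>insert j I. cup Y (a i) (pullback Y fst (b i))))"
    using j fin by (simp add: u1_def b_def algebra_simps)
  then show ?thesis
    using c0 c b1 by (intro bexI[of _ c0] exI[of _ b]) (auto simp: b_def)
qed

text \<open>Restricting to the punctured tube shows that the coefficient of the new class is
  trivial. The rest is the restriction of a class \<open>x\<close> on \<open>X\<close>, which bounds
  on \<open>Y\<close> and on the tube; it remains to see that it bounds on \<open>X\<close> before
  invoking the induction hypothesis.\<close>

lemma removal_independence:
  assumes IH: "\<And>b0 b. b0 \<in> cocycles B \<Longrightarrow> (\<And>i. i \<in> I \<Longrightarrow> b i \<in> cocycles B) \<Longrightarrow>
      cohomologous X (pullback X fst b0 + (\<Sum>i\<in>I. cup X (graph_class B q I i) (pullback X fst (b i)))) 0 \<Longrightarrow>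
      cohomologous B b0 0 \<and> (\<forall>i\<in>I. cohomologous B (b i) 0)"
    and b0: "b0 \<in> cocycles B" and b: "\<And>i. i \<in> insert j I \<Longrightarrow> b i \<in> cocycles B"
    and zero: "cohomologous Y (pullback Y fst b0 + (\<Sum>i\<in>insert j I. cup Y (a i) (pullback Y fst (b i)))) 0"
  shows "cohomologous B b0 0 \<and> (\<forall>i\<in>insert j I. cohomologous B (b i) 0)"
proof -
  let ?N = "T (- {0})" and ?V = "T UNIV"
  define x where "x = pullback X fst b0 + (\<Sum>i\<in>I. cup X (graph_class B q I i) (pullback X fst (b i)))"
  have x: "x \<in> cocycles X"
    unfolding x_def using b
    by (intro cocycles_add cocycles_sum cup_cocycles pullback_fst_cocycles b0 graph_class_cocycle cont) auto
  have xY: "pullback Y id x = pullback Y fst b0 + (\<Sum>i\<in>I. cup Y (a i) (pullback Y fst (b i)))"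
    unfolding x_def by (rule pullback_combination) auto
  have zero': "cohomologous Y (pullback Y id x + cup Y (a j) (pullback Y fst (b j))) 0"
    using zero fin j by (simp add: xY algebra_simps)
  define c where "c = pullback B (sec 0) (pullback ?V id x)"
  have sec0: "continuous_map B ?V (sec 0)"
    by (rule continuous_map_sec) auto
  have xV: "pullback ?V id x \<in> cocycles ?V"
    by (rule pullback_cocycles[OF maps(2) x])
  then have c: "c \<in> cocycles B"
    unfolding c_def by (rule pullback_cocycles[OF sec0])
  have xc: "cohomologous ?V (pullback ?V id x) (pullback ?V fst c)"
    unfolding c_def by (rule tube_UNIV_cohomologous[OF xV])
  have "cohomologous ?N (pullback ?N id x + cup ?N (wind (- {0})) (pullback ?N fst (b j))) 0"
    using pullback_cohomologous[OF maps(3) zero']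
    by (simp add: pullback_add pullback_cup[OF maps(3)] pullback_new_class pullback_id_right[OF maps(3)] pullback_id_left[OF maps(3)])
  moreover have "cohomologous ?N (pullback ?N fst c) (pullback ?N id x)"
    using cohomologous_sym[OF pullback_cohomologous[OF maps(4) xc]]
    by (simp add: pullback_id_left[OF maps(4)] pullback_id_right[OF maps(4)])
  ultimately have "cohomologous ?N (pullback ?N fst c + cup ?N (wind (- {0})) (pullback ?N fst (b j))) 0"
    using cohomologous_trans[OF cohomologous_add[OF _ cohomologous_refl]] by blast
  from punctured_tube_independence[OF c b this] have c0: "cohomologous B c 0" and bj: "cohomologous B (b j) 0"
    by auto
  have "cohomologous Y (pullback Y fst (b j)) (pullback Y fst 0)"
    by (rule pullback_cohomologous[OF _ bj]) simp
  then have "cohomologous Y (cup Y (a j) (pullback Y fst (b j))) (cup Y (a j) 0)"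
    by (intro cohomologous_cup_right a_cocycle) simp_all
  from cohomologous_diff[OF zero' this] have "cohomologous Y (pullback Y id x) 0"
    by simp
  then obtain s where s: "s \<in> total_cochains Y" "pullback Y id x = coboundary Y s"
    by (rule cohomologousE) simp
  have "cohomologous ?V (pullback ?V fst c) (pullback ?V fst 0)"
    by (rule pullback_cohomologous[OF _ c0]) simp
  with xc have "cohomologous ?V (pullback ?V id x) 0"
    by (simp add: cohomologous_trans)
  then obtain t where t: "t \<in> total_cochains ?V" "pullback ?V id x = coboundary ?V t"
    by (rule cohomologousE) simp
  have "coboundary ?N (pullback ?N id s) = coboundary ?N (pullback ?N id t)"
    using coboundary_pullback[OF maps(3), of s] coboundary_pullback[OF maps(4), of t]
      pullback_id_left[OF maps(3), of x] pullback_id_left[OF maps(4), of x] s(2) t(2) by simp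
  then have "pullback ?N id s - pullback ?N id t \<in> cocycles ?N"
    using pullback_total[OF s(1), of ?N id] pullback_total[OF t(1), of ?N id]
    by (intro cocyclesI) (auto simp: coboundary_diff)
  \<comment> \<open>The two primitives differ on the overlap by a cocycle, whose two components both
    extend: \<open>e0\<close> over the full tube, and the winding class times \<open>e1\<close> over
    \<open>Y\<close> as a multiple of \<open>a j\<close>. So the connecting map yields
    nothing.\<close>
  then obtain e0 e1 where e0: "e0 \<in> cocycles B" and e1: "e1 \<in> cocycles B" and
    e: "cohomologous ?N (pullback ?N id s - pullback ?N id t)
      (pullback ?N fst e0 + cup ?N (wind (- {0})) (pullback ?N fst e1))"
    using punctured_tube_decomposition by meson
  have "cohomologous X x 0"
  proof (rule Mayer_Vietoris_trivial[OF openin_cover cover, unfolded subspaces])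
    show "cup Y (a j) (pullback Y fst e1) \<in> cocycles Y"
      using a_cocycle[of j] pullback_fst_cocycles[OF e1] by auto
    show "- pullback ?V fst e0 \<in> cocycles ?V"
      using pullback_fst_cocycles[OF e0] by auto
    show "cohomologous ?N (pullback ?N id s - pullback ?N id t)
      (pullback ?N id (cup Y (a j) (pullback Y fst e1)) - pullback ?N id (- pullback ?V fst e0))"
      using e by (simp add: pullback_cup[OF maps(3)] pullback_new_class pullback_id_right[OF maps(3)]
          pullback_uminus pullback_id_right[OF maps(4)] add.commute)
  qed (fact x s t)+
  then show ?thesis
    using IH[OF b0, of b] b bj by (auto simp: x_def)
qed

end

text \<open>The Leray--Hirsch theorem for the complement of finitely many disjoint graphs in \<open>B \<times> \<complex>\<close>.\<close>

theorem punctured_bundle_decomposition: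
  assumes "finite I" "\<And>i. i \<in> I \<Longrightarrow> continuous_map B euclidean (q i)"
    and "\<And>i i' x. i \<in> I \<Longrightarrow> i' \<in> I \<Longrightarrow> i \<noteq> i' \<Longrightarrow> x \<in> topspace B \<Longrightarrow> q i x \<noteq> q i' x"
    and "u \<in> cocycles (punctured_bundle B q I)"
  shows "\<exists>b0\<in>cocycles B. \<exists>b. (\<forall>i\<in>I. b i \<in> cocycles B) \<and>
    cohomologous (punctured_bundle B q I) u (pullback (punctured_bundle B q I) fst b0 +
      (\<Sum>i\<in>I. cup (punctured_bundle B q I) (graph_class B q I i) (pullback (punctured_bundle B q I) fst (b i))))"
  using assms
proof (induction I arbitrary: u)
  case empty
  let ?E = "punctured_bundle B q {}"
  have s: "continuous_map B ?E (\<lambda>x. (x, 0))"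
    by (rule continuous_map_fibre_spaceI) (auto simp: graph_complement_def simp flip: id_def)
  have "cohomologous ?E u (pullback ?E fst (pullback B (\<lambda>x. (x, 0)) u))"
    unfolding fibre_space_def
    by (rule fibrewise_star_cohomologous) (use empty.prems in \<open>auto simp: graph_complement_def fibre_space_def\<close>)
  then show ?case
    using pullback_cocycles[OF s empty.prems(3)] by (intro bexI[of _ "pullback B (\<lambda>x. (x, 0)) u"]) auto
next
  case (insert j I)
  interpret graph_removal B q I j
  proof unfold_locales
    show "q i x \<noteq> q j x" if "i \<in> I" "x \<in> topspace B" for i x
      using insert.prems(2)[of i j x] insert.hyps that by auto
  qed (use insert.hyps insert.prems in auto)
  show ?case
    using insert.prems by (intro removal_decomposition insert.IH) auto
qed

theorem punctured_bundle_independence: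
  assumes "finite I" "\<And>i. i \<in> I \<Longrightarrow> continuous_map B euclidean (q i)"
    and "\<And>i i' x. i \<in> I \<Longrightarrow> i' \<in> I \<Longrightarrow> i \<noteq> i' \<Longrightarrow> x \<in> topspace B \<Longrightarrow> q i x \<noteq> q i' x"
    and "b0 \<in> cocycles B" "\<And>i. i \<in> I \<Longrightarrow> b i \<in> cocycles B"
    and "cohomologous (punctured_bundle B q I) (pullback (punctured_bundle B q I) fst b0 +
      (\<Sum>i\<in>I. cup (punctured_bundle B q I) (graph_class B q I i) (pullback (punctured_bundle B q I) fst (b i)))) 0"
  shows "cohomologous B b0 0 \<and> (\<forall>i\<in>I. cohomologous B (b i) 0)"
  using assms
proof (induction I arbitrary: b0 b)
  case empty
  let ?E = "punctured_bundle B q {}"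
  have s: "continuous_map B ?E (\<lambda>x. (x, 0))"
    by (rule continuous_map_fibre_spaceI) (auto simp: graph_complement_def simp flip: id_def)
  have "cohomologous B (pullback B (\<lambda>x. (x, 0)) (pullback ?E fst b0)) 0"
    using pullback_cohomologous[OF s empty.prems(5)] unfolding sum.empty add_0_right pullback_0 .
  moreover have "pullback B (\<lambda>x. (x, 0)) (pullback ?E fst b0) = b0"
    by (rule pullback_section[OF s]) (use empty.prems in auto)
  ultimately have "cohomologous B b0 0" by simp
  then show ?case by blast
next
  case (insert j I)
  interpret graph_removal B q I j
  proof unfold_locales
    show "q i x \<noteq> q j x" if "i \<in> I" "x \<in> topspace B" for i x
      using insert.prems(2)[of i j x] insert.hyps that by auto
  qed (use insert.hyps insert.prems in auto)
  show ?case
  proof (rule removal_independence)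
    show "cohomologous B c0 0 \<and> (\<forall>i\<in>I. cohomologous B (c i) 0)"
      if "c0 \<in> cocycles B" "\<And>i. i \<in> I \<Longrightarrow> c i \<in> cocycles B"
        "cohomologous X (pullback X fst c0 + (\<Sum>i\<in>I. cup X (graph_class B q I i) (pullback X fst (c i)))) 0"
      for c0 c
    proof (rule insert.IH[OF _ _ that])
      show "continuous_map B euclidean (q i)" if "i \<in> I" for i
        using that insert.prems(1) by simp
      show "q i x \<noteq> q i' x" if "i \<in> I" "i' \<in> I" "i \<noteq> i'" "x \<in> topspace B" for i i' x
        using that insert.prems(2)[of i i' x] by simp
    qed
  qed (fact insert.prems)+
qed

section \<open>The cohomology of a point and products of winding classes\<close>

lemma singular_simplex_point:
  assumes "topspace X = {a}"
  shows "singular_simplex p X \<sigma> \<longleftrightarrow> \<sigma> = restrict (\<lambda>v. a) (standard_simplex p)"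
proof
  assume \<sigma>: "singular_simplex p X \<sigma>"
  then have "\<sigma> v = a" if "v \<in> standard_simplex p" for v
    using singular_simplex_topspace[OF \<sigma> that] assms by simp
  then show "\<sigma> = restrict (\<lambda>v. a) (standard_simplex p)"
    using \<sigma> by (auto simp: singular_simplex_def extensional_def fun_eq_iff)
qed (use assms in \<open>simp add: singular_simplex_def\<close>)

lemma alternating_sum_int: "(\<Sum>k\<le>n. (-1) ^ k :: int) = (if even n then 1 else 0)"
  by (induction n) auto

text \<open>There is one simplex in each degree, and the coboundary leaving degree \<open>p\<close>
  is the identity for odd \<open>p\<close> and 0 for even \<open>p\<close>. So cocycles vanish in
  odd degrees and bound in positive even degrees, leaving a constant in degree 0.\<close>

lemma point_cohomologous:
  assumes X: "topspace X = {a}" and b: "b \<in> cocycles X"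
  shows "\<exists>m. cohomologous X b (point_cochain X (\<lambda>x. m))"
proof -
  define e where "e p = b p (restrict (\<lambda>v. a) (standard_simplex p))" for p
  have sing: "singular_simplex p X (restrict (\<lambda>v. a) (standard_simplex p))" for p
    by (simp add: singular_simplex_point[OF X])
  have face: "singular_face (Suc p) k (restrict (\<lambda>v. a) (standard_simplex (Suc p))) = restrict (\<lambda>v. a) (standard_simplex p)"
    if "k \<le> Suc p" for p k
    using singular_simplex_subtopology_face[OF sing that] by (simp add: singular_simplex_point[OF X])
  have delta: "coboundary X \<phi> (Suc p) (restrict (\<lambda>v. a) (standard_simplex (Suc p)))
      = (if odd p then \<phi> p (restrict (\<lambda>v. a) (standard_simplex p)) else 0)" for \<phi> p
  proof -
    have "coboundary X \<phi> (Suc p) (restrict (\<lambda>v. a) (standard_simplex (Suc p)))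
      = (\<Sum>k\<le>Suc p. (-1) ^ k * \<phi> p (restrict (\<lambda>v. a) (standard_simplex p)))"
      using sing[of "Suc p"] by (auto simp: coboundary_Suc face simp del: sum.atMost_Suc singular_face_restrict intro!: sum.cong)
    also have "\<dots> = (\<Sum>k\<le>Suc p. (-1) ^ k) * \<phi> p (restrict (\<lambda>v. a) (standard_simplex p))"
      by (simp only: sum_distrib_right)
    finally show ?thesis
      unfolding alternating_sum_int by simp
  qed
  have odd: "e p = 0" if "odd p" for p
    using delta[of b p] b that by (simp add: e_def)
  define w where "w p \<sigma> = (if odd p \<and> singular_simplex p X \<sigma> then e (Suc p) else 0)" for p \<sigma>
  obtain N where N: "\<forall>p\<ge>N. \<forall>\<sigma>. b p \<sigma> = 0"
    using total_cochains_bound[of b X] b by auto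
  have w: "w \<in> total_cochains X"
    by (rule total_cochains_bounded[of X _ N]) (auto simp: w_def e_def N)
  have "b = point_cochain X (\<lambda>x. e 0) + coboundary X w"
  proof (rule total_cochains_eqI[of _ X])
    fix p \<sigma> assume "singular_simplex p X \<sigma>"
    then have \<sigma>: "\<sigma> = restrict (\<lambda>v. a) (standard_simplex p)"
      by (simp add: singular_simplex_point[OF X])
    show "b p \<sigma> = (point_cochain X (\<lambda>x. e 0) + coboundary X w) p \<sigma>"
    proof (cases p)
      case 0
      then show ?thesis using sing[of 0] by (simp add: \<sigma> e_def point_cochain_def)
    next
      case (Suc q)
      then show ?thesis
        using delta[of w q] sing[of q] odd[of p] by (simp add: \<sigma> w_def point_cochain_def e_def)
    qed
  qed (use b w in auto)
  then show ?thesis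
    using w by (intro exI[of _ "e 0"]) (rule cohomologousI)
qed

text \<open>
  On the complement of \<open>{0, k}\<close> in the plane, the Leray--Hirsch theorem over a point leaves no
  cohomology in degree 2.
\<close>

lemma steinberg_cup:
  assumes f: "nonvanishing X f" and g: "nonvanishing X g" and k: "k \<noteq> 0"
    and diff: "\<And>x. x \<in> topspace X \<Longrightarrow> f x - g x = k"
  shows "cohomologous X (cup X (winding_cochain X f) (winding_cochain X g)) 0"
proof -
  let ?B = "discrete_topology {()}"
  \<comment> \<open>The two graphs over a point are the punctures 0 and \<open>k\<close>. The map
    given by \<open>f\<close> into their complement pulls the class of \<open>False\<close> back to
    that of \<open>f\<close> and the class of \<open>True\<close> back to that of
    \<open>f - k = g\<close>.\<close>
  define q where "q i = (\<lambda>x::unit. if i then k else 0)" for i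
  let ?Y = "punctured_bundle ?B q UNIV"
  let ?a = "graph_class ?B q UNIV"
  define u where "u = cup ?Y (?a False) (?a True)"
  have cont: "continuous_map ?B euclidean (q i)" for i
    by (simp add: q_def)
  have a: "?a i \<in> cocycles ?Y" for i
    by (rule graph_class_cocycle[OF cont]) simp
  have u: "u \<in> cocycles ?Y"
    unfolding u_def by (intro cup_cocycles a)
  have distinct: "q i x \<noteq> q i' x" if "i \<noteq> i'" for i i' x
    using k that by (auto simp: q_def)
  have "\<exists>b0\<in>cocycles ?B. \<exists>b. (\<forall>i\<in>UNIV. b i \<in> cocycles ?B) \<and>
      cohomologous ?Y u (pullback ?Y fst b0 + (\<Sum>i\<in>UNIV. cup ?Y (?a i) (pullback ?Y fst (b i))))"
    by (rule punctured_bundle_decomposition[OF _ cont distinct u]) simp_all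
  then obtain b0 b where b0: "b0 \<in> cocycles ?B" and b: "\<forall>i\<in>UNIV. b i \<in> cocycles ?B"
    and ub: "cohomologous ?Y u (pullback ?Y fst b0 + (\<Sum>i\<in>UNIV. cup ?Y (?a i) (pullback ?Y fst (b i))))"
    by blast
  obtain m0 where m0: "cohomologous ?B b0 (point_cochain ?B (\<lambda>x. m0))"
    using point_cohomologous[OF _ b0] by auto
  have "\<exists>m. cohomologous ?B (b i) (point_cochain ?B (\<lambda>x. m))" for i
    using point_cohomologous[of ?B "()" "b i"] b by simp
  then obtain m where m: "\<And>i. cohomologous ?B (b i) (point_cochain ?B (\<lambda>x. m i))"
    by metis
  define e where "e = pullback ?Y fst (point_cochain ?B (\<lambda>x. m0))
      + (\<Sum>i\<in>UNIV. cup ?Y (?a i) (pullback ?Y fst (point_cochain ?B (\<lambda>x. m i))))"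
  have "cohomologous ?Y (pullback ?Y fst b0 + (\<Sum>i\<in>UNIV. cup ?Y (?a i) (pullback ?Y fst (b i)))) e"
    unfolding e_def
    by (intro cohomologous_add cohomologous_sum cohomologous_cup_right a pullback_cohomologous[of ?Y ?B fst] m0 m) simp_all
  then have "cohomologous ?Y u e"
    by (rule cohomologous_trans[OF ub])
  then obtain \<psi> where \<psi>: "\<psi> \<in> total_cochains ?Y" "u = e + coboundary ?Y \<psi>"
    by (rule cohomologousE)
  have deg_a: "?a i p \<sigma> = 0" if "p \<noteq> 1" for i p \<sigma>
    unfolding graph_class_def using winding_cochain_degree[OF that] by metis
  have deg_e: "e 2 \<sigma> = 0" for \<sigma>
  proof -
    have "pullback ?Y fst (point_cochain ?B (\<lambda>x. m')) p \<tau> = 0" if "p \<noteq> 0" for p \<tau> m'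
      using that by (simp add: pullback_def point_cochain_def)
    then have "?a i p (front_face p \<sigma>) * pullback ?Y fst (point_cochain ?B (\<lambda>x. m i)) (2 - p) (back_face p (2 - p) \<sigma>) = 0"
      if "p \<le> 2" for i p
      using that deg_a[of p i] by (cases "p = 1") auto
    then have "cup ?Y (?a i) (pullback ?Y fst (point_cochain ?B (\<lambda>x. m i))) 2 \<sigma> = 0" for i
      unfolding cup_def by (auto intro!: sum.neutral)
    then show ?thesis
      by (simp add: e_def pullback_def point_cochain_def UNIV_bool)
  qed
  have deg_u: "u p \<sigma> = 0" if "p \<noteq> 2" for p \<sigma>
  proof -
    have "?a False i (front_face i \<sigma>) * ?a True (p - i) (back_face i (p - i) \<sigma>) = 0" for i
      using that deg_a[of i] deg_a[of "p - i"] by (cases "i = 1") auto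
    then show ?thesis
      unfolding u_def cup_def by (auto intro!: sum.neutral)
  qed
  \<comment> \<open>The combination \<open>e\<close> has no component in degree 2, while
    \<open>u\<close> lives there alone; hence the degree one part of the primitive already has
    coboundary \<open>u\<close>.\<close>
  define \<psi>' where "\<psi>' p \<sigma> = (if p = 1 then \<psi> p \<sigma> else 0)" for p \<sigma>
  have "u = 0 + coboundary ?Y \<psi>'"
  proof (intro ext)
    fix p \<sigma>
    show "u p \<sigma> = (0 + coboundary ?Y \<psi>') p \<sigma>"
    proof (cases "p = 2")
      case True
      then have "coboundary ?Y \<psi>' p \<sigma> = coboundary ?Y \<psi> p \<sigma>"
        by (simp add: coboundary_Suc numeral_2_eq_2 \<psi>'_def)
      then show ?thesis
        using \<psi>(2) True deg_e by simp
    next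
      case False
      then have "coboundary ?Y \<psi>' p \<sigma> = 0"
        by (cases p) (auto simp: coboundary_Suc \<psi>'_def numeral_2_eq_2 simp del: sum.atMost_Suc)
      then show ?thesis using False deg_u by simp
    qed
  qed
  moreover have "\<psi>' \<in> total_cochains ?Y"
    by (rule total_cochains_bounded[of ?Y _ 2]) (use \<psi>(1) in \<open>auto simp: \<psi>'_def total_cochains_outside[of \<psi> ?Y]\<close>)
  ultimately have u0: "cohomologous ?Y u 0"
    using cohomologousI by blast
  define h where "h x = ((), f x)" for x
  have h: "continuous_map X ?Y h"
    unfolding h_def
  proof (rule continuous_map_fibre_spaceI)
    show "((), f x) \<in> graph_complement ?B q UNIV" if "x \<in> topspace X" for x
      using f g diff[OF that] that by (auto simp: graph_complement_def q_def nonvanishing_def)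
  qed (use f in \<open>auto simp: nonvanishing_def\<close>)
  have "pullback X h (?a False) = winding_cochain X f"
    unfolding graph_class_def pullback_winding_cochain[OF h] by (rule winding_cochain_cong) (simp add: h_def q_def)
  moreover have "pullback X h (?a True) = winding_cochain X g"
    unfolding graph_class_def pullback_winding_cochain[OF h]
    by (rule winding_cochain_cong) (use diff in \<open>simp add: h_def q_def algebra_simps\<close>)
  ultimately show ?thesis
    using pullback_cohomologous[OF h u0] by (simp add: u_def pullback_cup[OF h])
qed

section \<open>The fibration of the arrangement complement\<close>

fun level :: "generator \<Rightarrow> nat" where
  "level (Z i) = i" | "level (Rho i) = i" | "level (Eta i) = i"
| "level (Alpha i j) = j" | "level (Beta i j) = j"

definition level_gens :: "nat \<Rightarrow> generator set" where
  "level_gens n = {g \<in> gens n. level g = n}"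

text \<open>The missing value of the last coordinate where the divisor of the generator meets the fibre.\<close>

fun root_of :: "generator \<Rightarrow> (nat \<Rightarrow> complex) \<Rightarrow> complex" where
  "root_of (Z i) x = 0" | "root_of (Rho i) x = 1" | "root_of (Eta i) x = -1"
| "root_of (Alpha i j) x = x i" | "root_of (Beta i j) x = inverse (x i)"

lemma in_gens [simp]:
  "Z i \<in> gens n \<longleftrightarrow> 1 \<le> i \<and> i \<le> n" "Rho i \<in> gens n \<longleftrightarrow> 1 \<le> i \<and> i \<le> n" "Eta i \<in> gens n \<longleftrightarrow> 1 \<le> i \<and> i \<le> n"
  "Alpha i j \<in> gens n \<longleftrightarrow> 1 \<le> i \<and> i < j \<and> j \<le> n" "Beta i j \<in> gens n \<longleftrightarrow> 1 \<le> i \<and> i < j \<and> j \<le> n"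
  by (auto simp: gens_def)

lemma gens_Suc: "gens (Suc m) = gens m \<union> level_gens (Suc m)"
proof (rule Set.set_eqI)
  show "g \<in> gens (Suc m) \<longleftrightarrow> g \<in> gens m \<union> level_gens (Suc m)" for g
    by (cases g) (auto simp: level_gens_def)
qed

lemma level_gens_cases:
  assumes "g \<in> level_gens (Suc m)"
  obtains "g = Z (Suc m)" | "g = Rho (Suc m)" | "g = Eta (Suc m)"
    | i where "1 \<le> i" "i \<le> m" "g = Alpha i (Suc m)" | i where "1 \<le> i" "i \<le> m" "g = Beta i (Suc m)"
  using assms by (cases g) (auto simp: level_gens_def)

lemma gens_0: "gens 0 = {}"
  by (auto simp: gens_def)

lemma level_gens_subset: "level_gens n \<subseteq> gens n"
  by (auto simp: level_gens_def)

lemma gens_level_le: "g \<in> gens n \<Longrightarrow> level g \<le> n"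
  by (cases g) auto

lemma gens_mono: "m \<le> n \<Longrightarrow> gens m \<subseteq> gens n"
proof
  show "g \<in> gens n" if "m \<le> n" "g \<in> gens m" for g
    using that by (cases g) auto
qed

lemma finite_level_gens: "finite (level_gens (Suc m))"
proof (rule finite_subset)
  show "level_gens (Suc m) \<subseteq> {Z (Suc m), Rho (Suc m), Eta (Suc m)}
     \<union> (\<lambda>i. Alpha i (Suc m)) ` {1..m} \<union> (\<lambda>i. Beta i (Suc m)) ` {1..m}"
    by (auto elim: level_gens_cases)
qed simp

section \<open>The arrangement complement as a bundle of punctured planes\<close>

lemma topspace_M_C:
  "topspace (M_C n) = {x \<in> extensional {1..n}. (\<forall>i\<in>{1..n}. x i \<noteq> 0 \<and> x i \<noteq> 1 \<and> x i \<noteq> -1) \<and>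
         (\<forall>i\<in>{1..n}. \<forall>j\<in>{1..n}. i < j \<longrightarrow> x j \<noteq> x i \<and> x i * x j \<noteq> 1)}"
  by (auto simp: M_C_def PiE_UNIV_domain PiE_def)

lemma M_C_coordinates:
  assumes "x \<in> topspace (M_C n)" "i \<in> {1..n}"
  shows "x i \<noteq> 0" "x i \<noteq> 1" "x i \<noteq> -1"
    "\<And>j. j \<in> {1..n} \<Longrightarrow> i \<noteq> j \<Longrightarrow> x i \<noteq> x j"
    "\<And>j. j \<in> {1..n} \<Longrightarrow> x i * x j \<noteq> 1"
proof -
  show "x i \<noteq> 0" "x i \<noteq> 1" "x i \<noteq> -1"
    using assms unfolding topspace_M_C by auto
  show "x i \<noteq> x j" if "j \<in> {1..n}" "i \<noteq> j" for j
    using assms that unfolding topspace_M_C by (cases "i < j") fastforce+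
  show "x i * x j \<noteq> 1" if "j \<in> {1..n}" for j
  proof (cases i j rule: linorder_cases)
    \<comment> \<open>Equal indices are covered because the square of a coordinate is 1 only at the
      excluded values 1 and -1.\<close>
    case equal
    then show ?thesis
      using \<open>x i \<noteq> 1\<close> \<open>x i \<noteq> -1\<close> square_eq_1_iff[of "x i"] by auto
  next
    case greater
    then show ?thesis
      using assms that unfolding topspace_M_C by (fastforce simp: mult.commute)
  qed (use assms that in \<open>auto simp: topspace_M_C\<close>)
qed

lemma continuous_map_M_C_coordinate:
  "i \<in> {1..n} \<Longrightarrow> continuous_map (M_C n) euclidean (\<lambda>x. x i)"
  unfolding M_C_def by (intro continuous_map_from_subtopology continuous_map_product_projection)

lemma log_arg_fun:
  "log_arg (Z i) = (\<lambda>x. x i)" "log_arg (Rho i) = (\<lambda>x. x i - 1)" "log_arg (Eta i) = (\<lambda>x. x i + 1)"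
  "log_arg (Alpha i j) = (\<lambda>x. x j - x i)" "log_arg (Beta i j) = (\<lambda>x. x i * x j - 1)"
  by auto

lemma root_of_fun:
  "root_of (Z i) = (\<lambda>x. 0)" "root_of (Rho i) = (\<lambda>x. 1)" "root_of (Eta i) = (\<lambda>x. -1)"
  "root_of (Alpha i j) = (\<lambda>x. x i)" "root_of (Beta i j) = (\<lambda>x. 1 / x i)"
  by (auto simp: inverse_eq_divide)

lemma nonvanishing_log_arg:
  assumes "g \<in> gens n"
  shows "nonvanishing (M_C n) (log_arg g)"
proof -
  have "continuous_map (M_C n) euclidean (log_arg g)"
    by (cases g) (use assms in \<open>auto simp: log_arg_fun intro!: continuous_map_M_C_coordinate continuous_map_add continuous_map_diff continuous_map_mult\<close>)
  moreover have "log_arg g x \<noteq> 0" if "x \<in> topspace (M_C n)" for x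
    using assms M_C_coordinates[OF that] by (cases g) (simp_all add: eq_neg_iff_add_eq_0)
  ultimately show ?thesis
    by (simp add: nonvanishing_def)
qed

abbreviation gen_cochain :: "nat \<Rightarrow> generator \<Rightarrow> (nat \<Rightarrow> complex) cochain" where
  "gen_cochain n g \<equiv> winding_cochain (M_C n) (log_arg g)"

lemma gen_cochain_cocycle: "g \<in> gens n \<Longrightarrow> gen_cochain n g \<in> cocycles (M_C n)"
  by (rule winding_cochain_cocycle[OF nonvanishing_log_arg])

definition drop_last :: "nat \<Rightarrow> (nat \<Rightarrow> complex) \<Rightarrow> nat \<Rightarrow> complex" where
  "drop_last m x = restrict x {1..m}"

lemma continuous_map_drop_last: "continuous_map (M_C (Suc m)) (M_C m) (drop_last m)"
proof -
  have "continuous_map (M_C (Suc m)) (product_topology (\<lambda>i. euclidean) {1..m}) (drop_last m)"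
    unfolding continuous_map_componentwise
    by (auto simp: drop_last_def intro!: continuous_map_M_C_coordinate[of _ "Suc m", simplified])
  moreover have "drop_last m x \<in> topspace (M_C m)" if "x \<in> topspace (M_C (Suc m))" for x
    using that by (auto simp: topspace_M_C drop_last_def)
  ultimately show ?thesis
    by (subst M_C_def) (auto simp: continuous_map_in_subtopology topspace_M_C)
qed

lemma log_arg_drop_last: "g \<in> gens m \<Longrightarrow> log_arg g \<circ> drop_last m = log_arg g"
  by (cases g) (auto simp: drop_last_def fun_eq_iff)

lemma pullback_gen_cochain:
  "g \<in> gens m \<Longrightarrow> pullback (M_C (Suc m)) (drop_last m) (gen_cochain m g) = gen_cochain (Suc m) g"
  by (simp add: pullback_winding_cochain[OF continuous_map_drop_last] log_arg_drop_last)

lemma root_of_continuous: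
  assumes "g \<in> level_gens (Suc m)"
  shows "continuous_map (M_C m) euclidean (root_of g)"
  using assms
proof (cases rule: level_gens_cases)
  case (5 i)
  then have "continuous_map (M_C m) euclidean (\<lambda>x. 1 / x i)"
    by (intro continuous_map_divide continuous_map_M_C_coordinate M_C_coordinates) auto
  then show ?thesis
    by (simp add: 5 root_of_fun)
qed (auto simp: root_of_fun intro!: continuous_map_M_C_coordinate)

text \<open>The conditions defining the base are what keeps the punctures apart: coordinates avoid
  0, 1, -1 and each other, and the products of coordinates, squares included, avoid 1, which
  separates coordinates from inverses.\<close>

lemma root_of_distinct:
  assumes "g \<in> level_gens (Suc m)" "g' \<in> level_gens (Suc m)" "g \<noteq> g'" "x \<in> topspace (M_C m)"
  shows "root_of g x \<noteq> root_of g' x"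
proof -
  note x = M_C_coordinates[OF assms(4)]
  have 1: "x i \<noteq> 0" "x i \<noteq> 1" "x i \<noteq> -1" "0 \<noteq> x i" "1 \<noteq> x i" "-1 \<noteq> x i"
    "inverse (x i) \<noteq> 1" "inverse (x i) \<noteq> -1" "1 \<noteq> inverse (x i)" "-1 \<noteq> inverse (x i)" if "1 \<le> i" "i \<le> m" for i
    using x(1-3)[of i] that by (auto simp: inverse_eq_iff_eq[of _ "-1", simplified] dest: sym)
  have 2: "inverse (x i) \<noteq> x j" "x j \<noteq> inverse (x i)" if "1 \<le> i" "i \<le> m" "1 \<le> j" "j \<le> m" for i j
    using x(5)[of i j] x(1)[of i] that by (auto simp: field_simps)
  have 3: "x i \<noteq> x j" if "1 \<le> i" "i \<le> m" "1 \<le> j" "j \<le> m" "i \<noteq> j" for i j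
    using x(4)[of i j] that by auto
  show ?thesis
    by (rule level_gens_cases[OF assms(1)]; rule level_gens_cases[OF assms(2)])
      (use assms(3) 1 2 3 in simp_all)
qed

abbreviation E_bundle :: "nat \<Rightarrow> ((nat \<Rightarrow> complex) \<times> complex) topology" where
  "E_bundle m \<equiv> punctured_bundle (M_C m) root_of (level_gens (Suc m))"

definition split_last :: "nat \<Rightarrow> (nat \<Rightarrow> complex) \<Rightarrow> (nat \<Rightarrow> complex) \<times> complex" where
  "split_last m x = (drop_last m x, x (Suc m))"

definition join_last :: "nat \<Rightarrow> (nat \<Rightarrow> complex) \<times> complex \<Rightarrow> nat \<Rightarrow> complex" where
  "join_last m z = (fst z)(Suc m := snd z)"

text \<open>Splitting off the last coordinate turns the conditions on it into avoidance of the
  roots, for \<open>Beta\<close> after dividing by a nonzero coordinate. With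
  \<open>join_last\<close> as inverse this is a homeomorphism.\<close>

lemma continuous_map_split_last: "continuous_map (M_C (Suc m)) (E_bundle m) (split_last m)"
  unfolding split_last_def
proof (rule continuous_map_fibre_spaceI)
  fix x assume x: "x \<in> topspace (M_C (Suc m))"
  have "x (Suc m) \<noteq> root_of g (drop_last m x)" if "g \<in> level_gens (Suc m)" for g
    using that
  proof (cases rule: level_gens_cases)
    case (4 i)
    then show ?thesis
      using M_C_coordinates(4)[OF x, of "Suc m" i] by (simp add: drop_last_def)
  next
    case (5 i)
    then show ?thesis
      using M_C_coordinates(5)[OF x, of "Suc m" i] M_C_coordinates(1)[OF x, of i] by (auto simp: drop_last_def)
  qed (use M_C_coordinates[OF x, of "Suc m"] in auto)
  moreover have "drop_last m x \<in> topspace (M_C m)"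
    using continuous_map_drop_last x by (auto simp: continuous_map_def)
  ultimately show "(drop_last m x, x (Suc m)) \<in> graph_complement (M_C m) root_of (level_gens (Suc m))"
    by (auto simp: graph_complement_def)
qed (auto intro!: continuous_map_drop_last continuous_map_M_C_coordinate)

lemma continuous_map_join_last: "continuous_map (E_bundle m) (M_C (Suc m)) (join_last m)"
proof -
  have coord: "continuous_map (E_bundle m) euclidean (\<lambda>z. join_last m z i)" if "i \<in> {1..Suc m}" for i
  proof (cases "i = Suc m")
    case True
    then show ?thesis
      using continuous_map_snd_fibre_space[of "M_C m" "graph_complement (M_C m) root_of (level_gens (Suc m))"]
      by (simp add: join_last_def)
  next
    case False
    then have "continuous_map (E_bundle m) euclidean ((\<lambda>x. x i) \<circ> fst)"
      using that by (intro continuous_map_compose[OF continuous_map_fst_fibre_space continuous_map_M_C_coordinate]) auto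
    then show ?thesis
      using False by (simp add: join_last_def o_def)
  qed
  have top: "join_last m z \<in> topspace (M_C (Suc m))" if "z \<in> topspace (E_bundle m)" for z
  proof -
    have z: "fst z \<in> topspace (M_C m)" "\<And>g. g \<in> level_gens (Suc m) \<Longrightarrow> snd z \<noteq> root_of g (fst z)"
      using that unfolding topspace_punctured_bundle by (auto simp: graph_complement_def)
    have s: "snd z \<noteq> 0" "snd z \<noteq> 1" "snd z \<noteq> -1" "\<And>i. i \<in> {1..m} \<Longrightarrow> snd z \<noteq> fst z i"
      using z(2)[of "Z (Suc m)"] z(2)[of "Rho (Suc m)"] z(2)[of "Eta (Suc m)"] z(2)[of "Alpha i (Suc m)" for i]
      by (auto simp: level_gens_def)
    have s': "fst z i * snd z \<noteq> 1" if "i \<in> {1..m}" for i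
      using z(2)[of "Beta i (Suc m)"] that M_C_coordinates(1)[OF z(1) that]
      by (auto simp: level_gens_def field_simps)
    show ?thesis
      using z(1) s s' unfolding topspace_M_C
      by (auto simp: join_last_def extensional_def le_Suc_eq)
  qed
  have "continuous_map (E_bundle m) (product_topology (\<lambda>i. euclidean) {1..Suc m}) (join_last m)"
    unfolding continuous_map_componentwise using coord top by (auto simp: topspace_M_C)
  then show ?thesis
    using top by (subst M_C_def) (auto simp: continuous_map_in_subtopology topspace_M_C)
qed

lemma join_split_last: "x \<in> topspace (M_C (Suc m)) \<Longrightarrow> join_last m (split_last m x) = x"
  by (auto simp: join_last_def split_last_def drop_last_def topspace_M_C extensional_def fun_eq_iff le_Suc_eq)

lemma split_join_last: "z \<in> topspace (E_bundle m) \<Longrightarrow> split_last m (join_last m z) = z"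
  unfolding topspace_punctured_bundle
  by (cases z) (auto simp: join_last_def split_last_def drop_last_def topspace_M_C extensional_def fun_eq_iff graph_complement_def)

text \<open>
  \<open>x\<^sub>i x\<^sub>n - 1 = x\<^sub>i (x\<^sub>n - 1 / x\<^sub>i)\<close>: the classes of the \<open>\<beta>\<^sub>i\<^sub>n\<close> differ from the graph classes by classes of the base.
\<close>

fun base_correction :: "nat \<Rightarrow> generator \<Rightarrow> (nat \<Rightarrow> complex) cochain" where
  "base_correction m (Beta i j) = gen_cochain m (Z i)"
| "base_correction m g = 0"

lemma base_correction_cocycle:
  "g \<in> level_gens (Suc m) \<Longrightarrow> base_correction m g \<in> cocycles (M_C m)"
  using gen_cochain_cocycle[of _ m] by (auto elim!: level_gens_cases)

lemma gen_cochain_graph_class: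
  assumes "g \<in> level_gens (Suc m)"
  shows "cohomologous (M_C (Suc m)) (gen_cochain (Suc m) g)
    (pullback (M_C (Suc m)) (split_last m) (graph_class (M_C m) root_of (level_gens (Suc m)) g)
      + pullback (M_C (Suc m)) (drop_last m) (base_correction m g))"
proof -
  let ?M = "M_C (Suc m)"
  let ?f = "\<lambda>x. x (Suc m) - root_of g (drop_last m x)"
  have pb: "pullback ?M (split_last m) (graph_class (M_C m) root_of (level_gens (Suc m)) g) = winding_cochain ?M ?f"
    unfolding graph_class_def pullback_winding_cochain[OF continuous_map_split_last] by (simp add: o_def split_last_def)
  show ?thesis
  proof (cases "\<exists>i. g = Beta i (Suc m)")
    case True
    then obtain i where g: "g = Beta i (Suc m)" and i: "i \<in> {1..m}"
      using assms by (auto elim!: level_gens_cases)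
    have f: "nonvanishing ?M ?f"
    proof -
      have "continuous_map ?M euclidean (root_of g \<circ> drop_last m)"
        by (rule continuous_map_compose[OF continuous_map_drop_last root_of_continuous[OF assms]])
      then have "continuous_map ?M euclidean ?f"
        by (intro continuous_map_diff continuous_map_M_C_coordinate) (auto simp: o_def)
      moreover have "?f x \<noteq> 0" if "x \<in> topspace ?M" for x
        using continuous_map_image_subset_topspace[OF continuous_map_split_last[of m]] that assms
        unfolding topspace_punctured_bundle by (fastforce simp: graph_complement_def split_last_def)
      ultimately show ?thesis by (simp add: nonvanishing_def)
    qed
    have Zi: "Z i \<in> gens (Suc m)" "Z i \<in> gens m"
      using i by auto
    have "gen_cochain (Suc m) g = winding_cochain ?M (\<lambda>x. ?f x * log_arg (Z i) x)"
    proof (rule winding_cochain_cong)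
      fix x assume "x \<in> topspace ?M"
      then show "log_arg g x = ?f x * log_arg (Z i) x"
        using M_C_coordinates(1)[of x "Suc m" i] i by (simp add: g drop_last_def field_simps)
    qed
    then show ?thesis
      unfolding pb using winding_cochain_mult[OF f nonvanishing_log_arg[OF Zi(1)]] pullback_gen_cochain[OF Zi(2)]
      by (simp add: g)
  next
    case False
    then have "base_correction m g = 0"
      using assms by (auto elim!: level_gens_cases)
    moreover have "winding_cochain ?M ?f = gen_cochain (Suc m) g"
      by (rule winding_cochain_cong) (use False assms in \<open>auto elim!: level_gens_cases simp: drop_last_def\<close>)
    ultimately show ?thesis
      unfolding pb by simp
  qed
qed

lemma pullback_drop_last_cocycles:
  "b \<in> cocycles (M_C m) \<Longrightarrow> pullback (M_C (Suc m)) (drop_last m) b \<in> cocycles (M_C (Suc m))"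
  by (rule pullback_cocycles[OF continuous_map_drop_last])

lemma pullback_split_fst:
  "pullback (M_C (Suc m)) (split_last m) (pullback (E_bundle m) fst b) = pullback (M_C (Suc m)) (drop_last m) b"
  by (simp add: pullback_compose[OF continuous_map_split_last] o_def split_last_def)

lemma pullback_split_join:
  "u \<in> total_cochains (M_C (Suc m)) \<Longrightarrow> pullback (M_C (Suc m)) (split_last m) (pullback (E_bundle m) (join_last m) u) = u"
  unfolding pullback_compose[OF continuous_map_split_last]
  by (rule pullback_ident) (simp_all add: join_split_last)

lemma pullback_join_split:
  "u \<in> total_cochains (E_bundle m) \<Longrightarrow> pullback (E_bundle m) (join_last m) (pullback (M_C (Suc m)) (split_last m) u) = u"
  unfolding pullback_compose[OF continuous_map_join_last]
  by (rule pullback_ident) (simp_all add: split_join_last)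

text \<open>Passing from graph classes to generators keeps every fibre coefficient and only adds the
  corrections to the base term. This change of basis is unitriangular, hence invertible over the
  integers.\<close>

lemma graph_combination_cohomologous:
  fixes m b0 b
  defines "M \<equiv> M_C (Suc m)" and "L \<equiv> level_gens (Suc m)" and "d \<equiv> pullback (M_C (Suc m)) (drop_last m)"
  assumes b0: "b0 \<in> cocycles (M_C m)" and b: "\<And>g. g \<in> L \<Longrightarrow> b g \<in> cocycles (M_C m)"
  shows "cohomologous M (d b0 + (\<Sum>g\<in>L. cup M (gen_cochain (Suc m) g) (d (b g))))
    (pullback M (split_last m) (pullback (E_bundle m) fst (b0 + (\<Sum>g\<in>L. cup (M_C m) (base_correction m g) (b g)))
      + (\<Sum>g\<in>L. cup (E_bundle m) (graph_class (M_C m) root_of L g) (pullback (E_bundle m) fst (b g)))))"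
proof -
  let ?s = "pullback M (split_last m)"
  let ?a = "graph_class (M_C m) root_of L"
  have "cohomologous M (\<Sum>g\<in>L. cup M (gen_cochain (Suc m) g) (d (b g)))
      (\<Sum>g\<in>L. cup M (?s (?a g) + d (base_correction m g)) (d (b g)))"
    unfolding M_def L_def d_def
    by (intro cohomologous_sum cohomologous_cup_left gen_cochain_graph_class pullback_drop_last_cocycles)
      (use b in \<open>simp_all add: L_def\<close>)
  then have "cohomologous M (d b0 + (\<Sum>g\<in>L. cup M (gen_cochain (Suc m) g) (d (b g))))
      (d b0 + (\<Sum>g\<in>L. cup M (?s (?a g) + d (base_correction m g)) (d (b g))))"
    by (rule cohomologous_add[OF cohomologous_refl])
  also have "d b0 + (\<Sum>g\<in>L. cup M (?s (?a g) + d (base_correction m g)) (d (b g)))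
     = ?s (pullback (E_bundle m) fst (b0 + (\<Sum>g\<in>L. cup (M_C m) (base_correction m g) (b g)))
      + (\<Sum>g\<in>L. cup (E_bundle m) (?a g) (pullback (E_bundle m) fst (b g))))"
    unfolding M_def d_def
    by (simp only: pullback_add pullback_sum pullback_cup[OF continuous_map_split_last] pullback_split_fst
        pullback_cup[OF continuous_map_drop_last] cup_add_left sum.distrib add_ac)
  finally show ?thesis .
qed

theorem M_C_decomposition:
  assumes u: "u \<in> cocycles (M_C (Suc m))"
  shows "\<exists>b0\<in>cocycles (M_C m). \<exists>b. (\<forall>g\<in>level_gens (Suc m). b g \<in> cocycles (M_C m)) \<and>
    cohomologous (M_C (Suc m)) u (pullback (M_C (Suc m)) (drop_last m) b0 +
      (\<Sum>g\<in>level_gens (Suc m). cup (M_C (Suc m)) (gen_cochain (Suc m) g) (pullback (M_C (Suc m)) (drop_last m) (b g))))"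
proof -
  let ?M = "M_C (Suc m)" and ?L = "level_gens (Suc m)" and ?E = "E_bundle m"
  have "pullback ?E (join_last m) u \<in> cocycles ?E"
    by (rule pullback_cocycles[OF continuous_map_join_last u])
  then have "\<exists>b0\<in>cocycles (M_C m). \<exists>b. (\<forall>g\<in>?L. b g \<in> cocycles (M_C m)) \<and>
    cohomologous ?E (pullback ?E (join_last m) u) (pullback ?E fst b0 +
      (\<Sum>g\<in>?L. cup ?E (graph_class (M_C m) root_of ?L g) (pullback ?E fst (b g))))"
  proof (intro punctured_bundle_decomposition)
    show "root_of g y \<noteq> root_of g' y" if "g \<in> ?L" "g' \<in> ?L" "g \<noteq> g'" "y \<in> topspace (M_C m)" for g g' y
      using that by (rule root_of_distinct)
  qed (assumption | intro finite_level_gens root_of_continuous)+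
  then obtain b0 b where b0: "b0 \<in> cocycles (M_C m)" and b: "\<forall>g\<in>?L. b g \<in> cocycles (M_C m)" and
    ub: "cohomologous ?E (pullback ?E (join_last m) u) (pullback ?E fst b0 +
      (\<Sum>g\<in>?L. cup ?E (graph_class (M_C m) root_of ?L g) (pullback ?E fst (b g))))"
    by blast
  define c0 where "c0 = b0 - (\<Sum>g\<in>?L. cup (M_C m) (base_correction m g) (b g))"
  have c0: "c0 \<in> cocycles (M_C m)"
    unfolding c0_def using b base_correction_cocycle by (intro cocycles_diff cocycles_sum cup_cocycles b0) auto
  have "cohomologous ?M u (pullback ?M (split_last m) (pullback ?E fst b0 +
      (\<Sum>g\<in>?L. cup ?E (graph_class (M_C m) root_of ?L g) (pullback ?E fst (b g)))))"
    using pullback_cohomologous[OF continuous_map_split_last ub] unfolding pullback_split_join[OF cocycles_total[OF u]] .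
  moreover have "b0 = c0 + (\<Sum>g\<in>?L. cup (M_C m) (base_correction m g) (b g))"
    by (simp add: c0_def)
  ultimately have "cohomologous ?M u (pullback ?M (drop_last m) c0 +
      (\<Sum>g\<in>?L. cup ?M (gen_cochain (Suc m) g) (pullback ?M (drop_last m) (b g))))"
    using cohomologous_trans[OF _ cohomologous_sym[OF graph_combination_cohomologous[OF c0, of b]]] b by simp
  then show ?thesis
    using c0 b by blast
qed

theorem M_C_independence:
  assumes b0: "b0 \<in> cocycles (M_C m)" and b: "\<And>g. g \<in> level_gens (Suc m) \<Longrightarrow> b g \<in> cocycles (M_C m)"
    and zero: "cohomologous (M_C (Suc m)) (pullback (M_C (Suc m)) (drop_last m) b0 +
      (\<Sum>g\<in>level_gens (Suc m). cup (M_C (Suc m)) (gen_cochain (Suc m) g) (pullback (M_C (Suc m)) (drop_last m) (b g)))) 0"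
  shows "cohomologous (M_C m) b0 0 \<and> (\<forall>g\<in>level_gens (Suc m). cohomologous (M_C m) (b g) 0)"
proof -
  let ?M = "M_C (Suc m)" and ?L = "level_gens (Suc m)" and ?E = "E_bundle m"
  define S where "S = (\<Sum>g\<in>?L. cup (M_C m) (base_correction m g) (b g))"
  have S: "S \<in> cocycles (M_C m)"
    unfolding S_def using b base_correction_cocycle by (intro cocycles_sum cup_cocycles) auto
  define x where "x = pullback ?E fst (b0 + S) + (\<Sum>g\<in>?L. cup ?E (graph_class (M_C m) root_of ?L g) (pullback ?E fst (b g)))"
  have x: "x \<in> cocycles ?E"
    unfolding x_def using b0 S b root_of_continuous
    by (intro cocycles_add cocycles_sum cup_cocycles pullback_fst_cocycles graph_class_cocycle) auto
  have "cohomologous ?M (pullback ?M (split_last m) x) 0"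
    using cohomologous_trans[OF cohomologous_sym[OF graph_combination_cohomologous[OF b0 b]] zero]
    by (simp add: x_def S_def)
  from pullback_cohomologous[OF continuous_map_join_last this] have "cohomologous ?E x 0"
    using x by (simp add: pullback_join_split)
  then have "cohomologous (M_C m) (b0 + S) 0 \<and> (\<forall>g\<in>?L. cohomologous (M_C m) (b g) 0)"
    unfolding x_def
  proof (intro punctured_bundle_independence)
    show "root_of g y \<noteq> root_of g' y" if "g \<in> ?L" "g' \<in> ?L" "g \<noteq> g'" "y \<in> topspace (M_C m)" for g g' y
      using that by (rule root_of_distinct)
  qed (assumption | intro finite_level_gens root_of_continuous cocycles_add b0 S b)+
  then have b0S: "cohomologous (M_C m) (b0 + S) 0" and bg: "\<And>g. g \<in> ?L \<Longrightarrow> cohomologous (M_C m) (b g) 0"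
    by auto
  \<comment> \<open>The correction \<open>S\<close> is built from the coefficients
    \<open>b g\<close>, so it is trivial once they are, and triviality of \<open>b0\<close> follows
    from that of \<open>b0 + S\<close>.\<close>
  have "cohomologous (M_C m) S (\<Sum>g\<in>?L. cup (M_C m) (base_correction m g) 0)"
    unfolding S_def by (intro cohomologous_sum cohomologous_cup_right base_correction_cocycle bg)
  also have "(\<Sum>g\<in>?L. cup (M_C m) (base_correction m g) 0) = 0"
    by (rule sum.neutral) simp
  finally have "cohomologous (M_C m) (b0 + S - S) (0 - 0)"
    by (rule cohomologous_diff[OF b0S])
  then show ?thesis
    using bg by auto
qed

section \<open>The additive basis of words\<close>

definition scale_cochain :: "int \<Rightarrow> 'a cochain \<Rightarrow> 'a cochain" where
  "scale_cochain k \<phi> = (\<lambda>p \<sigma>. k * \<phi> p \<sigma>)"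

lemma scale_cochain_diff: "scale_cochain (k - l) \<phi> = scale_cochain k \<phi> - scale_cochain l \<phi>"
  and scale_cochain_0 [simp]: "scale_cochain 0 \<phi> = 0"
  and scale_cochain_0_right [simp]: "scale_cochain k 0 = 0"
  and scale_cochain_1 [simp]: "scale_cochain 1 \<phi> = \<phi>"
  by (auto simp: scale_cochain_def fun_eq_iff algebra_simps)

lemma cup_scale_right: "cup X \<phi> (scale_cochain k \<psi>) = scale_cochain k (cup X \<phi> \<psi>)"
  by (auto simp: scale_cochain_def cup_def fun_eq_iff sum_distrib_left algebra_simps)

lemma pullback_scale: "pullback X f (scale_cochain k \<phi>) = scale_cochain k (pullback X f \<phi>)"
  by (auto simp: scale_cochain_def pullback_def fun_eq_iff)

lemma coboundary_scale: "coboundary X (scale_cochain k \<phi>) = scale_cochain k (coboundary X \<phi>)"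
proof (intro ext)
  show "coboundary X (scale_cochain k \<phi>) p \<sigma> = scale_cochain k (coboundary X \<phi>) p \<sigma>" for p \<sigma>
    by (cases p) (auto simp: coboundary_Suc scale_cochain_def sum_distrib_left algebra_simps simp del: sum.atMost_Suc)
qed

lemma scale_cochain_total [simp]:
  assumes "\<phi> \<in> total_cochains X"
  shows "scale_cochain k \<phi> \<in> total_cochains X"
proof -
  obtain N where "\<forall>p\<ge>N. \<forall>\<sigma>. \<phi> p \<sigma> = 0"
    using total_cochains_bound[OF assms] by blast
  then show ?thesis
    using assms by (intro total_cochains_bounded[of X _ N]) (auto simp: scale_cochain_def total_cochains_outside)
qed

lemma scale_cochain_cocycles [simp]: "\<phi> \<in> cocycles X \<Longrightarrow> scale_cochain k \<phi> \<in> cocycles X"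
  by (rule cocyclesI) (simp_all add: coboundary_scale)

lemma point_cochain_const: "point_cochain X (\<lambda>x. m) = scale_cochain m (unit_cochain X)"
  by (auto simp: point_cochain_def scale_cochain_def unit_cochain_def fun_eq_iff)

fun word_cochain :: "nat \<Rightarrow> generator list \<Rightarrow> (nat \<Rightarrow> complex) cochain" where
  "word_cochain n [] = unit_cochain (M_C n)"
| "word_cochain n (g # w) = cup (M_C n) (gen_cochain n g) (word_cochain n w)"

lemma word_cochain_cocycle: "set w \<subseteq> gens n \<Longrightarrow> word_cochain n w \<in> cocycles (M_C n)"
  by (induction w) (auto intro!: cup_cocycles gen_cochain_cocycle)

lemma word_cochain_append:
  assumes "set u \<subseteq> gens n" "set w \<subseteq> gens n"
  shows "word_cochain n (u @ w) = cup (M_C n) (word_cochain n u) (word_cochain n w)"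
  using assms word_cochain_cocycle[OF assms(2)] by (induction u) (simp_all add: cup_assoc)

lemma pullback_word_cochain:
  "set w \<subseteq> gens m \<Longrightarrow> pullback (M_C (Suc m)) (drop_last m) (word_cochain m w) = word_cochain (Suc m) w"
  by (induction w)
    (simp_all add: pullback_unit_cochain[OF continuous_map_drop_last] pullback_cup[OF continuous_map_drop_last] pullback_gen_cochain)

text \<open>Words with strictly decreasing levels, the Leray--Hirsch basis.\<close>

fun standard_words :: "nat \<Rightarrow> generator list set" where
  "standard_words 0 = {[]}"
| "standard_words (Suc m) = standard_words m \<union> (\<lambda>(g, w). g # w) ` (level_gens (Suc m) \<times> standard_words m)"

lemma standard_words_gens: "w \<in> standard_words n \<Longrightarrow> set w \<subseteq> gens n"
  by (induction n arbitrary: w) (fastforce simp: gens_Suc)+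

lemma finite_standard_words: "finite (standard_words n)"
  by (induction n) (auto simp: finite_level_gens)

lemma sum_standard_words_Suc:
  fixes f :: "generator list \<Rightarrow> 'a::comm_monoid_add"
  shows "(\<Sum>w\<in>standard_words (Suc m). f w)
    = (\<Sum>w\<in>standard_words m. f w) + (\<Sum>g\<in>level_gens (Suc m). \<Sum>w\<in>standard_words m. f (g # w))"
proof -
  let ?C = "(\<lambda>(g, w). g # w) ` (level_gens (Suc m) \<times> standard_words m)"
  have "standard_words m \<inter> ?C = {}"
  proof -
    have False if "g \<in> level_gens (Suc m)" "g # w \<in> standard_words m" for g w
      using standard_words_gens[OF that(2)] gens_level_le[of g m] that(1) by (auto simp: level_gens_def)
    then show ?thesis by auto
  qed
  then have "(\<Sum>w\<in>standard_words (Suc m). f w) = (\<Sum>w\<in>standard_words m. f w) + (\<Sum>w\<in>?C. f w)"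
    by (simp add: sum.union_disjoint finite_standard_words finite_level_gens)
  also have "(\<Sum>w\<in>?C. f w) = (\<Sum>(g, w)\<in>level_gens (Suc m) \<times> standard_words m. f (g # w))"
    by (subst sum.reindex) (auto simp: inj_on_def case_prod_unfold)
  also have "\<dots> = (\<Sum>g\<in>level_gens (Suc m). \<Sum>w\<in>standard_words m. f (g # w))"
    by (simp add: sum.cartesian_product)
  finally show ?thesis .
qed

abbreviation word_combination :: "nat \<Rightarrow> (generator list \<Rightarrow> int) \<Rightarrow> (nat \<Rightarrow> complex) cochain" where
  "word_combination n k \<equiv> \<Sum>w\<in>standard_words n. scale_cochain (k w) (word_cochain n w)"

lemma word_combination_cocycle: "word_combination n k \<in> cocycles (M_C n)"
  by (intro cocycles_sum scale_cochain_cocycles word_cochain_cocycle standard_words_gens)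

text \<open>Separating the words by their leading generator gives exactly the shape of the
  Leray--Hirsch sums, so spanning and independence both become inductions on the number of
  coordinates.\<close>

lemma word_combination_Suc:
  "word_combination (Suc m) k = pullback (M_C (Suc m)) (drop_last m) (word_combination m k) +
    (\<Sum>g\<in>level_gens (Suc m). cup (M_C (Suc m)) (gen_cochain (Suc m) g)
       (pullback (M_C (Suc m)) (drop_last m) (word_combination m (\<lambda>w. k (g # w)))))"
proof -
  have eq: "pullback (M_C (Suc m)) (drop_last m) (word_combination m l)
      = (\<Sum>w\<in>standard_words m. scale_cochain (l w) (word_cochain (Suc m) w))" for l
    unfolding pullback_sum pullback_scale
    by (intro sum.cong refl arg_cong[of _ _ "scale_cochain _"] pullback_word_cochain standard_words_gens)
  show ?thesis
    unfolding eq sum_standard_words_Suc cup_sum_right cup_scale_right by simp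
qed

theorem standard_words_span:
  assumes "u \<in> cocycles (M_C n)"
  shows "\<exists>k. cohomologous (M_C n) u (word_combination n k)"
  using assms
proof (induction n arbitrary: u)
  case 0
  have "topspace (M_C 0) = {\<lambda>x. undefined}"
    by (auto simp: topspace_M_C extensional_def)
  then obtain m where "cohomologous (M_C 0) u (point_cochain (M_C 0) (\<lambda>x. m))"
    using point_cohomologous[OF _ 0] by blast
  then show ?case
    by (intro exI[of _ "\<lambda>w. m"]) (simp add: point_cochain_const)
next
  case (Suc m)
  obtain b0 b where b0: "b0 \<in> cocycles (M_C m)" and b: "\<And>g. g \<in> level_gens (Suc m) \<Longrightarrow> b g \<in> cocycles (M_C m)"
    and u: "cohomologous (M_C (Suc m)) u (pullback (M_C (Suc m)) (drop_last m) b0 +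
      (\<Sum>g\<in>level_gens (Suc m). cup (M_C (Suc m)) (gen_cochain (Suc m) g) (pullback (M_C (Suc m)) (drop_last m) (b g))))"
    using M_C_decomposition[OF Suc.prems] by blast
  obtain k0 where k0: "cohomologous (M_C m) b0 (word_combination m k0)"
    using Suc.IH[OF b0] by blast
  have "\<forall>g\<in>level_gens (Suc m). \<exists>k. cohomologous (M_C m) (b g) (word_combination m k)"
    using Suc.IH[OF b] by blast
  then obtain k where k: "\<And>g. g \<in> level_gens (Suc m) \<Longrightarrow> cohomologous (M_C m) (b g) (word_combination m (k g))"
    by metis
  \<comment> \<open>Merges the coefficient functions of all summands into one. There is no clash, as
    a standard word of the lower stage never begins with a generator of level
    \<open>Suc m\<close>.\<close>
  define l where "l w = (case w of [] \<Rightarrow> k0 [] | g # w' \<Rightarrow> if g \<in> level_gens (Suc m) then k g w' else k0 w)" for w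
  have l0: "l w = k0 w" if "w \<in> standard_words m" for w
  proof (cases w)
    case (Cons g w')
    then have "g \<notin> level_gens (Suc m)"
      using standard_words_gens[OF that] gens_level_le[of g m] by (auto simp: level_gens_def)
    then show ?thesis by (simp add: l_def Cons)
  qed (simp add: l_def)
  have l1: "word_combination m (\<lambda>w. l (g # w)) = word_combination m (k g)" if "g \<in> level_gens (Suc m)" for g
    using that by (simp add: l_def)
  have "word_combination m l = word_combination m k0"
    by (intro sum.cong) (auto simp: l0)
  then have eq: "word_combination (Suc m) l = pullback (M_C (Suc m)) (drop_last m) (word_combination m k0) +
    (\<Sum>g\<in>level_gens (Suc m). cup (M_C (Suc m)) (gen_cochain (Suc m) g)
       (pullback (M_C (Suc m)) (drop_last m) (word_combination m (k g))))"
    unfolding word_combination_Suc by (auto simp only: l1 intro!: arg_cong2[of _ _ _ _ plus] sum.cong)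
  have "cohomologous (M_C (Suc m)) (pullback (M_C (Suc m)) (drop_last m) b0 +
      (\<Sum>g\<in>level_gens (Suc m). cup (M_C (Suc m)) (gen_cochain (Suc m) g) (pullback (M_C (Suc m)) (drop_last m) (b g))))
     (pullback (M_C (Suc m)) (drop_last m) (word_combination m k0) +
    (\<Sum>g\<in>level_gens (Suc m). cup (M_C (Suc m)) (gen_cochain (Suc m) g)
       (pullback (M_C (Suc m)) (drop_last m) (word_combination m (k g)))))"
    by (intro cohomologous_add cohomologous_sum cohomologous_cup_right
        pullback_cohomologous[OF continuous_map_drop_last] k0 k gen_cochain_cocycle subsetD[OF level_gens_subset])
  from cohomologous_trans[OF u this] show ?case
    unfolding eq[symmetric] by (rule exI[of _ l])
qed

theorem standard_words_independent:
  assumes "cohomologous (M_C n) (word_combination n k) 0" "w \<in> standard_words n"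
  shows "k w = 0"
  using assms
proof (induction n arbitrary: k w)
  case 0
  have top: "topspace (M_C 0) = {\<lambda>x. undefined}"
    by (auto simp: topspace_M_C extensional_def)
  obtain v where "word_combination 0 k = 0 + coboundary (M_C 0) v"
    using 0(1) by (rule cohomologousE)
  then have "scale_cochain (k []) (unit_cochain (M_C 0)) = coboundary (M_C 0) v"
    by simp
  \<comment> \<open>Coboundaries vanish in degree 0, so evaluating at the only 0-simplex of the
    one-point space \<open>M_C 0\<close> leaves the coefficient of the empty word.\<close>
  from fun_cong[OF fun_cong[OF this, of 0], of "restrict (\<lambda>v x. undefined) (standard_simplex 0)"]
  have "k [] = 0"
    by (simp add: scale_cochain_def unit_cochain_def singular_simplex_point[OF top])
  then show ?case using 0(2) by simp
next
  case (Suc m)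
  have *: "cohomologous (M_C m) (word_combination m k) 0 \<and>
      (\<forall>g\<in>level_gens (Suc m). cohomologous (M_C m) (word_combination m (\<lambda>w. k (g # w))) 0)"
    by (rule M_C_independence[OF word_combination_cocycle word_combination_cocycle])
      (use Suc.prems(1) in \<open>simp only: word_combination_Suc\<close>)
  show ?case
  proof (cases "w \<in> standard_words m")
    case True
    then show ?thesis using * Suc.IH[of k] by blast
  next
    case False
    then obtain g w' where "g \<in> level_gens (Suc m)" "w' \<in> standard_words m" "w = g # w'"
      using Suc.prems(2) by auto
    then show ?thesis using * Suc.IH[of "\<lambda>w. k (g # w)" w'] by blast
  qed
qed

section \<open>The relations\<close>

definition concat_product :: "('g list \<Rightarrow>\<^sub>0 int) \<Rightarrow> ('g list \<Rightarrow>\<^sub>0 int) \<Rightarrow> ('g list \<Rightarrow>\<^sub>0 int)" where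
  "concat_product a b = frag_extend (\<lambda>u. frag_extend (\<lambda>w. frag_of (u @ w)) b) a"

lemma frag_induct [case_names zero one diff]:
  "P 0 \<Longrightarrow> (\<And>x. P (frag_of x)) \<Longrightarrow> (\<And>a b. P a \<Longrightarrow> P b \<Longrightarrow> P (a - b)) \<Longrightarrow> P c"
  using frag_induction[of c UNIV P] by blast

lemma frag_extend_fun_diff: "frag_extend (\<lambda>x. f x - g x) c = frag_extend f c - frag_extend g c"
  by (induction c rule: frag_induct) (auto simp: frag_extend_diff)

lemma concat_product_diff_left: "concat_product (a - b) c = concat_product a c - concat_product b c"
  by (simp add: concat_product_def frag_extend_diff)

lemma concat_product_diff_right: "concat_product a (b - c) = concat_product a b - concat_product a c"
  by (simp add: concat_product_def frag_extend_diff frag_extend_fun_diff)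

lemma concat_product_0_left [simp]: "concat_product 0 a = 0"
  by (simp add: concat_product_def)

lemma concat_product_0_right [simp]: "concat_product a 0 = 0"
  using concat_product_diff_right[of a 0 0] by simp

lemma concat_product_uminus_left: "concat_product (- a) c = - concat_product a c"
  using concat_product_diff_left[of 0 a c] by simp

lemma concat_product_uminus_right: "concat_product a (- c) = - concat_product a c"
  using concat_product_diff_right[of a 0 c] by simp

lemma concat_product_add_left: "concat_product (a + b) c = concat_product a c + concat_product b c"
  using concat_product_diff_left[of a "- b" c] by (simp add: concat_product_uminus_left)

lemma concat_product_add_right: "concat_product a (b + c) = concat_product a b + concat_product a c"
  using concat_product_diff_right[of a b "- c"] by (simp add: concat_product_uminus_right)

lemma concat_product_of [simp]: "concat_product (frag_of u) (frag_of w) = frag_of (u @ w)"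
  by (simp add: concat_product_def)

lemma concat_product_assoc: "concat_product (concat_product a b) c = concat_product a (concat_product b c)"
proof (induction a rule: frag_induct)
  case (one u)
  show ?case
  proof (induction b rule: frag_induct)
    case (one v)
    show ?case
      by (induction c rule: frag_induct) (auto simp: concat_product_diff_right)
  qed (auto simp: concat_product_diff_right concat_product_diff_left)
qed (auto simp: concat_product_diff_left)

lemma concat_product_Nil_left [simp]: "concat_product (frag_of []) a = a"
  by (induction a rule: frag_induct) (auto simp: concat_product_diff_right)

lemma concat_product_Nil_right [simp]: "concat_product a (frag_of []) = a"
  by (induction a rule: frag_induct) (auto simp: concat_product_diff_left)

lemma keys_concat_product:
  assumes "Poly_Mapping.keys a \<subseteq> lists S" "Poly_Mapping.keys b \<subseteq> lists S"
  shows "Poly_Mapping.keys (concat_product a b) \<subseteq> lists S"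
proof -
  have "Poly_Mapping.keys (frag_extend (\<lambda>w. frag_of (u @ w)) b) \<subseteq> lists S" if "u \<in> lists S" for u
    by (rule order_trans[OF keys_frag_extend]) (use that assms(2) in fastforce)
  then show ?thesis
    unfolding concat_product_def by (intro order_trans[OF keys_frag_extend]) (use assms(1) in blast)
qed

definition tensors :: "'g set \<Rightarrow> ('g list \<Rightarrow>\<^sub>0 int) set" where
  "tensors S = {a. Poly_Mapping.keys a \<subseteq> lists S}"

lemma carrier_tensor_algebra [simp]: "carrier (tensor_algebra S) = tensors S"
  and mult_tensor_algebra [simp]: "a \<otimes>\<^bsub>tensor_algebra S\<^esub> b = concat_product a b"
  and one_tensor_algebra [simp]: "\<one>\<^bsub>tensor_algebra S\<^esub> = frag_of []"
  and zero_tensor_algebra [simp]: "\<zero>\<^bsub>tensor_algebra S\<^esub> = 0"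
  and add_tensor_algebra [simp]: "a \<oplus>\<^bsub>tensor_algebra S\<^esub> b = a + b"
  by (simp_all add: tensor_algebra_def tensors_def concat_product_def)

lemma tensors_0 [simp]: "0 \<in> tensors S"
  and tensors_of [simp]: "frag_of w \<in> tensors S \<longleftrightarrow> set w \<subseteq> S"
  by (auto simp: tensors_def)

lemma tensors_diff [simp]: "a \<in> tensors S \<Longrightarrow> b \<in> tensors S \<Longrightarrow> a - b \<in> tensors S"
  using keys_diff[of a b] by (auto simp: tensors_def)

lemma tensors_uminus [simp]: "- a \<in> tensors S \<longleftrightarrow> a \<in> tensors S"
  by (simp add: tensors_def)

lemma tensors_add [simp]: "a \<in> tensors S \<Longrightarrow> b \<in> tensors S \<Longrightarrow> a + b \<in> tensors S"
  using tensors_diff[of a S "- b"] by simp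

lemma tensors_concat [simp]: "a \<in> tensors S \<Longrightarrow> b \<in> tensors S \<Longrightarrow> concat_product a b \<in> tensors S"
  by (simp add: tensors_def keys_concat_product)

lemma ring_tensor_algebra: "ring (tensor_algebra S)"
proof (rule ringI)
  show "abelian_group (tensor_algebra S)"
  proof (rule abelian_groupI)
    show "\<exists>b\<in>carrier (tensor_algebra S). b \<oplus>\<^bsub>tensor_algebra S\<^esub> a = \<zero>\<^bsub>tensor_algebra S\<^esub>"
      if "a \<in> carrier (tensor_algebra S)" for a
      using that by (intro bexI[of _ "- a"]) simp_all
  qed (simp_all add: add_ac)
  show "Group.monoid (tensor_algebra S)"
    by (rule monoidI) (simp_all add: concat_product_assoc)
qed (simp_all add: concat_product_add_left concat_product_add_right)

lemma a_inv_tensor_algebra [simp]: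
  assumes "a \<in> tensors S" shows "\<ominus>\<^bsub>tensor_algebra S\<^esub> a = - a"
proof -
  interpret ring "tensor_algebra S" by (rule ring_tensor_algebra)
  show ?thesis
    by (rule minus_equality) (use assms in simp_all)
qed

lemma minus_tensor_algebra [simp]:
  "b \<in> tensors S \<Longrightarrow> a \<ominus>\<^bsub>tensor_algebra S\<^esub> b = a - b"
  by (simp add: a_minus_def)

definition linear_tensors :: "'g set \<Rightarrow> ('g list \<Rightarrow>\<^sub>0 int) set" where
  "linear_tensors S = {v. Poly_Mapping.keys v \<subseteq> {[g] | g. g \<in> S}}"

lemma linear_tensors_0 [simp]: "0 \<in> linear_tensors S"
  and linear_tensors_of [simp]: "frag_of [g] \<in> linear_tensors S \<longleftrightarrow> g \<in> S"
  by (auto simp: linear_tensors_def)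

lemma linear_tensors_diff [simp]: "a \<in> linear_tensors S \<Longrightarrow> b \<in> linear_tensors S \<Longrightarrow> a - b \<in> linear_tensors S"
  using keys_diff[of a b] by (auto simp: linear_tensors_def)

lemma linear_tensors_uminus [simp]: "- a \<in> linear_tensors S \<longleftrightarrow> a \<in> linear_tensors S"
  by (simp add: linear_tensors_def)

lemma linear_tensors_add [simp]: "a \<in> linear_tensors S \<Longrightarrow> b \<in> linear_tensors S \<Longrightarrow> a + b \<in> linear_tensors S"
  using linear_tensors_diff[of a S "- b"] by simp

lemma linear_tensors_tensors: "v \<in> linear_tensors S \<Longrightarrow> v \<in> tensors S"
  unfolding linear_tensors_def tensors_def by auto

lemma linear_tensors_mono: "v \<in> linear_tensors S \<Longrightarrow> S \<subseteq> S' \<Longrightarrow> v \<in> linear_tensors S'"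
  unfolding linear_tensors_def by blast

section \<open>Evaluation of tensors in cochains\<close>

definition extend_words :: "(generator list \<Rightarrow> 'a cochain) \<Rightarrow> (generator list \<Rightarrow>\<^sub>0 int) \<Rightarrow> 'a cochain" where
  "extend_words f a = (\<Sum>w\<in>Poly_Mapping.keys a. scale_cochain (Poly_Mapping.lookup a w) (f w))"

lemma extend_words_superset:
  assumes "finite S" "Poly_Mapping.keys a \<subseteq> S"
  shows "extend_words f a = (\<Sum>w\<in>S. scale_cochain (Poly_Mapping.lookup a w) (f w))"
  unfolding extend_words_def by (rule sum.mono_neutral_left) (use assms in \<open>auto simp: in_keys_iff\<close>)

lemma extend_words_diff: "extend_words f (a - b) = extend_words f a - extend_words f b"
proof -
  let ?S = "Poly_Mapping.keys a \<union> Poly_Mapping.keys b"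
  have "extend_words f c = (\<Sum>w\<in>?S. scale_cochain (Poly_Mapping.lookup c w) (f w))" if "c \<in> {a, b, a - b}" for c
    by (rule extend_words_superset) (use that keys_diff[of a b] in auto)
  then show ?thesis
    by (simp add: lookup_minus scale_cochain_diff sum_subtractf)
qed

lemma extend_words_of [simp]: "extend_words f (frag_of w) = f w"
  by (simp add: extend_words_def)

lemma extend_words_0 [simp]: "extend_words f 0 = 0"
  by (simp add: extend_words_def)

lemma extend_words_uminus: "extend_words f (- a) = - extend_words f a"
  using extend_words_diff[of f 0 a] by simp

lemma extend_words_add: "extend_words f (a + b) = extend_words f a + extend_words f b"
  using extend_words_diff[of f a "- b"] by (simp add: extend_words_uminus)

abbreviation ev :: "nat \<Rightarrow> (generator list \<Rightarrow>\<^sub>0 int) \<Rightarrow> (nat \<Rightarrow> complex) cochain" where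
  "ev n \<equiv> extend_words (word_cochain n)"

lemma ev_cocycle: "a \<in> tensors (gens n) \<Longrightarrow> ev n a \<in> cocycles (M_C n)"
  unfolding extend_words_def by (intro cocycles_sum scale_cochain_cocycles word_cochain_cocycle) (auto simp: tensors_def)

lemma ev_concat_product:
  assumes "a \<in> tensors (gens n)" "b \<in> tensors (gens n)"
  shows "ev n (concat_product a b) = cup (M_C n) (ev n a) (ev n b)"
  using assms(1) unfolding tensors_def mem_Collect_eq
proof (induction a rule: frag_induction)
  case (one u)
  then have u: "set u \<subseteq> gens n" by auto
  show ?case
    using assms(2) unfolding tensors_def mem_Collect_eq
  proof (induction b rule: frag_induction)
    case (one w)
    then have "set w \<subseteq> gens n" by auto
    then show ?case using u by (simp add: word_cochain_append)
  next
    case (diff a b)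
    then show ?case by (simp only: concat_product_diff_right extend_words_diff cup_diff_right)
  qed (simp only: concat_product_0_right extend_words_0 cup_0_right)
next
  case (diff a b)
  then show ?case by (simp only: concat_product_diff_left extend_words_diff cup_diff_left)
qed (simp only: concat_product_0_left extend_words_0 cup_0_left)

lemma ev_ring_hom: "ev n \<in> ring_hom (tensor_algebra (gens n)) (cocycle_ring (M_C n))"
  by (rule ring_hom_memI) (simp_all add: ev_cocycle ev_concat_product extend_words_add)

lemma ev_linear_degree_1:
  assumes "v \<in> linear_tensors (gens n)" "p \<noteq> 1"
  shows "ev n v p = (\<lambda>\<sigma>. 0)"
proof -
  have "ev n v p \<sigma> = 0" for \<sigma>
    using assms(1) unfolding linear_tensors_def mem_Collect_eq
  proof (induction v rule: frag_induction)
    case (one w)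
    then obtain g where "g \<in> gens n" "w = [g]" by auto
    then show ?case using winding_cochain_degree[OF assms(2), of "M_C n" "log_arg g"] by simp
  qed (simp_all add: extend_words_diff)
  then show ?thesis by blast
qed

text \<open>All linear combinations are required, since \<open>square_ideal\<close> is generated by
  the squares of every linear tensor. Steenrod's argument asks only for a cocycle concentrated in
  degree one.\<close>

lemma ev_linear_square:
  assumes "v \<in> linear_tensors (gens n)"
  shows "cohomologous (M_C n) (ev n (concat_product v v)) 0"
  using assms cup_square_degree_1[OF ev_cocycle[OF linear_tensors_tensors[OF assms]] ev_linear_degree_1[OF assms]]
  by (simp add: ev_concat_product linear_tensors_tensors)

lemma ev_standard:
  assumes "Poly_Mapping.keys a \<subseteq> standard_words n"
  shows "ev n a = word_combination n (Poly_Mapping.lookup a)"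
  by (rule extend_words_superset[OF finite_standard_words assms])

section \<open>Relations under ring homomorphisms\<close>

lemma (in ring_hom_ring) hom_a_minus: "a \<in> carrier R \<Longrightarrow> b \<in> carrier R \<Longrightarrow> h (a \<ominus> b) = h a \<ominus>\<^bsub>S\<^esub> h b"
  by (simp add: a_minus_def)

context ring_hom_ring
begin

context
  fixes z \<rho> \<eta> :: "nat \<Rightarrow> 'a" and \<alpha> \<beta> :: "nat \<Rightarrow> nat \<Rightarrow> 'a" and n :: nat
  assumes closed: "\<And>i. 1 \<le> i \<Longrightarrow> i \<le> n \<Longrightarrow> z i \<in> carrier R \<and> \<rho> i \<in> carrier R \<and> \<eta> i \<in> carrier R"
    "\<And>i j. 1 \<le> i \<Longrightarrow> i < j \<Longrightarrow> j \<le> n \<Longrightarrow> \<alpha> i j \<in> carrier R \<and> \<beta> i j \<in> carrier R"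
begin

abbreviation "relations_source \<equiv> type_C_relations R z \<rho> \<eta> \<alpha> \<beta> n"
abbreviation "relations_target \<equiv>
  type_C_relations S (\<lambda>i. h (z i)) (\<lambda>i. h (\<rho> i)) (\<lambda>i. h (\<eta> i)) (\<lambda>i j. h (\<alpha> i j)) (\<lambda>i j. h (\<beta> i j)) n"

lemma closed':
  "1 \<le> i \<Longrightarrow> i \<le> n \<Longrightarrow> z i \<in> carrier R" "1 \<le> i \<Longrightarrow> i \<le> n \<Longrightarrow> \<rho> i \<in> carrier R" "1 \<le> i \<Longrightarrow> i \<le> n \<Longrightarrow> \<eta> i \<in> carrier R"
  "1 \<le> i \<Longrightarrow> i < j \<Longrightarrow> j \<le> n \<Longrightarrow> \<alpha> i j \<in> carrier R" "1 \<le> i \<Longrightarrow> i < j \<Longrightarrow> j \<le> n \<Longrightarrow> \<beta> i j \<in> carrier R"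
  using closed by auto

text \<open>The relations are stated in the exterior algebra but computed with in the tensor
  algebra. Being formed by ring operations, they correspond under a homomorphism; the next lemma
  gives the converse inclusion, case by case.\<close>

lemma hom_relations: "y \<in> relations_source \<Longrightarrow> h y \<in> relations_target"
  by (induction rule: type_C_relations.induct; simp add: closed' hom_a_minus; rule type_C_relations.intros; simp)

lemma relations_hom_preimage:
  assumes "x \<in> relations_target"
  shows "\<exists>y\<in>relations_source. x = h y"
proof -
  have "relations_target \<subseteq> h ` relations_source"
  proof
    fix x assume "x \<in> relations_target"
    then show "x \<in> h ` relations_source"
    proof (induction rule: type_C_relations.induct)
      case (1 i) then show ?case
        by (intro image_eqI[OF _ type_C_relations.intros(1)[where i = i]]) (simp_all add: closed' hom_a_minus)
    next
      case (2 i) then show ?case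
        by (intro image_eqI[OF _ type_C_relations.intros(2)[where i = i]]) (simp_all add: closed' hom_a_minus)
    next
      case (3 i) then show ?case
        by (intro image_eqI[OF _ type_C_relations.intros(3)[where i = i]]) (simp_all add: closed' hom_a_minus)
    next
      case (4 i j) then show ?case
        by (intro image_eqI[OF _ type_C_relations.intros(4)[where i = i and j = j]]) (simp_all add: closed' hom_a_minus)
    next
      case (5 i j) then show ?case
        by (intro image_eqI[OF _ type_C_relations.intros(5)[where i = i and j = j]]) (simp_all add: closed' hom_a_minus)
    next
      case (6 i j) then show ?case
        by (intro image_eqI[OF _ type_C_relations.intros(6)[where i = i and j = j]]) (simp_all add: closed' hom_a_minus)
    next
      case (7 i j) then show ?case
        by (intro image_eqI[OF _ type_C_relations.intros(7)[where i = i and j = j]]) (simp_all add: closed' hom_a_minus)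
    next
      case (8 i j) then show ?case
        by (intro image_eqI[OF _ type_C_relations.intros(8)[where i = i and j = j]]) (simp_all add: closed' hom_a_minus)
    next
      case (9 i j) then show ?case
        by (intro image_eqI[OF _ type_C_relations.intros(9)[where i = i and j = j]]) (simp_all add: closed' hom_a_minus)
    next
      case (10 i j) then show ?case
        by (intro image_eqI[OF _ type_C_relations.intros(10)[where i = i and j = j]]) (simp_all add: closed' hom_a_minus)
    next
      case (11 i j k) then show ?case
        by (intro image_eqI[OF _ type_C_relations.intros(11)[where i = i and j = j and k = k]]) (simp_all add: closed' hom_a_minus)
    next
      case (12 i j k) then show ?case
        by (intro image_eqI[OF _ type_C_relations.intros(12)[where i = i and j = j and k = k]]) (simp_all add: closed' hom_a_minus)
    next
      case (13 i j k) then show ?case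
        by (intro image_eqI[OF _ type_C_relations.intros(13)[where i = i and j = j and k = k]]) (simp_all add: closed' hom_a_minus)
    next
      case (14 i j k) then show ?case
        by (intro image_eqI[OF _ type_C_relations.intros(14)[where i = i and j = j and k = k]]) (simp_all add: closed' hom_a_minus)
    qed
  qed
  then show ?thesis using assms by blast
qed

end

end

section \<open>The relations hold in cohomology\<close>

abbreviation gen :: "generator \<Rightarrow> (generator list \<Rightarrow>\<^sub>0 int)" where
  "gen g \<equiv> frag_of [g]"

abbreviation tensor_relations :: "nat \<Rightarrow> (generator list \<Rightarrow>\<^sub>0 int) set" where
  "tensor_relations n \<equiv> type_C_relations (tensor_algebra (gens n))
     (\<lambda>i. gen (Z i)) (\<lambda>i. gen (Rho i)) (\<lambda>i. gen (Eta i)) (\<lambda>i j. gen (Alpha i j)) (\<lambda>i j. gen (Beta i j)) n"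

text \<open>A dictionary between tensors and functions: sums and differences of generators on the
  left match products and quotients of functions on the right.\<close>

definition dlog_of :: "nat \<Rightarrow> (generator list \<Rightarrow>\<^sub>0 int) \<Rightarrow> ((nat \<Rightarrow> complex) \<Rightarrow> complex) \<Rightarrow> bool" where
  "dlog_of n t F \<longleftrightarrow> t \<in> tensors (gens n) \<and> nonvanishing (M_C n) F \<and> cohomologous (M_C n) (ev n t) (winding_cochain (M_C n) F)"

lemma dlog_of_gen: "g \<in> gens n \<Longrightarrow> dlog_of n (gen g) (log_arg g)"
  using gen_cochain_cocycle[of g n] by (simp add: dlog_of_def nonvanishing_log_arg)

lemma dlog_of_add: "dlog_of n s F \<Longrightarrow> dlog_of n t G \<Longrightarrow> dlog_of n (s + t) (\<lambda>x. F x * G x)"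
  unfolding dlog_of_def extend_words_add
  using cohomologous_trans[OF cohomologous_add cohomologous_sym[OF winding_cochain_mult]]
  by (auto intro: nonvanishing_mult)

lemma dlog_of_diff: "dlog_of n s F \<Longrightarrow> dlog_of n t G \<Longrightarrow> dlog_of n (s - t) (\<lambda>x. F x / G x)"
  unfolding dlog_of_def extend_words_diff
  using cohomologous_trans[OF cohomologous_diff cohomologous_sym[OF winding_cochain_divide]]
  by (auto intro: nonvanishing_divide)

text \<open>Reduces a relation to an identity between rational functions: the functions belonging to
  its two factors must differ by a nonzero constant. For each relation that identity comes from
  dividing a linear relation among three divisors by one of them.\<close>

lemma dlog_of_relation:
  assumes "dlog_of n s F" "dlog_of n t G" "k \<noteq> 0" "\<And>x. x \<in> topspace (M_C n) \<Longrightarrow> F x - G x = k"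
  shows "cohomologous (M_C n) (ev n (concat_product s t)) 0"
proof -
  have "cohomologous (M_C n) (cup (M_C n) (ev n s) (ev n t))
      (cup (M_C n) (winding_cochain (M_C n) F) (winding_cochain (M_C n) G))"
    using assms(1,2) by (intro cohomologous_cup winding_cochain_cocycle ev_cocycle) (auto simp: dlog_of_def)
  also have "cohomologous (M_C n) \<dots> 0"
    using assms by (intro steinberg_cup) (auto simp: dlog_of_def)
  finally show ?thesis
    using assms(1,2) by (simp add: dlog_of_def ev_concat_product)
qed

lemma log_arg_nonzero:
  assumes "x \<in> topspace (M_C n)"
  shows "1 \<le> i \<Longrightarrow> i \<le> n \<Longrightarrow> x i \<noteq> 0" "1 \<le> i \<Longrightarrow> i \<le> n \<Longrightarrow> x i - 1 \<noteq> 0" "1 \<le> i \<Longrightarrow> i \<le> n \<Longrightarrow> x i + 1 \<noteq> 0"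
    "1 \<le> i \<Longrightarrow> i < j \<Longrightarrow> j \<le> n \<Longrightarrow> x j - x i \<noteq> 0" "1 \<le> i \<Longrightarrow> i < j \<Longrightarrow> j \<le> n \<Longrightarrow> x i * x j - 1 \<noteq> 0"
  using assms nonvanishing_log_arg[of "Z i" n] nonvanishing_log_arg[of "Rho i" n] nonvanishing_log_arg[of "Eta i" n]
    nonvanishing_log_arg[of "Alpha i j" n] nonvanishing_log_arg[of "Beta i j" n]
  by (auto simp: nonvanishing_def)

lemma tensor_relations_ev:
  assumes "y \<in> tensor_relations n"
  shows "cohomologous (M_C n) (ev n y) 0"
proof -
  define trivial where "trivial y \<longleftrightarrow> cohomologous (M_C n) (ev n y) 0" for y
  have "trivial y"
    using assms
  proof (induction rule: type_C_relations.induct)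
    case (1 i)
    have "cohomologous (M_C n) (ev n (concat_product (gen (Z i)) (gen (Rho i)))) 0"
    proof (rule dlog_of_relation[where k = "1"])
      show "dlog_of n (gen (Z i)) (\<lambda>x. log_arg (Z i) x)"
        "dlog_of n (gen (Rho i)) (\<lambda>x. log_arg (Rho i) x)"
        by (intro dlog_of_diff dlog_of_add dlog_of_gen; use 1 in simp)+
      show "log_arg (Z i) x - log_arg (Rho i) x = 1"
        if "x \<in> topspace (M_C n)" for x
        by simp
    qed simp
    then show ?case using 1 by (simp add: trivial_def)
  next
    case (2 i)
    have "cohomologous (M_C n) (ev n (concat_product (gen (Z i)) (gen (Eta i)))) 0"
    proof (rule dlog_of_relation[where k = "-1"])
      show "dlog_of n (gen (Z i)) (\<lambda>x. log_arg (Z i) x)"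
        "dlog_of n (gen (Eta i)) (\<lambda>x. log_arg (Eta i) x)"
        by (intro dlog_of_diff dlog_of_add dlog_of_gen; use 2 in simp)+
      show "log_arg (Z i) x - log_arg (Eta i) x = -1"
        if "x \<in> topspace (M_C n)" for x
        by simp
    qed simp
    then show ?case using 2 by (simp add: trivial_def)
  next
    case (3 i)
    have "cohomologous (M_C n) (ev n (concat_product (gen (Rho i)) (gen (Eta i)))) 0"
    \<comment> \<open>The constant need not be a unit in the integers; it only locates the second
      puncture of the plane.\<close>
    proof (rule dlog_of_relation[where k = "-2"])
      show "dlog_of n (gen (Rho i)) (\<lambda>x. log_arg (Rho i) x)"
        "dlog_of n (gen (Eta i)) (\<lambda>x. log_arg (Eta i) x)"
        by (intro dlog_of_diff dlog_of_add dlog_of_gen; use 3 in simp)+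
      show "log_arg (Rho i) x - log_arg (Eta i) x = -2"
        if "x \<in> topspace (M_C n)" for x
        by simp
    qed simp
    then show ?case using 3 by (simp add: trivial_def)
  next
    case (4 i j)
    have "cohomologous (M_C n) (ev n (concat_product (gen (Z j) - gen (Z i)) (gen (Alpha i j) - gen (Z i)))) 0"
    proof (rule dlog_of_relation[where k = "1"])
      show "dlog_of n (gen (Z j) - gen (Z i)) (\<lambda>x. log_arg (Z j) x / log_arg (Z i) x)"
        "dlog_of n (gen (Alpha i j) - gen (Z i)) (\<lambda>x. log_arg (Alpha i j) x / log_arg (Z i) x)"
        by (intro dlog_of_diff dlog_of_add dlog_of_gen; use 4 in simp)+
      show "log_arg (Z j) x / log_arg (Z i) x - log_arg (Alpha i j) x / log_arg (Z i) x = 1"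
        if "x \<in> topspace (M_C n)" for x
      proof -
        have "x j - (x j - x i) = x i"
          by (simp add: algebra_simps)
        then show ?thesis
          using log_arg_nonzero(1)[OF that, of i] 4 by (simp only: log_arg.simps flip: diff_divide_distrib) simp
      qed
    qed simp
    then show ?case using 4 by (simp add: trivial_def)
  next
    case (5 i j)
    have "cohomologous (M_C n) (ev n (concat_product (gen (Rho j) - gen (Rho i)) (gen (Alpha i j) - gen (Rho i)))) 0"
    proof (rule dlog_of_relation[where k = "1"])
      show "dlog_of n (gen (Rho j) - gen (Rho i)) (\<lambda>x. log_arg (Rho j) x / log_arg (Rho i) x)"
        "dlog_of n (gen (Alpha i j) - gen (Rho i)) (\<lambda>x. log_arg (Alpha i j) x / log_arg (Rho i) x)"
        by (intro dlog_of_diff dlog_of_add dlog_of_gen; use 5 in simp)+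
      show "log_arg (Rho j) x / log_arg (Rho i) x - log_arg (Alpha i j) x / log_arg (Rho i) x = 1"
        if "x \<in> topspace (M_C n)" for x
      proof -
        have "(x j - 1) - (x j - x i) = x i - 1"
          by (simp add: algebra_simps)
        then show ?thesis
          using log_arg_nonzero(2)[OF that, of i] 5 by (simp only: log_arg.simps flip: diff_divide_distrib) simp
      qed
    qed simp
    then show ?case using 5 by (simp add: trivial_def)
  next
    case (6 i j)
    have "cohomologous (M_C n) (ev n (concat_product (gen (Eta j) - gen (Eta i)) (gen (Alpha i j) - gen (Eta i)))) 0"
    proof (rule dlog_of_relation[where k = "1"])
      show "dlog_of n (gen (Eta j) - gen (Eta i)) (\<lambda>x. log_arg (Eta j) x / log_arg (Eta i) x)"
        "dlog_of n (gen (Alpha i j) - gen (Eta i)) (\<lambda>x. log_arg (Alpha i j) x / log_arg (Eta i) x)"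
        by (intro dlog_of_diff dlog_of_add dlog_of_gen; use 6 in simp)+
      show "log_arg (Eta j) x / log_arg (Eta i) x - log_arg (Alpha i j) x / log_arg (Eta i) x = 1"
        if "x \<in> topspace (M_C n)" for x
      proof -
        have "(x j + 1) - (x j - x i) = x i + 1"
          by (simp add: algebra_simps)
        then show ?thesis
          using log_arg_nonzero(3)[OF that, of i] 6 by (simp only: log_arg.simps flip: diff_divide_distrib) simp
      qed
    qed simp
    then show ?case using 6 by (simp add: trivial_def)
  next
    case (7 i j)
    have "cohomologous (M_C n) (ev n (concat_product (gen (Z j) + gen (Z i)) (gen (Beta i j)))) 0"
    proof (rule dlog_of_relation[where k = "1"])
      show "dlog_of n (gen (Z j) + gen (Z i)) (\<lambda>x. log_arg (Z j) x * log_arg (Z i) x)"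
        "dlog_of n (gen (Beta i j)) (\<lambda>x. log_arg (Beta i j) x)"
        by (intro dlog_of_diff dlog_of_add dlog_of_gen; use 7 in simp)+
      show "log_arg (Z j) x * log_arg (Z i) x - log_arg (Beta i j) x = 1"
        if "x \<in> topspace (M_C n)" for x
        by (simp add: mult.commute)
    qed simp
    then show ?case using 7 by (simp add: trivial_def)
  next
    case (8 i j)
    have "cohomologous (M_C n) (ev n (concat_product (gen (Rho j) + gen (Z i) - gen (Rho i)) (gen (Beta i j) - gen (Rho i)))) 0"
    proof (rule dlog_of_relation[where k = "-1"])
      show "dlog_of n (gen (Rho j) + gen (Z i) - gen (Rho i)) (\<lambda>x. log_arg (Rho j) x * log_arg (Z i) x / log_arg (Rho i) x)"
        "dlog_of n (gen (Beta i j) - gen (Rho i)) (\<lambda>x. log_arg (Beta i j) x / log_arg (Rho i) x)"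
        by (intro dlog_of_diff dlog_of_add dlog_of_gen; use 8 in simp)+
      show "log_arg (Rho j) x * log_arg (Z i) x / log_arg (Rho i) x - log_arg (Beta i j) x / log_arg (Rho i) x = -1"
        if "x \<in> topspace (M_C n)" for x
      proof -
        have "(x j - 1) * x i - (x i * x j - 1) = - (x i - 1)"
          by (simp add: algebra_simps)
        then show ?thesis
          using log_arg_nonzero(2)[OF that, of i] 8 by (simp only: log_arg.simps flip: diff_divide_distrib) (simp add: divide_eq_eq)
      qed
    qed simp
    then show ?case using 8 by (simp add: trivial_def)
  next
    case (9 i j)
    have "cohomologous (M_C n) (ev n (concat_product (gen (Eta j) + gen (Z i) - gen (Eta i)) (gen (Beta i j) - gen (Eta i)))) 0"
    proof (rule dlog_of_relation[where k = 1])
      show "dlog_of n (gen (Eta j) + gen (Z i) - gen (Eta i)) (\<lambda>x. log_arg (Eta j) x * log_arg (Z i) x / log_arg (Eta i) x)"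
        "dlog_of n (gen (Beta i j) - gen (Eta i)) (\<lambda>x. log_arg (Beta i j) x / log_arg (Eta i) x)"
        by (intro dlog_of_diff dlog_of_add dlog_of_gen; use 9 in simp)+
      show "log_arg (Eta j) x * log_arg (Z i) x / log_arg (Eta i) x - log_arg (Beta i j) x / log_arg (Eta i) x = 1"
        if "x \<in> topspace (M_C n)" for x
      proof -
        have "(x j + 1) * x i - (x i * x j - 1) = x i + 1"
          by (simp add: algebra_simps)
        then show ?thesis
          using log_arg_nonzero(3)[OF that, of i] 9 by (simp only: log_arg.simps flip: diff_divide_distrib) simp
      qed
    qed simp
    then show ?case using 9 by (simp add: trivial_def)
  next
    case (10 i j)
    have "cohomologous (M_C n) (ev n (concat_product (gen (Alpha i j) + gen (Z i) - gen (Rho i) - gen (Eta i))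
        (gen (Beta i j) - gen (Rho i) - gen (Eta i)))) 0"
    proof (rule dlog_of_relation[where k = "-1"])
      show "dlog_of n (gen (Alpha i j) + gen (Z i) - gen (Rho i) - gen (Eta i))
          (\<lambda>x. log_arg (Alpha i j) x * log_arg (Z i) x / log_arg (Rho i) x / log_arg (Eta i) x)"
        "dlog_of n (gen (Beta i j) - gen (Rho i) - gen (Eta i)) (\<lambda>x. log_arg (Beta i j) x / log_arg (Rho i) x / log_arg (Eta i) x)"
        by (intro dlog_of_diff dlog_of_add dlog_of_gen; use 10 in simp)+
      show "log_arg (Alpha i j) x * log_arg (Z i) x / log_arg (Rho i) x / log_arg (Eta i) x
          - log_arg (Beta i j) x / log_arg (Rho i) x / log_arg (Eta i) x = -1"
        if "x \<in> topspace (M_C n)" for x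
      proof -
        \<comment> \<open>The third term of the linear relation is the product of two divisors,
          which is why both \<open>Rho i\<close> and \<open>Eta i\<close> are subtracted in each
          factor.\<close>
        have "(x i - 1) * (x i + 1) \<noteq> 0"
          using log_arg_nonzero(2,3)[OF that, of i] 10 by simp
        moreover have "(x j - x i) * x i - (x i * x j - 1) = - ((x i - 1) * (x i + 1))"
          by (simp add: algebra_simps)
        ultimately show ?thesis
          by (simp add: divide_divide_eq_left flip: diff_divide_distrib)
      qed
    qed simp
    then show ?case using 10 by (simp add: trivial_def)
  next
    case (11 i j k)
    have "cohomologous (M_C n) (ev n (concat_product (gen (Alpha i k) - gen (Alpha i j)) (gen (Alpha j k) - gen (Alpha i j)))) 0"
    proof (rule dlog_of_relation[where k = 1])
      show "dlog_of n (gen (Alpha i k) - gen (Alpha i j)) (\<lambda>x. log_arg (Alpha i k) x / log_arg (Alpha i j) x)"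
        "dlog_of n (gen (Alpha j k) - gen (Alpha i j)) (\<lambda>x. log_arg (Alpha j k) x / log_arg (Alpha i j) x)"
        by (intro dlog_of_diff dlog_of_add dlog_of_gen; use 11 in simp)+
      show "log_arg (Alpha i k) x / log_arg (Alpha i j) x - log_arg (Alpha j k) x / log_arg (Alpha i j) x = 1"
        if "x \<in> topspace (M_C n)" for x
        using log_arg_nonzero(4)[OF that, of i j] 11 by (simp flip: diff_divide_distrib)
    qed simp
    then show ?case using 11 by (simp add: trivial_def)
  next
    case (12 i j k)
    have "cohomologous (M_C n) (ev n (concat_product (gen (Alpha i k) + gen (Z j) - gen (Beta i j)) (gen (Beta j k) - gen (Beta i j)))) 0"
    proof (rule dlog_of_relation[where k = "-1"])
      show "dlog_of n (gen (Alpha i k) + gen (Z j) - gen (Beta i j)) (\<lambda>x. log_arg (Alpha i k) x * log_arg (Z j) x / log_arg (Beta i j) x)"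
        "dlog_of n (gen (Beta j k) - gen (Beta i j)) (\<lambda>x. log_arg (Beta j k) x / log_arg (Beta i j) x)"
        by (intro dlog_of_diff dlog_of_add dlog_of_gen; use 12 in simp)+
      show "log_arg (Alpha i k) x * log_arg (Z j) x / log_arg (Beta i j) x - log_arg (Beta j k) x / log_arg (Beta i j) x = -1"
        if "x \<in> topspace (M_C n)" for x
      proof -
        have "(x k - x i) * x j - (x j * x k - 1) = - (x i * x j - 1)"
          by (simp add: algebra_simps)
        then show ?thesis
          using log_arg_nonzero(5)[OF that, of i j] 12 by (simp only: log_arg.simps flip: diff_divide_distrib) (simp add: divide_eq_eq)
      qed
    qed simp
    then show ?case using 12 by (simp add: trivial_def)
  next
    case (13 i j k)
    have "cohomologous (M_C n) (ev n (concat_product (gen (Beta i k) - gen (Beta i j)) (gen (Alpha j k) + gen (Z i) - gen (Beta i j)))) 0"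
    proof (rule dlog_of_relation[where k = 1])
      show "dlog_of n (gen (Beta i k) - gen (Beta i j)) (\<lambda>x. log_arg (Beta i k) x / log_arg (Beta i j) x)"
        "dlog_of n (gen (Alpha j k) + gen (Z i) - gen (Beta i j)) (\<lambda>x. log_arg (Alpha j k) x * log_arg (Z i) x / log_arg (Beta i j) x)"
        by (intro dlog_of_diff dlog_of_add dlog_of_gen; use 13 in simp)+
      show "log_arg (Beta i k) x / log_arg (Beta i j) x - log_arg (Alpha j k) x * log_arg (Z i) x / log_arg (Beta i j) x = 1"
        if "x \<in> topspace (M_C n)" for x
      proof -
        have "(x i * x k - 1) - (x k - x j) * x i = x i * x j - 1"
          by (simp add: algebra_simps)
        then show ?thesis
          using log_arg_nonzero(5)[OF that, of i j] 13 by (simp only: log_arg.simps flip: diff_divide_distrib) simp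
      qed
    qed simp
    then show ?case using 13 by (simp add: trivial_def)
  next
    case (14 i j k)
    have "cohomologous (M_C n) (ev n (concat_product (gen (Beta i k) + gen (Z j) - gen (Alpha i j)) (gen (Beta j k) + gen (Z i) - gen (Alpha i j)))) 0"
    proof (rule dlog_of_relation[where k = "-1"])
      show "dlog_of n (gen (Beta i k) + gen (Z j) - gen (Alpha i j)) (\<lambda>x. log_arg (Beta i k) x * log_arg (Z j) x / log_arg (Alpha i j) x)"
        "dlog_of n (gen (Beta j k) + gen (Z i) - gen (Alpha i j)) (\<lambda>x. log_arg (Beta j k) x * log_arg (Z i) x / log_arg (Alpha i j) x)"
        by (intro dlog_of_diff dlog_of_add dlog_of_gen; use 14 in simp)+
      show "log_arg (Beta i k) x * log_arg (Z j) x / log_arg (Alpha i j) x - log_arg (Beta j k) x * log_arg (Z i) x / log_arg (Alpha i j) x = -1"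
        if "x \<in> topspace (M_C n)" for x
      proof -
        \<comment> \<open>Multiplying by \<open>x j\<close> and \<open>x i\<close> cancels the cubic
          terms. These multipliers are the origin of the summands \<open>Z j\<close> and
          \<open>Z i\<close> in the relation.\<close>
        have "(x i * x k - 1) * x j - (x j * x k - 1) * x i = - (x j - x i)"
          by (simp add: algebra_simps)
        then show ?thesis
          using log_arg_nonzero(4)[OF that, of i j] 14 by (simp only: log_arg.simps flip: diff_divide_distrib) (simp add: divide_eq_eq)
      qed
    qed simp
    then show ?case using 14 by (simp add: trivial_def)
  qed
  then show ?thesis by (simp add: trivial_def)
qed

section \<open>The ideal of relations, in the exterior and in the tensor algebra\<close>

definition exterior_proj :: "'g set \<Rightarrow> ('g list \<Rightarrow>\<^sub>0 int) \<Rightarrow> ('g list \<Rightarrow>\<^sub>0 int) set" where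
  "exterior_proj S t = square_ideal S +>\<^bsub>tensor_algebra S\<^esub> t"

lemma square_ideal_eq:
  "square_ideal S = genideal (tensor_algebra S) ((\<lambda>v. concat_product v v) ` linear_tensors S)"
  unfolding square_ideal_def linear_tensors_def mult_tensor_algebra
  by (rule arg_cong[of _ _ "genideal (tensor_algebra S)"]) blast

lemma squares_subset: "(\<lambda>v. concat_product v v) ` linear_tensors S \<subseteq> carrier (tensor_algebra S)"
  by (auto simp: linear_tensors_tensors)

lemma ideal_square_ideal: "ideal (square_ideal S) (tensor_algebra S)"
  unfolding square_ideal_eq by (rule ring.genideal_ideal[OF ring_tensor_algebra squares_subset])

lemma square_in_ideal: "v \<in> linear_tensors S \<Longrightarrow> concat_product v v \<in> square_ideal S"
  unfolding square_ideal_eq using ring.genideal_self[OF ring_tensor_algebra squares_subset] by blast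

lemma ring_hom_exterior_proj: "ring_hom_ring (tensor_algebra S) (exterior_algebra S) (exterior_proj S)"
  unfolding exterior_algebra_def exterior_proj_def
  by (rule ideal.rcos_ring_hom_ring[OF ideal_square_ideal])

lemma carrier_exterior_algebra: "carrier (exterior_algebra S) = exterior_proj S ` tensors S"
  by (auto simp: exterior_algebra_def exterior_proj_def FactRing_def A_RCOSETS_defs a_r_coset_def)

lemma I_C_eq: "I_C n = genideal (E_C n) (type_C_relations (E_C n)
    (\<lambda>i. exterior_proj (gens n) (gen (Z i))) (\<lambda>i. exterior_proj (gens n) (gen (Rho i)))
    (\<lambda>i. exterior_proj (gens n) (gen (Eta i))) (\<lambda>i j. exterior_proj (gens n) (gen (Alpha i j)))
    (\<lambda>i j. exterior_proj (gens n) (gen (Beta i j))) n)"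
  by (simp add: I_C_def E_gen_def exterior_gen_def exterior_proj_def)

lemma ring_E_C: "ring (E_C n)"
  using ring_hom_exterior_proj[of "gens n"] by (simp add: E_C_def ring_hom_ring_def)

abbreviation exterior_relations :: "nat \<Rightarrow> (generator list \<Rightarrow>\<^sub>0 int) set set" where
  "exterior_relations n \<equiv> type_C_relations (E_C n)
    (\<lambda>i. exterior_proj (gens n) (gen (Z i))) (\<lambda>i. exterior_proj (gens n) (gen (Rho i)))
    (\<lambda>i. exterior_proj (gens n) (gen (Eta i))) (\<lambda>i j. exterior_proj (gens n) (gen (Alpha i j)))
    (\<lambda>i j. exterior_proj (gens n) (gen (Beta i j))) n"

lemma exterior_relations_eq: "exterior_relations n = exterior_proj (gens n) ` tensor_relations n"
proof -
  interpret ring_hom_ring "tensor_algebra (gens n)" "E_C n" "exterior_proj (gens n)"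
    unfolding E_C_def by (rule ring_hom_exterior_proj)
  have "\<And>i. 1 \<le> i \<Longrightarrow> i \<le> n \<Longrightarrow> gen (Z i) \<in> carrier (tensor_algebra (gens n)) \<and>
      gen (Rho i) \<in> carrier (tensor_algebra (gens n)) \<and> gen (Eta i) \<in> carrier (tensor_algebra (gens n))"
    "\<And>i j. 1 \<le> i \<Longrightarrow> i < j \<Longrightarrow> j \<le> n \<Longrightarrow> gen (Alpha i j) \<in> carrier (tensor_algebra (gens n)) \<and>
      gen (Beta i j) \<in> carrier (tensor_algebra (gens n))"
    by auto
  note hom_relations[where z = "\<lambda>i. gen (Z i)" and \<rho> = "\<lambda>i. gen (Rho i)" and \<eta> = "\<lambda>i. gen (Eta i)"
        and \<alpha> = "\<lambda>i j. gen (Alpha i j)" and \<beta> = "\<lambda>i j. gen (Beta i j)" and n = n, OF this]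
    and relations_hom_preimage[where z = "\<lambda>i. gen (Z i)" and \<rho> = "\<lambda>i. gen (Rho i)" and \<eta> = "\<lambda>i. gen (Eta i)"
        and \<alpha> = "\<lambda>i j. gen (Alpha i j)" and \<beta> = "\<lambda>i j. gen (Beta i j)" and n = n, OF this]
  then show ?thesis
    by blast
qed

lemma tensor_relations_closed: "tensor_relations n \<subseteq> tensors (gens n)"
proof
  fix y assume "y \<in> tensor_relations n"
  then show "y \<in> tensors (gens n)"
    by (induction rule: type_C_relations.induct) auto
qed

lemma carrier_E_C: "carrier (E_C n) = exterior_proj (gens n) ` tensors (gens n)"
  by (simp add: E_C_def carrier_exterior_algebra)

lemma exterior_relations_closed: "exterior_relations n \<subseteq> carrier (E_C n)"
  unfolding exterior_relations_eq carrier_E_C by (rule image_mono[OF tensor_relations_closed])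

lemma ideal_I_C: "ideal (I_C n) (E_C n)"
  unfolding I_C_eq
  by (rule ring.genideal_ideal[OF ring_E_C exterior_relations_closed])

text \<open>The preimage of \<open>I_C n\<close> in the tensor algebra. Words can then be rewritten
  as honest integral combinations of lists, with no cosets of cosets.\<close>

definition relation_ideal :: "nat \<Rightarrow> (generator list \<Rightarrow>\<^sub>0 int) set" where
  "relation_ideal n = {t \<in> tensors (gens n). exterior_proj (gens n) t \<in> I_C n}"

lemma ideal_relation_ideal: "ideal (relation_ideal n) (tensor_algebra (gens n))"
proof -
  interpret ring_hom_ring "tensor_algebra (gens n)" "E_C n" "exterior_proj (gens n)"
    unfolding E_C_def by (rule ring_hom_exterior_proj)
  show ?thesis
    using ideal_vimage[OF ideal_I_C] by (simp add: relation_ideal_def)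
qed

lemma relation_ideal_tensors: "t \<in> relation_ideal n \<Longrightarrow> t \<in> tensors (gens n)"
  by (simp add: relation_ideal_def)

lemma relation_ideal_0: "0 \<in> relation_ideal n"
  using additive_subgroup.zero_closed[OF ideal.axioms(1)[OF ideal_relation_ideal]] by simp

lemma relation_ideal_add: "s \<in> relation_ideal n \<Longrightarrow> t \<in> relation_ideal n \<Longrightarrow> s + t \<in> relation_ideal n"
  using additive_subgroup.a_closed[OF ideal.axioms(1)[OF ideal_relation_ideal[of n]], of s t] by simp

lemma relation_ideal_uminus: "t \<in> relation_ideal n \<Longrightarrow> - t \<in> relation_ideal n"
proof -
  assume t: "t \<in> relation_ideal n"
  show ?thesis
    using additive_subgroup.a_inv_closed[OF ideal.axioms(1)[OF ideal_relation_ideal] t] relation_ideal_tensors[OF t] by simp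
qed

lemma relation_ideal_diff: "s \<in> relation_ideal n \<Longrightarrow> t \<in> relation_ideal n \<Longrightarrow> s - t \<in> relation_ideal n"
  using relation_ideal_add[of s n "- t"] relation_ideal_uminus by simp

lemma relation_ideal_concat_left:
  "s \<in> tensors (gens n) \<Longrightarrow> t \<in> relation_ideal n \<Longrightarrow> concat_product s t \<in> relation_ideal n"
  using ideal.I_l_closed[OF ideal_relation_ideal[of n], of t s] by simp

lemma relation_ideal_concat_right:
  "s \<in> tensors (gens n) \<Longrightarrow> t \<in> relation_ideal n \<Longrightarrow> concat_product t s \<in> relation_ideal n"
  using ideal.I_r_closed[OF ideal_relation_ideal[of n], of t s] by simp

lemma relation_ideal_square:
  assumes "v \<in> linear_tensors (gens n)"
  shows "concat_product v v \<in> relation_ideal n"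
proof -
  interpret T: ring "tensor_algebra (gens n)" by (rule ring_tensor_algebra)
  interpret ideal "square_ideal (gens n)" "tensor_algebra (gens n)" by (rule ideal_square_ideal)
  have "exterior_proj (gens n) (concat_product v v) = square_ideal (gens n)"
    unfolding exterior_proj_def using square_in_ideal[OF assms] by (rule a_rcos_const)
  also have "\<dots> = \<zero>\<^bsub>E_C n\<^esub>"
    by (simp add: E_C_def exterior_algebra_def FactRing_def)
  also have "\<dots> \<in> I_C n"
    by (rule additive_subgroup.zero_closed[OF ideal.axioms(1)[OF ideal_I_C]])
  finally show ?thesis
    using linear_tensors_tensors[OF assms] by (simp add: relation_ideal_def)
qed

text \<open>Polarisation: expand the square of \<open>u + v\<close> and remove the two
  squares.\<close>

lemma relation_ideal_anticommute:
  assumes "u \<in> linear_tensors (gens n)" "v \<in> linear_tensors (gens n)"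
  shows "concat_product u v + concat_product v u \<in> relation_ideal n"
proof -
  have "concat_product (u + v) (u + v) - concat_product u u - concat_product v v \<in> relation_ideal n"
    using assms by (intro relation_ideal_diff relation_ideal_square linear_tensors_add)
  then show ?thesis
    by (simp add: concat_product_add_left concat_product_add_right algebra_simps)
qed

lemma tensor_relations_in_ideal:
  assumes "y \<in> tensor_relations n"
  shows "y \<in> relation_ideal n"
proof -
  have "exterior_proj (gens n) y \<in> exterior_relations n"
    using assms unfolding exterior_relations_eq by blast
  moreover have "exterior_relations n \<subseteq> I_C n"
    unfolding I_C_eq
    by (rule ring.genideal_self[OF ring_E_C exterior_relations_closed])
  ultimately show ?thesis
    using assms tensor_relations_closed by (auto simp: relation_ideal_def)
qed

section \<open>Reduction to standard words\<close>

text \<open>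
  The product of two generators of the same level can be rewritten with at most one generator of
  that level per word.
\<close>

definition reducible :: "nat \<Rightarrow> nat \<Rightarrow> generator \<Rightarrow> generator \<Rightarrow> bool" where
  "reducible n m g h \<longleftrightarrow> (\<exists>u\<in>linear_tensors (gens m). \<exists>v\<in>linear_tensors (gens m).
     concat_product (gen g + u) (gen h + v) \<in> relation_ideal n)"

lemma reducibleI:
  "concat_product (gen g + u) (gen h + v) \<in> tensor_relations n \<Longrightarrow>
   u \<in> linear_tensors (gens m) \<Longrightarrow> v \<in> linear_tensors (gens m) \<Longrightarrow> reducible n m g h"
  unfolding reducible_def using tensor_relations_in_ideal by blast

text \<open>The two orders of the product differ in sign modulo the ideal, so subtracting one from
  the anticommutator leaves the other.\<close>

lemma reducible_sym:
  assumes "reducible n m g h" "g \<in> gens n" "h \<in> gens n" "m \<le> n"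
  shows "reducible n m h g"
proof -
  obtain u v where u: "u \<in> linear_tensors (gens m)" and v: "v \<in> linear_tensors (gens m)"
    and *: "concat_product (gen g + u) (gen h + v) \<in> relation_ideal n"
    using assms(1) by (auto simp: reducible_def)
  have "u \<in> linear_tensors (gens n)" "v \<in> linear_tensors (gens n)"
    using u v linear_tensors_mono gens_mono[OF assms(4)] by blast+
  then have "concat_product (gen g + u) (gen h + v) + concat_product (gen h + v) (gen g + u) \<in> relation_ideal n"
    using assms(2,3) by (intro relation_ideal_anticommute) auto
  from relation_ideal_diff[OF this *] show ?thesis
    unfolding reducible_def using u v by auto
qed

text \<open>Each relation is read with its largest index equal to \<open>Suc m\<close>. In both
  factors the first term is then a generator of top level and the remaining terms have level at most
  \<open>m\<close>; these are the \<open>u\<close> and \<open>v\<close>.\<close>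

lemma reducible_level:
  assumes "Suc m \<le> n" "1 \<le> i" "i \<le> m"
  shows "reducible n m (Z (Suc m)) (Alpha i (Suc m))" "reducible n m (Rho (Suc m)) (Alpha i (Suc m))"
    "reducible n m (Eta (Suc m)) (Alpha i (Suc m))" "reducible n m (Z (Suc m)) (Beta i (Suc m))"
    "reducible n m (Rho (Suc m)) (Beta i (Suc m))" "reducible n m (Eta (Suc m)) (Beta i (Suc m))"
    "reducible n m (Alpha i (Suc m)) (Beta i (Suc m))"
proof -
  let ?T = "tensor_algebra (gens n)"
  note R = type_C_relations.intros(4-10)[where R = ?T and z = "\<lambda>i. gen (Z i)" and \<rho> = "\<lambda>i. gen (Rho i)"
      and \<eta> = "\<lambda>i. gen (Eta i)" and \<alpha> = "\<lambda>i j. gen (Alpha i j)" and \<beta> = "\<lambda>i j. gen (Beta i j)" and n = n and i = i and j = "Suc m"]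
  show "reducible n m (Z (Suc m)) (Alpha i (Suc m))"
    by (rule reducibleI[where u = "- gen (Z i)" and v = "- gen (Z i)"]) (use R(1) assms in simp_all)
  show "reducible n m (Rho (Suc m)) (Alpha i (Suc m))"
    by (rule reducibleI[where u = "- gen (Rho i)" and v = "- gen (Rho i)"]) (use R(2) assms in simp_all)
  show "reducible n m (Eta (Suc m)) (Alpha i (Suc m))"
    by (rule reducibleI[where u = "- gen (Eta i)" and v = "- gen (Eta i)"]) (use R(3) assms in simp_all)
  show "reducible n m (Z (Suc m)) (Beta i (Suc m))"
    by (rule reducibleI[where u = "gen (Z i)" and v = "0"]) (use R(4) assms in simp_all)
  show "reducible n m (Rho (Suc m)) (Beta i (Suc m))"
    by (rule reducibleI[where u = "gen (Z i) - gen (Rho i)" and v = "- gen (Rho i)"])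
      (use R(5) assms in \<open>simp_all add: algebra_simps\<close>)
  show "reducible n m (Eta (Suc m)) (Beta i (Suc m))"
    by (rule reducibleI[where u = "gen (Z i) - gen (Eta i)" and v = "- gen (Eta i)"])
      (use R(6) assms in \<open>simp_all add: algebra_simps\<close>)
  show "reducible n m (Alpha i (Suc m)) (Beta i (Suc m))"
    by (rule reducibleI[where u = "gen (Z i) - gen (Rho i) - gen (Eta i)" and v = "- gen (Rho i) - gen (Eta i)"])
      (use R(7) assms in \<open>simp_all add: algebra_simps\<close>)
qed

lemma reducible_base:
  assumes "Suc m \<le> n"
  shows "reducible n m (Z (Suc m)) (Rho (Suc m))" "reducible n m (Z (Suc m)) (Eta (Suc m))"
    "reducible n m (Rho (Suc m)) (Eta (Suc m))"
proof -
  let ?T = "tensor_algebra (gens n)"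
  note R = type_C_relations.intros(1-3)[where R = ?T and z = "\<lambda>i. gen (Z i)" and \<rho> = "\<lambda>i. gen (Rho i)"
      and \<eta> = "\<lambda>i. gen (Eta i)" and \<alpha> = "\<lambda>i j. gen (Alpha i j)" and \<beta> = "\<lambda>i j. gen (Beta i j)" and n = n and i = "Suc m"]
  show "reducible n m (Z (Suc m)) (Rho (Suc m))"
    by (rule reducibleI[where u = 0 and v = 0]) (use R(1) assms in simp_all)
  show "reducible n m (Z (Suc m)) (Eta (Suc m))"
    by (rule reducibleI[where u = 0 and v = 0]) (use R(2) assms in simp_all)
  show "reducible n m (Rho (Suc m)) (Eta (Suc m))"
    by (rule reducibleI[where u = 0 and v = 0]) (use R(3) assms in simp_all)
qed

lemma reducible_pair:
  assumes "Suc m \<le> n" "1 \<le> i" "i < j" "j \<le> m"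
  shows "reducible n m (Alpha i (Suc m)) (Alpha j (Suc m))" "reducible n m (Alpha i (Suc m)) (Beta j (Suc m))"
    "reducible n m (Beta i (Suc m)) (Alpha j (Suc m))" "reducible n m (Beta i (Suc m)) (Beta j (Suc m))"
proof -
  let ?T = "tensor_algebra (gens n)"
  note R = type_C_relations.intros(11-14)[where R = ?T and z = "\<lambda>i. gen (Z i)" and \<rho> = "\<lambda>i. gen (Rho i)"
      and \<eta> = "\<lambda>i. gen (Eta i)" and \<alpha> = "\<lambda>i j. gen (Alpha i j)" and \<beta> = "\<lambda>i j. gen (Beta i j)"
      and n = n and i = i and j = j and k = "Suc m"]
  show "reducible n m (Alpha i (Suc m)) (Alpha j (Suc m))"
    by (rule reducibleI[where u = "- gen (Alpha i j)" and v = "- gen (Alpha i j)"]) (use R(1) assms in simp_all)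
  show "reducible n m (Alpha i (Suc m)) (Beta j (Suc m))"
    by (rule reducibleI[where u = "gen (Z j) - gen (Beta i j)" and v = "- gen (Beta i j)"])
      (use R(2) assms in \<open>simp_all add: algebra_simps\<close>)
  show "reducible n m (Beta i (Suc m)) (Alpha j (Suc m))"
    by (rule reducibleI[where u = "- gen (Beta i j)" and v = "gen (Z i) - gen (Beta i j)"])
      (use R(3) assms in \<open>simp_all add: algebra_simps\<close>)
  show "reducible n m (Beta i (Suc m)) (Beta j (Suc m))"
    by (rule reducibleI[where u = "gen (Z j) - gen (Alpha i j)" and v = "gen (Z i) - gen (Alpha i j)"])
      (use R(4) assms in \<open>simp_all add: algebra_simps\<close>)
qed

text \<open>The relations treat every unordered pair of distinct generators of one level once; the
  opposite order comes from symmetry. This completeness of the list is what limits a word to one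
  generator per level.\<close>

lemma level_gens_reducible:
  assumes m: "Suc m \<le> n" and g: "g \<in> level_gens (Suc m)" and h: "h \<in> level_gens (Suc m)" and neq: "g \<noteq> h"
  shows "reducible n m g h"
proof -
  have gens: "g \<in> gens n" "h \<in> gens n"
    using g h level_gens_subset gens_mono[OF m] by blast+
  have sym: "reducible n m g h" if "reducible n m h g"
    using reducible_sym[OF that gens(2,1)] m by simp
  note red = reducible_base[OF m] reducible_level[OF m]
  show ?thesis
    using g
  proof (cases rule: level_gens_cases)
    case g: 1
    show ?thesis using h by (cases rule: level_gens_cases) (use neq red in \<open>simp_all add: g\<close>)
  next
    case g: 2
    show ?thesis
      using h by (cases rule: level_gens_cases) (use neq red sym in \<open>simp_all add: g\<close>)
  next
    case g: 3
    show ?thesis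
      using h by (cases rule: level_gens_cases) (use neq red sym in \<open>simp_all add: g\<close>)
  next
    case g: (4 i)
    show ?thesis
      using h
    proof (cases rule: level_gens_cases)
      case h: (4 j)
      show ?thesis
        using neq g h sym reducible_pair(1)[OF m, of i j] reducible_pair(1)[OF m, of j i] by (cases i j rule: linorder_cases) auto
    next
      case h: (5 j)
      show ?thesis
        using neq g h sym red reducible_pair(2)[OF m, of i j] reducible_pair(3)[OF m, of j i] by (cases i j rule: linorder_cases) auto
    qed (use g red sym in simp_all)
  next
    case g: (5 i)
    show ?thesis
      using h
    proof (cases rule: level_gens_cases)
      case h: (4 j)
      show ?thesis
        using neq g h sym red reducible_pair(3)[OF m, of i j] reducible_pair(2)[OF m, of j i] by (cases i j rule: linorder_cases) auto
    next
      case h: (5 j)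
      show ?thesis
        using neq g h sym reducible_pair(4)[OF m, of i j] reducible_pair(4)[OF m, of j i] by (cases i j rule: linorder_cases) auto
    qed (use g red sym in simp_all)
  qed
qed

text \<open>The bound \<open>m\<close> on the levels is separate from \<open>n\<close>: the
  induction raises \<open>m\<close> while all congruences are taken modulo one fixed ideal.\<close>

definition standard_span :: "nat \<Rightarrow> nat \<Rightarrow> (generator list \<Rightarrow>\<^sub>0 int) set" where
  "standard_span n m = {t \<in> tensors (gens n). \<exists>s. Poly_Mapping.keys s \<subseteq> standard_words m \<and> t - s \<in> relation_ideal n}"

lemma standard_span_diff:
  assumes "s \<in> standard_span n m" "t \<in> standard_span n m"
  shows "s - t \<in> standard_span n m"
proof -
  obtain s' t' where "Poly_Mapping.keys s' \<subseteq> standard_words m" "s - s' \<in> relation_ideal n"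
    "Poly_Mapping.keys t' \<subseteq> standard_words m" "t - t' \<in> relation_ideal n"
    using assms by (auto simp: standard_span_def)
  moreover from this have "(s - t) - (s' - t') \<in> relation_ideal n"
    using relation_ideal_diff[of "s - s'" n "t - t'"] by (simp add: algebra_simps)
  ultimately show ?thesis
    using assms keys_diff[of s' t'] unfolding standard_span_def
    by (auto intro!: exI[of _ "s' - t'"])
qed

lemma standard_span_0: "0 \<in> standard_span n m"
  by (auto simp: standard_span_def relation_ideal_0 intro!: exI[of _ 0])

lemma standard_span_uminus: "t \<in> standard_span n m \<Longrightarrow> - t \<in> standard_span n m"
  using standard_span_diff[OF standard_span_0] by fastforce

lemma standard_span_cong:
  assumes "s \<in> standard_span n m" "t - s \<in> relation_ideal n"
  shows "t \<in> standard_span n m"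
proof -
  obtain s' where s': "Poly_Mapping.keys s' \<subseteq> standard_words m" "s - s' \<in> relation_ideal n" and s: "s \<in> tensors (gens n)"
    using assms(1) by (auto simp: standard_span_def)
  have "t - s' \<in> relation_ideal n"
    using relation_ideal_add[OF assms(2) s'(2)] by simp
  moreover have "t \<in> tensors (gens n)"
    using tensors_add[OF relation_ideal_tensors[OF assms(2)] s] by simp
  ultimately show ?thesis
    using s'(1) by (auto simp: standard_span_def)
qed

lemma standard_span_relation: "t \<in> relation_ideal n \<Longrightarrow> t \<in> standard_span n m"
  using standard_span_cong[OF standard_span_0] by simp

lemma standard_span_word:
  assumes "w \<in> standard_words m" "m \<le> n"
  shows "frag_of w \<in> standard_span n m"
  using assms standard_words_gens[OF assms(1)] gens_mono[OF assms(2)]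
  by (auto simp: standard_span_def relation_ideal_0 intro!: exI[of _ "frag_of w"])

lemma standard_span_mono: "standard_span n m \<subseteq> standard_span n (Suc m)"
  by (auto simp: standard_span_def)

lemma standard_span_top:
  assumes "Suc m \<le> n" "g \<in> level_gens (Suc m)" "t \<in> standard_span n m"
  shows "concat_product (gen g) t \<in> standard_span n (Suc m)"
proof -
  have g: "gen g \<in> tensors (gens n)"
    using assms(2) level_gens_subset gens_mono[OF assms(1)] by auto
  obtain s where s: "Poly_Mapping.keys s \<subseteq> standard_words m" "t - s \<in> relation_ideal n"
    using assms(3) by (auto simp: standard_span_def)
  have "Poly_Mapping.keys (concat_product (gen g) s) \<subseteq> standard_words (Suc m)"
  proof
    fix w assume "w \<in> Poly_Mapping.keys (concat_product (gen g) s)"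
    then obtain w' where "w' \<in> Poly_Mapping.keys s" "w = g # w'"
      using keys_frag_extend[of "\<lambda>w. frag_of (g # w)" s] by (auto simp: concat_product_def)
    then show "w \<in> standard_words (Suc m)"
      using s(1) assms(2) by force
  qed
  moreover have "concat_product (gen g) t - concat_product (gen g) s \<in> relation_ideal n"
    using relation_ideal_concat_left[OF g s(2)] by (simp add: concat_product_diff_right)
  ultimately show ?thesis
    using g assms(3) by (auto simp: standard_span_def)
qed

text \<open>Induction on the level bound. Multiplying a word that starts with a top generator
  \<open>h\<close> by \<open>g\<close> leaves three cases: a lower \<open>g\<close> is moved past
  \<open>h\<close> by anticommutation, \<open>g = h\<close> gives a square, and a different
  \<open>g\<close> of the same level is rewritten by a relation. In all cases the induction
  hypothesis handles the lower factors.\<close>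

lemma standard_span_mult:
  assumes "m \<le> n" "g \<in> gens m" "t \<in> standard_span n m"
  shows "concat_product (gen g) t \<in> standard_span n m"
  using assms
proof (induction m arbitrary: g t)
  case 0
  then show ?case by (simp add: gens_0)
next
  case (Suc m)
  have gens: "gens m \<subseteq> gens n"
    using Suc.prems(1) by (intro gens_mono) simp
  have gn: "gen g \<in> tensors (gens n)" "gen g \<in> linear_tensors (gens n)"
    using Suc.prems(2) gens_mono[OF Suc.prems(1)] by auto
  have lin: "concat_product u s \<in> standard_span n m" if u: "u \<in> linear_tensors (gens m)" and s: "s \<in> standard_span n m" for u s
    using u unfolding linear_tensors_def mem_Collect_eq
  proof (induction u rule: frag_induction)
    case (one w)
    then obtain l where "l \<in> gens m" "w = [l]" by auto
    then show ?case using Suc.IH[OF _ _ s] Suc.prems(1) by simp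
  next
    case (diff a b)
    then show ?case by (simp add: concat_product_diff_left standard_span_diff)
  qed (simp add: standard_span_0)
  have word: "concat_product (gen g) (frag_of w) \<in> standard_span n (Suc m)" if w: "w \<in> standard_words (Suc m)" for w
  proof (cases "w \<in> standard_words m")
    case True
    then have ws: "frag_of w \<in> standard_span n m"
      using Suc.prems(1) by (intro standard_span_word) auto
    show ?thesis
    proof (cases "g \<in> gens m")
      case True
      then show ?thesis
        using lin[OF _ ws, of "gen g"] standard_span_mono by auto
    next
      case False
      then show ?thesis
        using Suc.prems standard_span_top[OF _ _ ws] by (auto simp: gens_Suc)
    qed
  next
    case False
    then obtain h w' where h: "h \<in> level_gens (Suc m)" and w': "w' \<in> standard_words m" and w: "w = h # w'"
      using w by auto
    have hn: "gen h \<in> tensors (gens n)" "gen h \<in> linear_tensors (gens n)"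
      using h level_gens_subset gens_mono[OF Suc.prems(1)] by auto
    have ws: "frag_of w' \<in> standard_span n m"
      using Suc.prems(1) w' by (intro standard_span_word) auto
    have wn: "frag_of w' \<in> tensors (gens n)"
      using standard_words_gens[OF w'] gens by auto
    have eq: "concat_product (gen g) (frag_of w) = concat_product (concat_product (gen g) (gen h)) (frag_of w')"
      by (simp add: w)
    consider "g \<in> gens m" | "g = h" | "g \<in> level_gens (Suc m)" "g \<noteq> h"
      using Suc.prems(2) by (auto simp: gens_Suc)
    then show ?thesis
    proof cases
      case 1
      have "- concat_product (gen h) (concat_product (gen g) (frag_of w')) \<in> standard_span n (Suc m)"
        using lin[OF _ ws, of "gen g"] 1 h Suc.prems(1) by (intro standard_span_uminus standard_span_top) auto
      moreover have "concat_product (concat_product (gen g) (gen h) + concat_product (gen h) (gen g)) (frag_of w') \<in> relation_ideal n"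
        by (intro relation_ideal_concat_right relation_ideal_anticommute gn hn wn)
      ultimately show ?thesis
        unfolding eq by (elim standard_span_cong) (simp add: concat_product_add_left concat_product_assoc)
    next
      case 2
      have "concat_product (concat_product (gen g) (gen h)) (frag_of w') \<in> relation_ideal n"
        unfolding 2 by (intro relation_ideal_concat_right relation_ideal_square hn wn)
      then show ?thesis
        unfolding eq by (rule standard_span_relation)
    next
      case 3
      obtain u v where u: "u \<in> linear_tensors (gens m)" and v: "v \<in> linear_tensors (gens m)"
        and rel: "concat_product (gen g + u) (gen h + v) \<in> relation_ideal n"
        using level_gens_reducible[OF Suc.prems(1) 3(1) h 3(2)] by (auto simp: reducible_def)
      have un: "u \<in> linear_tensors (gens n)"
        by (rule linear_tensors_mono[OF u gens])
      let ?w = "frag_of w'"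
      \<comment> \<open>Expanding the relation gives \<open>g h = - g v - u h - u v\<close> modulo
        the ideal. The term with \<open>u h\<close> is replaced by minus \<open>h u\<close>, so that
        the top generator stands first and everything behind it is of lower level.\<close>
      let ?r = "concat_product (gen h) (concat_product u ?w) - concat_product (gen g) (concat_product v ?w)
          - concat_product u (concat_product v ?w)"
      have A: "?r \<in> standard_span n (Suc m)"
        using lin[OF u ws] lin[OF v ws] lin[OF u lin[OF v ws]] 3(1) h Suc.prems(1) standard_span_mono[of n m]
        by (intro standard_span_diff standard_span_top) auto
      have B: "concat_product (concat_product (gen g + u) (gen h + v)) ?w
          - concat_product (concat_product u (gen h) + concat_product (gen h) u) ?w \<in> relation_ideal n"
        by (intro relation_ideal_diff relation_ideal_concat_right relation_ideal_anticommute rel wn un hn)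
      have eq2: "concat_product (concat_product (gen g + u) (gen h + v)) ?w
          - concat_product (concat_product u (gen h) + concat_product (gen h) u) ?w
          = concat_product (concat_product (gen g) (gen h)) ?w - ?r"
        by (simp only: concat_product_add_left concat_product_add_right concat_product_assoc) (simp add: algebra_simps)
      show ?thesis
        unfolding eq by (rule standard_span_cong[OF A B[unfolded eq2]])
    qed
  qed
  obtain s where s: "Poly_Mapping.keys s \<subseteq> standard_words (Suc m)" "t - s \<in> relation_ideal n"
    using Suc.prems(3) by (auto simp: standard_span_def)
  have "concat_product (gen g) s \<in> standard_span n (Suc m)"
    using s(1)
  proof (induction s rule: frag_induction)
    case (diff a b)
    then show ?case by (simp add: concat_product_diff_right standard_span_diff)
  qed (use word in \<open>auto simp: standard_span_0\<close>)
  moreover have "concat_product (gen g) t - concat_product (gen g) s \<in> relation_ideal n"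
    using relation_ideal_concat_left[OF gn(1) s(2)] by (simp add: concat_product_diff_right)
  ultimately show ?case
    by (rule standard_span_cong)
qed

theorem standard_words_generate:
  assumes "t \<in> tensors (gens n)"
  shows "t \<in> standard_span n n"
  using assms unfolding tensors_def mem_Collect_eq
proof (induction t rule: frag_induction)
  case (one w)
  then have "set w \<subseteq> gens n" by auto
  then show ?case
  proof (induction w)
    case Nil
    have "[] \<in> standard_words n" by (induction n) auto
    then show ?case by (intro standard_span_word) auto
  next
    case (Cons g w)
    then have "concat_product (gen g) (frag_of w) \<in> standard_span n n"
      by (intro standard_span_mult) auto
    then show ?case by simp
  qed
next
  case (diff a b)
  then show ?case by (rule standard_span_diff[rotated -2])
qed (rule standard_span_0)

section \<open>Descent to quotients and the isomorphism\<close>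

lemma a_r_cosetE:
  assumes "y \<in> I +>\<^bsub>R\<^esub> x"
  obtains i where "i \<in> I" "y = i \<oplus>\<^bsub>R\<^esub> x"
  using assms unfolding a_r_coset_def' by blast

lemma ring_hom_factor:
  assumes R: "ring R" and S: "ring S" and I: "ideal I R" and h: "h \<in> ring_hom R S"
    and zero: "\<And>x. x \<in> I \<Longrightarrow> h x = \<zero>\<^bsub>S\<^esub>"
  shows "\<exists>h'\<in>ring_hom (R Quot I) S. \<forall>x\<in>carrier R. h' (I +>\<^bsub>R\<^esub> x) = h x"
proof -
  interpret R: ring R by (rule R)
  interpret S: ring S by (rule S)
  interpret I: ideal I R by (rule I)
  interpret hom: ring_hom_ring R S h by (rule ring_hom_ringI2[OF R S h])
  \<comment> \<open>On a coset of the ideal \<open>h\<close> takes a single value, which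
    \<open>the_elem\<close> extracts from the image without choosing a representative.\<close>
  define h' where "h' X = the_elem (h ` X)" for X
  have h': "h' (I +>\<^bsub>R\<^esub> x) = h x" if x: "x \<in> carrier R" for x
  proof -
    have eq: "h y = h x" if y: "y \<in> I +>\<^bsub>R\<^esub> x" for y
    proof -
      obtain i where i: "i \<in> I" "y = i \<oplus>\<^bsub>R\<^esub> x"
        using y by (rule a_r_cosetE)
      show ?thesis
        unfolding i(2) hom.hom_add[OF I.a_Hcarr[OF i(1)] x] zero[OF i(1)]
        by (rule S.l_zero[OF hom.hom_closed[OF x]])
    qed
    have "h ` (I +>\<^bsub>R\<^esub> x) \<subseteq> {h x}"
      by (intro image_subsetI) (simp only: eq singleton_iff)
    moreover have "h x \<in> h ` (I +>\<^bsub>R\<^esub> x)"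
      by (rule imageI[OF I.a_rcos_self[OF x]])
    ultimately have "h ` (I +>\<^bsub>R\<^esub> x) = {h x}"
      by (intro equalityI insert_subsetI empty_subsetI)
    then show ?thesis by (simp add: h'_def)
  qed
  have carrier: "carrier (R Quot I) = (\<lambda>x. I +>\<^bsub>R\<^esub> x) ` carrier R"
    by (auto simp: FactRing_def A_RCOSETS_defs a_r_coset_def)
  have "h' \<in> ring_hom (R Quot I) S"
  proof (rule ring_hom_memI)
    fix X Y assume X: "X \<in> carrier (R Quot I)" and Y: "Y \<in> carrier (R Quot I)"
    then obtain x y where x: "x \<in> carrier R" "X = I +>\<^bsub>R\<^esub> x" and y: "y \<in> carrier R" "Y = I +>\<^bsub>R\<^esub> y"
      by (auto simp: carrier)
    show "h' (X \<otimes>\<^bsub>R Quot I\<^esub> Y) = h' X \<otimes>\<^bsub>S\<^esub> h' Y"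
      using x y by (simp add: FactRing_def I.rcoset_mult_add h')
    show "h' (X \<oplus>\<^bsub>R Quot I\<^esub> Y) = h' X \<oplus>\<^bsub>S\<^esub> h' Y"
      using x y by (simp add: FactRing_def I.a_rcos_sum h')
  next
    show "h' X \<in> carrier S" if "X \<in> carrier (R Quot I)" for X
      using that by (auto simp: carrier h')
    show "h' \<one>\<^bsub>R Quot I\<^esub> = \<one>\<^bsub>S\<^esub>"
      by (simp add: FactRing_def h')
  qed
  then show ?thesis using h' by blast
qed

lemma piecewise_C1_differentiable_mult:
  fixes f g :: "real \<Rightarrow> 'a::real_normed_algebra"
  assumes "f piecewise_C1_differentiable_on A" "g piecewise_C1_differentiable_on A"
  shows "(\<lambda>x. f x * g x) piecewise_C1_differentiable_on A"
proof -
  obtain S T where "finite S" "finite T" "f C1_differentiable_on (A - S)" "g C1_differentiable_on (A - T)"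
    using assms by (auto simp: piecewise_C1_differentiable_on_def)
  then have "finite (S \<union> T) \<and> (\<lambda>x. f x * g x) C1_differentiable_on A - (S \<union> T)"
    by (auto intro: C1_differentiable_on_mult elim!: C1_differentiable_on_subset)
  moreover have "continuous_on A f" "continuous_on A g"
    using assms piecewise_C1_differentiable_on_def by auto
  ultimately show ?thesis
    by (auto simp: piecewise_C1_differentiable_on_def continuous_on_mult)
qed

lemma valid_path_log_arg:
  assumes "\<And>i. valid_path (\<lambda>t. \<gamma> t i)"
  shows "valid_path (log_arg g \<circ> \<gamma>)"
  using assms unfolding valid_path_def
  by (cases g) (auto simp: log_arg_fun o_def intro!: piecewise_C1_differentiable_add piecewise_C1_differentiable_diff
      piecewise_C1_differentiable_mult piecewise_C1_differentiable_const)

lemma gen_cochain_represents_dlog: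
  assumes "g \<in> gens n"
  shows "represents_dlog (M_C n) (log_arg g) (gen_cochain n g)"
  unfolding represents_dlog_def
proof (intro conjI allI impI)
  show "gen_cochain n g \<in> carrier (cocycle_ring (M_C n))"
    using gen_cochain_cocycle[OF assms] by simp
  show "gen_cochain n g p = (\<lambda>\<sigma>. 0)" if "p \<noteq> 1" for p
    using that by (rule winding_cochain_degree)
  fix \<gamma> assume "pathin (M_C n) \<gamma> \<and> \<gamma> 0 = \<gamma> 1 \<and> (\<forall>i. valid_path (\<lambda>t. \<gamma> t i))"
  then show "of_int (gen_cochain n g 1 (path_simplex \<gamma>))
      = contour_integral (log_arg g \<circ> \<gamma>) (\<lambda>w. 1 / (2 * of_real pi * \<i> * w))"
    using nonvanishing_log_arg[OF assms] by (intro winding_cochain_path_simplex valid_path_log_arg) auto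
qed

abbreviation tensor_class :: "nat \<Rightarrow> (generator list \<Rightarrow>\<^sub>0 int) \<Rightarrow> (nat \<Rightarrow> complex) cochain set" where
  "tensor_class n t \<equiv> cohomology_class (M_C n) (ev n t)"

lemma tensor_class_eq_zero_iff:
  assumes "t \<in> tensors (gens n)"
  shows "tensor_class n t = \<zero>\<^bsub>cohomology_ring (M_C n)\<^esub> \<longleftrightarrow> cohomologous (M_C n) (ev n t) 0"
proof -
  interpret ring_hom_ring "cocycle_ring (M_C n)" "cohomology_ring (M_C n)" "cohomology_class (M_C n)"
    by (rule ring_hom_ringI2[OF ring_cocycle_ring ring_cohomology_ring cohomology_class_hom])
  have "\<zero>\<^bsub>cohomology_ring (M_C n)\<^esub> = cohomology_class (M_C n) 0"
    using hom_zero by simp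
  then show ?thesis
    using cohomology_class_eq_iff[OF ev_cocycle[OF assms] cocycles_0] by simp
qed

lemma tensor_class_hom: "tensor_class n \<in> ring_hom (tensor_algebra (gens n)) (cohomology_ring (M_C n))"
  using ring_hom_trans[OF ev_ring_hom cohomology_class_hom] by (simp add: o_def)

text \<open>Linear tensors square to zero in cohomology, so the kernel of evaluation contains the
  ideal generated by these squares and evaluation descends to the exterior algebra.\<close>

lemma exterior_class_exists:
  "\<exists>h\<in>ring_hom (E_C n) (cohomology_ring (M_C n)). \<forall>t\<in>tensors (gens n). h (exterior_proj (gens n) t) = tensor_class n t"
proof -
  interpret ring_hom_ring "tensor_algebra (gens n)" "cohomology_ring (M_C n)" "tensor_class n"
    by (rule ring_hom_ringI2[OF ring_tensor_algebra ring_cohomology_ring tensor_class_hom])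
  have "square_ideal (gens n) \<subseteq> a_kernel (tensor_algebra (gens n)) (cohomology_ring (M_C n)) (tensor_class n)"
    unfolding square_ideal_eq
  proof (rule R.genideal_minimal[OF kernel_is_ideal])
    show "(\<lambda>v. concat_product v v) ` linear_tensors (gens n)
        \<subseteq> a_kernel (tensor_algebra (gens n)) (cohomology_ring (M_C n)) (tensor_class n)"
    proof (intro image_subsetI)
      fix v assume v: "v \<in> linear_tensors (gens n)"
      then have t: "concat_product v v \<in> tensors (gens n)"
        by (simp add: linear_tensors_tensors)
      then have "tensor_class n (concat_product v v) = \<zero>\<^bsub>cohomology_ring (M_C n)\<^esub>"
        unfolding tensor_class_eq_zero_iff[OF t] by (intro ev_linear_square v)
      with t show "concat_product v v \<in> a_kernel (tensor_algebra (gens n)) (cohomology_ring (M_C n)) (tensor_class n)"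
        unfolding a_kernel_def' by simp
    qed
  qed
  then have "tensor_class n t = \<zero>\<^bsub>cohomology_ring (M_C n)\<^esub>" if "t \<in> square_ideal (gens n)" for t
    using that unfolding a_kernel_def' by blast
  from ring_hom_factor[OF ring_tensor_algebra ring_cohomology_ring ideal_square_ideal tensor_class_hom this]
  show ?thesis
    by (simp add: E_C_def exterior_algebra_def exterior_proj_def)
qed

theorem theorem7p2p2:
  fixes n :: nat
  assumes "n \<ge> 1"
  shows "\<exists>\<Phi> \<in> ring_iso (E_C n Quot I_C n) (cohomology_ring (M_C n)).
           \<forall>g \<in> gens n. is_dlog_class (M_C n) (log_arg g) (\<Phi> (I_C n +>\<^bsub>E_C n\<^esub> E_gen n g))"
proof -
  let ?H = "cohomology_ring (M_C n)" and ?p = "exterior_proj (gens n)"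
  obtain h where h: "h \<in> ring_hom (E_C n) ?H" and h_proj: "\<And>t. t \<in> tensors (gens n) \<Longrightarrow> h (?p t) = tensor_class n t"
    using exterior_class_exists[of n] by blast
  interpret h: ring_hom_ring "E_C n" ?H h
    by (rule ring_hom_ringI2[OF ring_E_C ring_cohomology_ring h])
  have "I_C n \<subseteq> a_kernel (E_C n) ?H h"
    unfolding I_C_eq
  proof (rule h.R.genideal_minimal[OF h.kernel_is_ideal])
    show "exterior_relations n \<subseteq> a_kernel (E_C n) ?H h"
    proof
      fix x assume x: "x \<in> exterior_relations n"
      then obtain y where y: "y \<in> tensor_relations n" "x = ?p y"
        unfolding exterior_relations_eq by blast
      have yt: "y \<in> tensors (gens n)"
        using y(1) tensor_relations_closed by blast
      then have "h x = \<zero>\<^bsub>?H\<^esub>"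
        using tensor_relations_ev[OF y(1)] by (simp add: y(2) h_proj tensor_class_eq_zero_iff)
      moreover have "x \<in> carrier (E_C n)"
        by (rule subsetD[OF exterior_relations_closed x])
      ultimately show "x \<in> a_kernel (E_C n) ?H h"
        unfolding a_kernel_def' by simp
    qed
  qed
  then have h_I_C: "h x = \<zero>\<^bsub>?H\<^esub>" if "x \<in> I_C n" for x
    using that unfolding a_kernel_def' by blast
  from ring_hom_factor[OF ring_E_C ring_cohomology_ring ideal_I_C h this]
  obtain \<Phi> where \<Phi>: "\<Phi> \<in> ring_hom (E_C n Quot I_C n) ?H"
    and \<Phi>_proj: "\<And>X. X \<in> carrier (E_C n) \<Longrightarrow> \<Phi> (I_C n +>\<^bsub>E_C n\<^esub> X) = h X"
    by blast
  interpret I: ideal "I_C n" "E_C n" by (rule ideal_I_C)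
  interpret \<Phi>: ring_hom_ring "E_C n Quot I_C n" ?H \<Phi>
    by (rule ring_hom_ringI2[OF I.quotient_is_ring ring_cohomology_ring \<Phi>])
  have \<Phi>_class: "\<Phi> (I_C n +>\<^bsub>E_C n\<^esub> ?p t) = tensor_class n t" if "t \<in> tensors (gens n)" for t
    using that by (simp add: \<Phi>_proj carrier_E_C h_proj)
  have carrier: "carrier (E_C n Quot I_C n) = (\<lambda>t. I_C n +>\<^bsub>E_C n\<^esub> ?p t) ` tensors (gens n)"
    unfolding FactRing_def A_RCOSETS_defs a_r_coset_def[symmetric] using carrier_E_C by auto
  have "inj_on \<Phi> (carrier (E_C n Quot I_C n))"
  proof (rule \<Phi>.trivial_ker_imp_inj)
    have "x = \<zero>\<^bsub>E_C n Quot I_C n\<^esub>" if x: "x \<in> carrier (E_C n Quot I_C n)" and "\<Phi> x = \<zero>\<^bsub>?H\<^esub>" for x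
    proof -
      obtain t where t: "t \<in> tensors (gens n)" "x = I_C n +>\<^bsub>E_C n\<^esub> ?p t"
        using x carrier by auto
      \<comment> \<open>A standard representative \<open>s\<close> of the same element. It differs
        from \<open>t\<close> by the ideal, which maps to zero, so its class vanishes along with
        that of \<open>t\<close>; independence of the standard words then kills each of its
        coefficients.\<close>
      obtain s where s: "Poly_Mapping.keys s \<subseteq> standard_words n" "t - s \<in> relation_ideal n"
        using standard_words_generate[OF t(1)] by (auto simp: standard_span_def)
      have st: "s \<in> tensors (gens n)"
        using tensors_diff[OF t(1) relation_ideal_tensors[OF s(2)]] by simp
      have "?p (t - s) \<in> I_C n" "t - s \<in> tensors (gens n)"
        using s(2) by (auto simp: relation_ideal_def)
      then have "tensor_class n (t - s) = \<zero>\<^bsub>?H\<^esub>"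
        using h_I_C[of "?p (t - s)"] h_proj[of "t - s"] by simp
      then have "cohomologous (M_C n) (ev n (t - s)) 0"
        using \<open>t - s \<in> tensors (gens n)\<close> by (simp add: tensor_class_eq_zero_iff)
      moreover have "cohomologous (M_C n) (ev n t) 0"
        using \<open>\<Phi> x = \<zero>\<^bsub>?H\<^esub>\<close> t by (simp add: \<Phi>_class tensor_class_eq_zero_iff)
      ultimately have "cohomologous (M_C n) (ev n t - ev n (t - s)) (0 - 0)"
        by (intro cohomologous_diff)
      then have "cohomologous (M_C n) (ev n s) 0"
        by (simp add: extend_words_diff)
      then have "Poly_Mapping.lookup s w = 0" if "w \<in> standard_words n" for w
        using standard_words_independent[of n "Poly_Mapping.lookup s" w] that by (simp only: ev_standard[OF s(1)])
      then have "s = 0"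
        using s(1) by (intro poly_mapping_eqI) (metis in_keys_iff lookup_zero subsetD)
      then have "t \<in> relation_ideal n"
        using s(2) by simp
      then have "?p t \<in> I_C n"
        by (simp add: relation_ideal_def)
      then show ?thesis
        unfolding t(2) using h.R.a_rcos_zero[OF ideal_I_C] by (simp add: FactRing_def)
    qed
    then show "a_kernel (E_C n Quot I_C n) ?H \<Phi> = {\<zero>\<^bsub>E_C n Quot I_C n\<^esub>}"
      unfolding a_kernel_def' using \<Phi>.hom_zero \<Phi>.R.zero_closed by blast
  qed
  moreover have "\<Phi> ` carrier (E_C n Quot I_C n) = carrier ?H"
  proof
    show "\<Phi> ` carrier (E_C n Quot I_C n) \<subseteq> carrier ?H"
      by auto
    show "carrier ?H \<subseteq> \<Phi> ` carrier (E_C n Quot I_C n)"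
    proof
      fix c assume "c \<in> carrier ?H"
      then obtain u where u: "u \<in> cocycles (M_C n)" "c = cohomology_class (M_C n) u"
        by (auto simp: carrier_cohomology_ring)
      obtain k where k: "cohomologous (M_C n) u (word_combination n k)"
        using standard_words_span[OF u(1)] by blast
      \<comment> \<open>The tensor with the coefficients found in cohomology: surjectivity needs
        standard words only.\<close>
      define t where "t = (\<Sum>w\<in>standard_words n. frag_cmul (k w) (frag_of w))"
      have lookup: "Poly_Mapping.lookup t w = (if w \<in> standard_words n then k w else 0)" for w
        by (simp add: t_def lookup_sum finite_standard_words if_distrib sum.delta cong: if_cong)
      have keys: "Poly_Mapping.keys t \<subseteq> standard_words n"
        by (auto simp: in_keys_iff lookup split: if_splits)
      then have t: "t \<in> tensors (gens n)"
        using standard_words_gens by (fastforce simp: tensors_def)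
      have "ev n t = word_combination n k"
        unfolding ev_standard[OF keys] by (intro sum.cong) (auto simp: lookup)
      then have "c = tensor_class n t"
        using k u cohomology_class_eq_iff[OF u(1) word_combination_cocycle] by simp
      then show "c \<in> \<Phi> ` carrier (E_C n Quot I_C n)"
        using \<Phi>_class[OF t] t carrier by auto
    qed
  qed
  ultimately have "\<Phi> \<in> ring_iso (E_C n Quot I_C n) ?H"
    using \<Phi> by (simp add: ring_iso_def bij_betw_def)
  moreover have "is_dlog_class (M_C n) (log_arg g) (\<Phi> (I_C n +>\<^bsub>E_C n\<^esub> E_gen n g))" if g: "g \<in> gens n" for g
  proof -
    have "E_gen n g = ?p (gen g)"
      by (simp add: E_gen_def exterior_gen_def exterior_proj_def)
    then have "\<Phi> (I_C n +>\<^bsub>E_C n\<^esub> E_gen n g) = cohomology_class (M_C n) (gen_cochain n g)"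
      using \<Phi>_class[of "gen g"] g gen_cochain_cocycle[OF g] by simp
    then show ?thesis
      unfolding is_dlog_class_def cohomology_class_def using gen_cochain_represents_dlog[OF g] by blast
  qed
  ultimately show ?thesis by blast
qed

end
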